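(* Let $T=(\pi,\lambda)$ be a self-similar IET of hyperbolic periodic type on $[0,1)$, let $\omega\in\mathbb R^{\mathcal A}$ be of central-stable type, and let $f\in\operatorname{Aff}(T,\omega)$. Let $\mu_f$ be the $f$-invariant probability measure. Then $$\dim_H(\mu_f)=\frac{\rho_T}{\mathcal G(T,\omega)}\in(0,1),$$ where $$\mathcal G(T,\omega)=\rho_c-\sum_{\alpha\in\mathcal A}\ \sum_{0\le i<q^{(N)}_\alpha}\theta_{\beta(\alpha,i)}\,e^{-\rho_T}\lambda_\alpha\,\Big(S_i\phi_{\omega_c}\big|_{I^{(N)}_\alpha}\Big).$$
   Context: **AIETs.** Let $\mathcal A$ be a finite alphabet with $d\ge 2$ letters. A permutation is a pair $\pi=(\pi_t,\pi_b)$ of bijections $\mathcal A\to\{1,\dots,d\}$, always assumed irreducible: $\pi_t^{-1}\{1,\dots,k\}\ne\pi_b^{-1}\{1,\dots,k\}$ for $1\le k<d$. An affine interval exchange transformation (AIET) $f=(\pi,\lambda,\omega)$, with $\lambda\in\mathbb R_{>0}^{\mathcal A}$ and log-slope vector $\omega\in\mathbb R^{\mathcal A}$, is a bijection of $I=[0,\sum_\alpha\lambda_\alpha)$ which maps each interval of the partition of $I$ into left-closed right-open intervals $I_\alpha=I_\alpha(f)$ of lengths $\lambda_\alpha$ (ordered from left to right according to $\pi_t$) affinely with slope $e^{\omega_\alpha}$, the images $f(I_\alpha)$ being ordered from left to right according to $\pi_b$. An IET $T=(\pi,\lambda)$ is an AIET with $\omega=0$. **Rauzy–Veech induction.** Put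 $\alpha(\varepsilon)=\pi_\varepsilon^{-1}(d)$, $\varepsilon\in\{t,b\}$. If $|I_{\alpha(t)}|>|f(I_{\alpha(b)})|$ (top type, winner $\alpha(t)$), set $I^{(1)}=I\setminus f(I_{\alpha(b)})$, $I^{(1)}_{\alpha(t)}=I_{\alpha(t)}\setminus f(I_{\alpha(b)})$ and $I^{(1)}_\alpha=I_\alpha$ for the other letters. If $|I_{\alpha(t)}|<|f(I_{\alpha(b)})|$ (bottom type, winner $\alpha(b)$), set $I^{(1)}=I\setminus I_{\alpha(t)}$, $I^{(1)}_{\alpha(t)}=f^{-1}(I_{\alpha(t)})$, $I^{(1)}_{\alpha(b)}=I_{\alpha(b)}\setminus f^{-1}(I_{\alpha(t)})$ and $I^{(1)}_\alpha=I_\alpha$ for the other letters. The first return map of $f$ to $I^{(1)}$ is an AIET exchanging the $I^{(1)}_\alpha$. If this can be iterated forever (no equality of lengths occurs), $f$ is infinitely renormalizable; one gets intervals $I^{(n)}$, $I^{(n)}_\alpha=I^{(n)}_\alpha(f)$, permutations $\pi^{(n)}$ and return times $q^{(n)}_\alpha$ such that the first return map of $f$ to $I^{(n)}$ equals $f^{q^{(n)}_\alpha}$ on $I^{(n)}_\alpha$. The combinatorial rotation number $\gamma(f)$ is the infinite sequence of pairs ($\pi^{(n)}$, type of step $n$), $n\ge0$; it is $\infty$-complete if every letter is a winner infinitely often. **Hyperbolic periodic type.** An IET $T=(\pi,\lambda)$ on $[0,1)$ is self-similar if $\gamma(T)$ is $\infty$-complete and periodic. For a period $N$, the self-similarity matrix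 is $M=M(T)$, $M_{\alpha\beta}=\#\{0\le k<q^{(N)}_\alpha: T^kI^{(N)}_\alpha\subset I_\beta\}$; then $\lambda M=e^{\rho_T}\lambda$, where $\rho_T>0$ is the logarithm of the Perron–Frobenius eigenvalue of $M$, and $I^{(N)}_\alpha=e^{-\rho_T}I_\alpha$. Let $\Omega_\pi$ be the matrix with $(\Omega_\pi)_{\alpha\beta}=1$ if $\pi_b(\alpha)>\pi_b(\beta),\pi_t(\alpha)<\pi_t(\beta)$; $-1$ if $\pi_b(\alpha)<\pi_b(\beta),\pi_t(\alpha)>\pi_t(\beta)$; $0$ otherwise; put $\kappa-1=\dim\ker\Omega_\pi$ and $2g=d-(\kappa-1)$. $T$ is of hyperbolic periodic type (hyperbolically self-similar) if it is self-similar and $M$ has $g$ simple real eigenvalues of modulus $>1$ and $g$ simple real eigenvalues of modulus $<1$, all with pairwise distinct moduli, and eigenvalue $1$ with $\kappa-1$ independent fixed vectors; so $\mathbb R^{\mathcal A}$ has a basis of right eigenvectors of $M$: $g$ expanding, $g$ contracting, $\kappa-1$ fixed. Convention: $N$ is replaced by a multiple so that all entries and all eigenvalues of $M$ are positive. Self-similar IETs are uniquely ergodic. **Types.** Let $\langle\omega,\lambda\rangle=0$. $\omega$ is of central-stable type if in its decomposition in the eigenbasis of $M$ at least one fixed but no expanding eigenvector occurs; then $\omega=\omega_c+\omega_s$ with $M\omega_c=\omega_c\neq0$ and $\omega_s$ a combination of contracting eigenvectors. **Aff.** $\operatorname{Aff}(T,\omega)$ is the set of AIETs $f$ on $[0,1)$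 with log-slope vector $\omega$ and $\gamma(f)=\gamma(T)$; equivalently (known fact) $f$ is semi-conjugated to $T$ by a continuous non-decreasing surjection $h$ of $[0,1)$ with $h\circ f=T\circ h$ respecting the Rauzy–Veech combinatorics. Such $f$ is uniquely ergodic, with invariant probability measure $\mu_f$. **Notation in the formula.** $I_\alpha,I^{(N)}_\alpha,q^{(N)}_\alpha$ refer to $T$. For $v\in\mathbb R^{\mathcal A}$, $\phi_v:[0,1)\to\mathbb R$ equals $v_\alpha$ on $I_\alpha$, and $S_i\phi(x)=\sum_{0\le k<i}\phi(T^kx)$, which for $\phi=\phi_v$ and $0\le i\le q^{(N)}_\alpha$ is constant on $I^{(N)}_\alpha$. $\beta(\alpha,i)$ is the unique letter with $T^iI^{(N)}_\alpha\subset I_{\beta(\alpha,i)}$. $\theta\in\mathbb R^{\mathcal A}_{>0}$ is the right Perron–Frobenius eigenvector of $M$ ($M\theta=e^{\rho_T}\theta$) with $\langle\lambda,\theta\rangle=1$. $M(v)$ is the positive matrix $M(v)_{\alpha\beta}=\sum_{0\le k<q^{(N)}_\alpha,\ \beta(\alpha,k)=\beta}e^{S_k\phi_v|_{I^{(N)}_\alpha}}$, and $\rho_c$ is the logarithm of the Perron–Frobenius eigenvalue of $M(\omega_c)$. **Dimension.** For a Borel probability $\mu$ on $\mathbb R$, $\dim_H(\mu)=\inf\{\dim_H(E): E\text{ Borel},\ \mu(E)=1\}$. *)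

theory Defs
  imports "HOL-Analysis.Analysis" "HOL-Probability.Probability_Measure"
    "HOL-Computational_Algebra.Polynomial"
begin

section \<open>Hausdorff dimension\<close>

text \<open>The case distinction is there because \<open>0 powr 0 = 0\<close>: for exponent 0 every nonempty set
  must have cost 1, so that the measure of exponent 0 is the counting measure.\<close>

definition hausdorff_cost :: "real \<Rightarrow> 'a::metric_space set \<Rightarrow> ennreal" where
  "hausdorff_cost s U = (if U = {} then 0 else if s = 0 then 1 else ennreal (diameter U powr s))"

definition hausdorff_premeasure :: "real \<Rightarrow> real \<Rightarrow> 'a::metric_space set \<Rightarrow> ennreal" where
  "hausdorff_premeasure s \<delta> E = Inf {\<Sum>i. hausdorff_cost s (U i) | U :: nat \<Rightarrow> 'a set.
     E \<subseteq> (\<Union>i. U i) \<and> (\<forall>i. bounded (U i) \<and> diameter (U i) \<le> \<delta>)}"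

definition hausdorff_measure :: "real \<Rightarrow> 'a::metric_space set \<Rightarrow> ennreal" where
  "hausdorff_measure s E = (SUP \<delta>\<in>{0<..}. hausdorff_premeasure s \<delta> E)"

definition hausdorff_dim :: "'a::metric_space set \<Rightarrow> ennreal" where
  "hausdorff_dim E = Inf {ennreal s | s. 0 \<le> s \<and> hausdorff_measure s E = 0}"

definition measure_hausdorff_dim :: "real measure \<Rightarrow> ennreal" where
  "measure_hausdorff_dim \<mu> = Inf {hausdorff_dim E | E. E \<in> sets borel \<and> emeasure \<mu> E = 1}"


section \<open>Eigenvalues\<close>

definition eigenvalue :: "'k::field^'n^'n \<Rightarrow> 'k \<Rightarrow> bool" where
  "eigenvalue A r \<longleftrightarrow> (\<exists>v. v \<noteq> 0 \<and> A *v v = r *s v)"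

definition charpoly :: "'k::field^'n^'n \<Rightarrow> 'k poly" where
  "charpoly A = det (\<chi> i j. (if i = j then [:0, 1:] else 0) - [:A $ i $ j:])"

definition simple_eigenvalue :: "'k::field^'n^'n \<Rightarrow> 'k \<Rightarrow> bool" where
  "simple_eigenvalue A r \<longleftrightarrow> eigenvalue A r \<and> order r (charpoly A) = 1"

definition complex_matrix :: "real^'n^'m \<Rightarrow> complex^'n^'m" where
  "complex_matrix A = (\<chi> i j. complex_of_real (A $ i $ j))"

text \<open>The Perron--Frobenius eigenvalue: the real eigenvalue that is maximal in modulus among all
  complex eigenvalues.\<close>

definition pf_eigenvalue :: "real^'n^'n \<Rightarrow> real" where
  "pf_eigenvalue A = (THE r. eigenvalue A r \<and> (\<forall>z. eigenvalue (complex_matrix A) z \<longrightarrow> cmod z \<le> r))"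

definition expanding_space :: "real^'n^'n \<Rightarrow> (real^'n) set" where
  "expanding_space A = span {v. \<exists>r. \<bar>r\<bar> > 1 \<and> A *v v = r *s v}"

definition contracting_space :: "real^'n^'n \<Rightarrow> (real^'n) set" where
  "contracting_space A = span {v. \<exists>r. \<bar>r\<bar> < 1 \<and> A *v v = r *s v}"

definition fixed_space :: "real^'n^'n \<Rightarrow> (real^'n) set" where
  "fixed_space A = {v. A *v v = v}"

text \<open>\<open>v = u + c + s\<close> splits the expansion of \<open>v\<close> in a basis of eigenvectors into its expanding,
  fixed and contracting parts; this does not depend on the basis.\<close>

definition eigen_splitting ::
    "real^'n^'n \<Rightarrow> real^'n \<Rightarrow> real^'n \<Rightarrow> real^'n \<Rightarrow> real^'n \<Rightarrow> bool" where
  "eigen_splitting A v u c s \<longleftrightarrow>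
     v = u + c + s \<and> u \<in> expanding_space A \<and> c \<in> fixed_space A \<and> s \<in> contracting_space A"

definition central_part :: "real^'n^'n \<Rightarrow> real^'n \<Rightarrow> real^'n" where
  "central_part A v = (THE c. \<exists>u s. eigen_splitting A v u c s)"


section \<open>Affine interval exchange transformations\<close>

text \<open>The fields are \<open>\<pi>\<^sub>t\<close>, \<open>\<pi>\<^sub>b\<close>, \<open>\<lambda>\<close> and \<open>\<omega>\<close>; the alphabet is the finite type \<open>'a\<close>.\<close>

record ('a::finite) aiet =
  pos_t :: "'a \<Rightarrow> nat"
  pos_b :: "'a \<Rightarrow> nat"
  lengths :: "real^'a"
  slopes :: "real^'a"

definition irreducible_perm :: "('a::finite \<Rightarrow> nat) \<Rightarrow> ('a \<Rightarrow> nat) \<Rightarrow> bool" where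
  "irreducible_perm pt pb \<longleftrightarrow>
     bij_betw pt UNIV {1..CARD('a)} \<and> bij_betw pb UNIV {1..CARD('a)} \<and>
     (\<forall>k. 1 \<le> k \<and> k < CARD('a) \<longrightarrow> pt -` {1..k} \<noteq> pb -` {1..k})"

definition total_length :: "('a::finite) aiet \<Rightarrow> real" where
  "total_length f = (\<Sum>\<alpha>\<in>UNIV. lengths f $ \<alpha>)"

definition domain :: "('a::finite) aiet \<Rightarrow> real set" where
  "domain f = {0..<total_length f}"

definition left_t :: "('a::finite) aiet \<Rightarrow> 'a \<Rightarrow> real" where
  "left_t f \<alpha> = (\<Sum>\<beta> | pos_t f \<beta> < pos_t f \<alpha>. lengths f $ \<beta>)"

definition left_b :: "('a::finite) aiet \<Rightarrow> 'a \<Rightarrow> real" where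
  "left_b f \<alpha> = (\<Sum>\<beta> | pos_b f \<beta> < pos_b f \<alpha>. exp (slopes f $ \<beta>) * lengths f $ \<beta>)"

definition interval :: "('a::finite) aiet \<Rightarrow> 'a \<Rightarrow> real set" where
  "interval f \<alpha> = {left_t f \<alpha> ..< left_t f \<alpha> + lengths f $ \<alpha>}"

definition letter :: "('a::finite) aiet \<Rightarrow> real \<Rightarrow> 'a" where
  "letter f x = (THE \<alpha>. x \<in> interval f \<alpha>)"

text \<open>The transformation itself, extended by the identity outside its domain.\<close>

definition aiet_map :: "('a::finite) aiet \<Rightarrow> real \<Rightarrow> real" where
  "aiet_map f x =
     (if x \<in> domain f
      then left_b f (letter f x) + exp (slopes f $ letter f x) * (x - left_t f (letter f x))
      else x)"

definition is_aiet :: "('a::finite) aiet \<Rightarrow> bool" where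
  "is_aiet f \<longleftrightarrow> irreducible_perm (pos_t f) (pos_b f) \<and> (\<forall>\<alpha>. lengths f $ \<alpha> > 0) \<and>
     bij_betw (aiet_map f) (domain f) (domain f)"

definition is_iet :: "('a::finite) aiet \<Rightarrow> bool" where
  "is_iet T \<longleftrightarrow> is_aiet T \<and> slopes T = 0"


section \<open>Rauzy--Veech induction\<close>

definition return_time :: "(real \<Rightarrow> real) \<Rightarrow> real set \<Rightarrow> real \<Rightarrow> nat" where
  "return_time F J x = (LEAST k. 0 < k \<and> (F ^^ k) x \<in> J)"

definition first_return :: "(real \<Rightarrow> real) \<Rightarrow> real set \<Rightarrow> real \<Rightarrow> real" where
  "first_return F J x = (F ^^ return_time F J x) x"

datatype rv_type = Top | Bottom

definition last_t :: "('a::finite) aiet \<Rightarrow> 'a" where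
  "last_t f = inv (pos_t f) CARD('a)"

definition last_b :: "('a::finite) aiet \<Rightarrow> 'a" where
  "last_b f = inv (pos_b f) CARD('a)"

text \<open>Since \<open>f\<close> is affine on \<open>I\<^sub>\<alpha>\<close>, the length of \<open>f(I\<^sub>\<alpha>)\<close> is \<open>exp \<omega>\<^sub>\<alpha> * \<lambda>\<^sub>\<alpha>\<close>.\<close>

definition renormalizable :: "('a::finite) aiet \<Rightarrow> bool" where
  "renormalizable f \<longleftrightarrow>
     lengths f $ last_t f \<noteq> exp (slopes f $ last_b f) * lengths f $ last_b f"

definition rv_step_type :: "('a::finite) aiet \<Rightarrow> rv_type" where
  "rv_step_type f =
     (if lengths f $ last_t f > exp (slopes f $ last_b f) * lengths f $ last_b f
      then Top else Bottom)"

definition rv_domain :: "('a::finite) aiet \<Rightarrow> real set" where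
  "rv_domain f = (case rv_step_type f of
      Top \<Rightarrow> domain f - aiet_map f ` interval f (last_b f)
    | Bottom \<Rightarrow> domain f - interval f (last_t f))"

definition rv_interval :: "('a::finite) aiet \<Rightarrow> 'a \<Rightarrow> real set" where
  "rv_interval f \<alpha> = (case rv_step_type f of
      Top \<Rightarrow> if \<alpha> = last_t f then interval f \<alpha> - aiet_map f ` interval f (last_b f)
             else interval f \<alpha>
    | Bottom \<Rightarrow> if \<alpha> = last_t f then aiet_map f -` interval f (last_t f)
                else if \<alpha> = last_b f then interval f \<alpha> - aiet_map f -` interval f (last_t f)
                else interval f \<alpha>)"

text \<open>The AIET exchanging the new intervals which is the first return map to their union.\<close>

definition rv_next :: "('a::finite) aiet \<Rightarrow> 'a aiet" where
  "rv_next f = (THE g. is_aiet g \<and> domain g = rv_domain f \<and>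
     (\<forall>\<alpha>. interval g \<alpha> = rv_interval f \<alpha>) \<and>
     (\<forall>x\<in>rv_domain f. aiet_map g x = first_return (aiet_map f) (rv_domain f) x))"

definition rv_iter :: "nat \<Rightarrow> ('a::finite) aiet \<Rightarrow> 'a aiet" where
  "rv_iter n f = (rv_next ^^ n) f"

definition infinitely_renormalizable :: "('a::finite) aiet \<Rightarrow> bool" where
  "infinitely_renormalizable f \<longleftrightarrow> (\<forall>n. renormalizable (rv_iter n f))"

text \<open>The combinatorial rotation number; only meaningful for infinitely renormalizable AIETs.\<close>

definition rotation_number ::
    "('a::finite) aiet \<Rightarrow> nat \<Rightarrow> (('a \<Rightarrow> nat) \<times> ('a \<Rightarrow> nat)) \<times> rv_type" where
  "rotation_number f n =
     ((pos_t (rv_iter n f), pos_b (rv_iter n f)), rv_step_type (rv_iter n f))"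

definition winner :: "('a::finite) aiet \<Rightarrow> nat \<Rightarrow> 'a" where
  "winner f n = (case rv_step_type (rv_iter n f) of
      Top \<Rightarrow> last_t (rv_iter n f) | Bottom \<Rightarrow> last_b (rv_iter n f))"

definition infinity_complete :: "('a::finite) aiet \<Rightarrow> bool" where
  "infinity_complete f \<longleftrightarrow> infinitely_renormalizable f \<and> (\<forall>\<alpha>. \<exists>\<^sub>\<infinity>n. winner f n = \<alpha>)"

definition is_period :: "('a::finite) aiet \<Rightarrow> nat \<Rightarrow> bool" where
  "is_period T N \<longleftrightarrow> 0 < N \<and> (\<forall>n. rotation_number T (n + N) = rotation_number T n)"

definition rv_height :: "('a::finite) aiet \<Rightarrow> nat \<Rightarrow> 'a \<Rightarrow> nat" where
  "rv_height f n \<alpha> = (THE q. \<forall>x\<in>interval (rv_iter n f) \<alpha>.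
     return_time (aiet_map f) (domain (rv_iter n f)) x = q)"

definition self_similarity_matrix :: "('a::finite) aiet \<Rightarrow> nat \<Rightarrow> real^'a^'a" where
  "self_similarity_matrix T N = (\<chi> \<alpha> \<beta>. real (card {k. k < rv_height T N \<alpha> \<and>
     (aiet_map T ^^ k) ` interval (rv_iter N T) \<alpha> \<subseteq> interval T \<beta>}))"


section \<open>Hyperbolic periodic type\<close>

definition self_similar :: "('a::finite) aiet \<Rightarrow> bool" where
  "self_similar T \<longleftrightarrow> is_iet T \<and> total_length T = 1 \<and> infinity_complete T \<and> (\<exists>N. is_period T N)"

definition Omega :: "('a::finite) aiet \<Rightarrow> real^'a^'a" where
  "Omega T = (\<chi> \<alpha> \<beta>.
     if pos_b T \<alpha> > pos_b T \<beta> \<and> pos_t T \<alpha> < pos_t T \<beta> then 1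
     else if pos_b T \<alpha> < pos_b T \<beta> \<and> pos_t T \<alpha> > pos_t T \<beta> then -1
     else 0)"

text \<open>This is \<open>\<kappa> - 1\<close>.\<close>

definition kernel_dim :: "('a::finite) aiet \<Rightarrow> nat" where
  "kernel_dim T = dim {v. Omega T *v v = 0}"

text \<open>The division is exact, since \<open>Omega T\<close> is antisymmetric and so has even rank.\<close>

definition genus :: "('a::finite) aiet \<Rightarrow> nat" where
  "genus T = (CARD('a) - kernel_dim T) div 2"

text \<open>Together with \<open>\<kappa> - 1\<close> independent fixed vectors, the eigenvalues in \<open>E\<close> and \<open>C\<close> exhaust the
  spectrum, since \<open>2 * g + (\<kappa> - 1) = CARD('a)\<close>.\<close>

definition hyperbolic_matrix :: "('a::finite) aiet \<Rightarrow> real^'a^'a \<Rightarrow> bool" where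
  "hyperbolic_matrix T M \<longleftrightarrow>
     (\<exists>E C. finite E \<and> finite C \<and> card E = genus T \<and> card C = genus T \<and>
        (\<forall>r\<in>E. simple_eigenvalue M r \<and> \<bar>r\<bar> > 1) \<and>
        (\<forall>r\<in>C. simple_eigenvalue M r \<and> \<bar>r\<bar> < 1) \<and>
        inj_on abs (E \<union> C)) \<and>
     dim (fixed_space M) = kernel_dim T"

definition hyperbolic_periodic_type :: "('a::finite) aiet \<Rightarrow> bool" where
  "hyperbolic_periodic_type T \<longleftrightarrow>
     self_similar T \<and> (\<exists>N. is_period T N \<and> hyperbolic_matrix T (self_similarity_matrix T N))"

text \<open>The periods allowed by the convention that all entries and all (complex) eigenvalues of the
  self-similarity matrix are positive.\<close>

definition positive_period :: "('a::finite) aiet \<Rightarrow> nat \<Rightarrow> bool" where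
  "positive_period T N \<longleftrightarrow> is_period T N \<and>
     (\<forall>\<alpha> \<beta>. self_similarity_matrix T N $ \<alpha> $ \<beta> > 0) \<and>
     (\<forall>z. eigenvalue (complex_matrix (self_similarity_matrix T N)) z \<longrightarrow> z \<in> \<real> \<and> Re z > 0)"

definition central_stable_type :: "('a::finite) aiet \<Rightarrow> nat \<Rightarrow> real^'a \<Rightarrow> bool" where
  "central_stable_type T N \<omega> \<longleftrightarrow> \<omega> \<bullet> lengths T = 0 \<and>
     (\<exists>c s. eigen_splitting (self_similarity_matrix T N) \<omega> 0 c s \<and> c \<noteq> 0)"

definition Aff :: "('a::finite) aiet \<Rightarrow> real^'a \<Rightarrow> 'a aiet set" where
  "Aff T \<omega> = {f. is_aiet f \<and> total_length f = 1 \<and> slopes f = \<omega> \<and>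
     infinitely_renormalizable f \<and> rotation_number f = rotation_number T}"

definition invariant_prob :: "('a::finite) aiet \<Rightarrow> real measure \<Rightarrow> bool" where
  "invariant_prob f \<mu> \<longleftrightarrow> prob_space \<mu> \<and> sets \<mu> = sets borel \<and> emeasure \<mu> (domain f) = 1 \<and>
     distr \<mu> borel (aiet_map f) = \<mu>"


section \<open>The quantities in the dimension formula\<close>

definition rho :: "('a::finite) aiet \<Rightarrow> nat \<Rightarrow> real" where
  "rho T N = ln (pf_eigenvalue (self_similarity_matrix T N))"

definition theta :: "('a::finite) aiet \<Rightarrow> nat \<Rightarrow> real^'a" where
  "theta T N = (THE v. (\<forall>\<alpha>. v $ \<alpha> > 0) \<and>
     self_similarity_matrix T N *v v = exp (rho T N) *s v \<and> lengths T \<bullet> v = 1)"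

definition phi :: "('a::finite) aiet \<Rightarrow> real^'a \<Rightarrow> real \<Rightarrow> real" where
  "phi T v x = v $ letter T x"

definition birkhoff_sum :: "(real \<Rightarrow> real) \<Rightarrow> nat \<Rightarrow> (real \<Rightarrow> real) \<Rightarrow> real \<Rightarrow> real" where
  "birkhoff_sum F i h x = (\<Sum>k<i. h ((F ^^ k) x))"

text \<open>The constant value of the \<open>i\<close>-th Birkhoff sum of \<open>\<phi>\<^sub>v\<close> on the interval of \<open>\<alpha>\<close> at level \<open>N\<close>.\<close>

definition tower_sum :: "('a::finite) aiet \<Rightarrow> nat \<Rightarrow> real^'a \<Rightarrow> nat \<Rightarrow> 'a \<Rightarrow> real" where
  "tower_sum T N v i \<alpha> =
     (THE c. \<forall>x\<in>interval (rv_iter N T) \<alpha>. birkhoff_sum (aiet_map T) i (phi T v) x = c)"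

definition tower_letter :: "('a::finite) aiet \<Rightarrow> nat \<Rightarrow> 'a \<Rightarrow> nat \<Rightarrow> 'a" where
  "tower_letter T N \<alpha> i =
     (THE \<beta>. (aiet_map T ^^ i) ` interval (rv_iter N T) \<alpha> \<subseteq> interval T \<beta>)"

definition weighted_matrix :: "('a::finite) aiet \<Rightarrow> nat \<Rightarrow> real^'a \<Rightarrow> real^'a^'a" where
  "weighted_matrix T N v = (\<chi> \<alpha> \<beta>.
     \<Sum>k | k < rv_height T N \<alpha> \<and> tower_letter T N \<alpha> k = \<beta>. exp (tower_sum T N v k \<alpha>))"

definition G_const :: "('a::finite) aiet \<Rightarrow> nat \<Rightarrow> real^'a \<Rightarrow> real" where
  "G_const T N \<omega> = (let \<omega>c = central_part (self_similarity_matrix T N) \<omega> in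
     ln (pf_eigenvalue (weighted_matrix T N \<omega>c)) -
     (\<Sum>\<alpha>\<in>UNIV. \<Sum>i<rv_height T N \<alpha>.
        theta T N $ tower_letter T N \<alpha> i * exp (- rho T N) * lengths T $ \<alpha> * tower_sum T N \<omega>c i \<alpha>))"

end

theory Submission
  imports Defs
begin

text \<open>The maps \<open>f\<close> and \<open>T\<close> have the same dynamical partitions, coded by the iterates of one substitution
  \<open>\<sigma>\<close> whose matrix is \<open>M\<close>. The number of floors of level \<open>k\<close> and the inverse of their \<open>\<mu>\<close>-mass are of
  order \<open>exp (k \<rho>\<^sub>T)\<close>. The stable part of \<open>\<omega>\<close> changes log-lengths of floors by a bounded amount, so the
  length of a floor is of order \<open>exp (S - k \<rho>\<^sub>c)\<close>, where \<open>S\<close> is a Birkhoff sum of \<open>\<omega>\<^sub>c\<close>. An exponential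
  large deviation bound for \<open>S\<close>, obtained by perturbing the right Perron--Frobenius eigenvector of \<open>M\<close> to
  first order, shows that almost every point lies, for all large \<open>k\<close>, in a floor of length
  \<open>exp (- k (G + o(1)))\<close>. The covering by these floors gives the upper bound. For the lower bound a set
  of diameter \<open>d\<close> meets at most two of the disjoint floors that are longer than \<open>d\<close>, so no control of
  neighbouring floors is needed. Finally \<open>\<rho>\<^sub>T < G\<close> is the strict case of Gibbs' inequality: equality
  would make \<open>\<omega>\<^sub>c\<close> a coboundary of a function that is constant, since all towers of a high level
  start in the leftmost interval.\<close>


section \<open>Perron--Frobenius eigenvectors and eigenspaces\<close>

text \<open>Counting floors suffices because all floors of one tower have equal \<mu>-mass, at most
  of order 1 / r^k at level k: exponentially few exceptional floors among about r^k have summable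
  mass, and Borel-Cantelli applies. The double sum in \<open>G_const\<close> is the drift of S per
  level when floors are chosen with the Perron-Frobenius weights of M. Since M \<omega>_c =
  \<omega>_c, a full word of any level again has total \<omega>_c, so the single matrix
  M(\<omega>_c) governs the partition sums of all levels; this is the origin of \<rho>_c. The rate
  of the deviation bound comes from a small tilt t > 0 and a positive vector u with M(t \<omega>_c)
  u \<le> R u; an inequality is easier to perturb than an eigenvalue. The obstacle at the start is
  that the induction, the return times and the tower sums are definite descriptions about real maps.
  A step of the induction is therefore made explicit and recorded as words that depend on
  permutations and type alone; equal rotation numbers then give T and f literally equal words. That
  the lengths of T form a left eigenvector of M is derived from the periodicity of the rotation
  number.\<close>

definition pf_vector :: "real^'n^'n \<Rightarrow> real \<Rightarrow> real^'n \<Rightarrow> bool" where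
  "pf_vector A r v \<longleftrightarrow> (\<forall>i. v $ i > 0) \<and> A *v v = r *s v"

text \<open>Brouwer's theorem for x \<mapsto> A x / |A x|_1 on the standard simplex; a fixed point
  lies in the image of A and is therefore strictly positive.\<close>

lemma pf_vector_exists:
  fixes A :: "real^'n^'n"
  assumes pos: "\<And>i j. A $ i $ j > 0"
  shows "\<exists>r v. r > 0 \<and> pf_vector A r v"
proof -
  let ?S = "{x::real^'n. (\<forall>i. x $ i \<ge> 0) \<and> (\<Sum>i\<in>UNIV. x $ i) = 1}"
  let ?s = "\<lambda>x::real^'n. \<Sum>i\<in>UNIV. (A *v x) $ i"
  let ?f = "\<lambda>x. (1 / ?s x) *\<^sub>R (A *v x)"
  have Apos: "(A *v x) $ i > 0" if "x \<in> ?S" for x :: "real^'n" and i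
  proof -
    from that have "\<exists>j. x $ j > 0"
      by (metis (mono_tags, lifting) less_eq_real_def mem_Collect_eq sum.neutral zero_neq_one)
    then obtain j where "x $ j > 0" by blast
    then show ?thesis using that pos unfolding matrix_vector_mult_def
      by (auto intro!: sum_pos2[where i=j] mult_nonneg_nonneg simp: less_imp_le)
  qed
  have spos: "?s x > 0" if "x \<in> ?S" for x :: "real^'n"
    using Apos[OF that] by (intro sum_pos) auto
  have closed: "closed ?S"
    by (intro closed_Collect_conj closed_Collect_all closed_Collect_le closed_Collect_eq
        continuous_intros)
  have "x \<in> cbox 0 1" if "x \<in> ?S" for x :: "real^'n"
  proof -
    have "x $ i \<le> 1" for i
      using that member_le_sum[of i UNIV "\<lambda>i. x $ i"] by auto
    then show ?thesis using that by (auto simp: mem_box_cart)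
  qed
  then have "bounded ?S" using bounded_cbox bounded_subset by blast
  with closed have comp: "compact ?S" by (simp add: compact_eq_bounded_closed)
  have conv: "convex ?S"
    unfolding convex_def
    by (auto simp: sum.distrib sum_distrib_left[symmetric])
  have "(axis undefined 1 :: real^'n) \<in> ?S" by (auto simp: axis_def)
  then have ne: "?S \<noteq> {}" by blast
  have cont: "continuous_on ?S ?f"
    using spos by (intro continuous_intros matrix_vector_mult_linear_continuous_on) (auto simp: less_le)
  have maps: "?f ` ?S \<subseteq> ?S"
  proof safe
    fix x :: "real^'n" and i assume "\<forall>i. 0 \<le> x $ i" "(\<Sum>i\<in>UNIV. x $ i) = 1"
    then have x: "x \<in> ?S" by blast
    show "0 \<le> ?f x $ i" using Apos[OF x, of i] spos[OF x] by (simp add: less_imp_le)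
    show "(\<Sum>i\<in>UNIV. ?f x $ i) = 1"
      using spos[OF x] by (simp add: sum_divide_distrib[symmetric])
  qed
  obtain x :: "real^'n" where x: "x \<in> ?S" "?f x = x" using brouwer[OF comp conv ne cont] maps by blast
  have eq: "A *v x = ?s x *s x"
    using spos[OF x(1)] x(2) 
    by (metis (no_types, lifting) divide_inverse mult_1 order_less_irrefl right_inverse scaleR_one
        scaleR_scaleR vector_mul_rcancel vector_scalar_mult_def scalar_mult_eq_scaleR)
  have "x $ i > 0" for i
    using Apos[OF x(1), of i] spos[OF x(1)] eq
    by (metis vector_smult_component zero_less_mult_pos)
  then show ?thesis unfolding pf_vector_def using eq spos[OF x(1)] by blast
qed

text \<open>The pairing of \<open>u\<close> with \<open>A *v v\<close> can be evaluated from both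
  sides, and \<open>u \<bullet> v\<close> is positive.\<close>

lemma pf_value_unique_transpose:
  fixes A :: "real^'n^'n"
  assumes "pf_vector A r v" "pf_vector (transpose A) s u"
  shows "r = s"
proof -
  have "r * (u \<bullet> v) = u \<bullet> (A *v v)" using assms by (simp add: pf_vector_def scalar_mult_eq_scaleR)
  also have "\<dots> = (transpose A *v u) \<bullet> v" by (simp add: dot_lmul_matrix)
  also have "\<dots> = s * (u \<bullet> v)"
    using assms by (simp add: pf_vector_def scalar_mult_eq_scaleR)
  finally have "r * (u \<bullet> v) = s * (u \<bullet> v)" .
  moreover have "u \<bullet> v > 0"
    using assms unfolding inner_vec_def pf_vector_def by (intro sum_pos) auto
  ultimately show ?thesis by simp
qed

text \<open>Among the multiples of \<open>v\<close> that stay below \<open>w\<close> take the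
  largest. The difference has nonnegative entries and a zero entry, and there a strictly positive
  row of A annihilates it only if it is zero. Since \<open>w\<close> may have any signs, the
  eigenspace is one-dimensional.\<close>

lemma pf_vector_unique:
  fixes A :: "real^'n^'n"
  assumes pos: "\<And>i j. A $ i $ j > 0" and v: "pf_vector A r v" and w: "A *v w = r *s w"
  shows "\<exists>c. w = c *s v"
proof -
  define c where "c = Min (range (\<lambda>i. w $ i / v $ i))"
  have "c \<in> range (\<lambda>i. w $ i / v $ i)" unfolding c_def by (rule Min_in) auto
  then obtain i0 where i0: "c = w $ i0 / v $ i0" by blast
  have cle: "c \<le> w $ i / v $ i" for i unfolding c_def by (rule Min_le) auto
  have vp: "v $ i > 0" for i using v by (simp add: pf_vector_def)
  define z where "z = w - c *s v"
  have z0: "z $ i \<ge> 0" for i using cle[of i] vp[of i] by (simp add: z_def field_simps)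
  have zi0: "z $ i0 = 0" using i0 vp[of i0] by (simp add: z_def)
  have "A *v z = r *s z"
    using v w unfolding z_def pf_vector_def
    by (simp add: matrix_vector_mult_diff_distrib vector_scalar_commute vector_ssub_ldistrib mult.commute)
  then have "(A *v z) $ i0 = 0" using zi0 by simp
  then have "(\<Sum>j\<in>UNIV. A $ i0 $ j * z $ j) = 0" by (simp add: matrix_vector_mult_def)
  then have "\<forall>j\<in>UNIV. A $ i0 $ j * z $ j = 0"
    using z0 pos by (subst (asm) sum_nonneg_eq_0_iff) (auto simp: less_imp_le)
  then have "z = 0" using pos by (auto simp: vec_eq_iff) (metis less_irrefl)
  then have "w = c *s v" by (simp add: z_def)
  then show ?thesis by blast
qed

text \<open>Pairing the moduli of the entries of an eigenvector with the positive left eigenvector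
  \<open>u\<close> turns the entrywise triangle inequality |z| |w| \<le> A |w| into a scalar
  one.\<close>

lemma pf_eigenvalue_bound:
  fixes A :: "real^'n^'n"
  assumes pos: "\<And>i j. A $ i $ j > 0" and u: "pf_vector (transpose A) r u"
    and z: "eigenvalue (complex_matrix A) z"
  shows "cmod z \<le> r"
proof -
  obtain w where w: "w \<noteq> 0" "complex_matrix A *v w = z *s w" using z by (auto simp: eigenvalue_def)
  have up: "u $ i > 0" for i using u by (simp add: pf_vector_def)
  have ul: "(\<Sum>i\<in>UNIV. A $ i $ j * u $ i) = r * u $ j" for j
  proof -
    have "(transpose A *v u) $ j = r * u $ j" using u by (simp add: pf_vector_def)
    then show ?thesis by (simp add: matrix_vector_mult_def transpose_def del: transpose_matrix_vector)
  qed
  have "cmod z * (\<Sum>i\<in>UNIV. u $ i * cmod (w $ i)) = (\<Sum>i\<in>UNIV. u $ i * cmod ((z *s w) $ i))"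
    by (simp add: sum_distrib_left norm_mult mult_ac)
  also have "\<dots> = (\<Sum>i\<in>UNIV. u $ i * cmod (\<Sum>j\<in>UNIV. complex_of_real (A $ i $ j) * w $ j))"
    unfolding w(2)[symmetric] by (simp add: matrix_vector_mult_def complex_matrix_def)
  also have "\<dots> \<le> (\<Sum>i\<in>UNIV. u $ i * (\<Sum>j\<in>UNIV. A $ i $ j * cmod (w $ j)))"
  proof (intro sum_mono mult_left_mono)
    fix i
    show "cmod (\<Sum>j\<in>UNIV. complex_of_real (A $ i $ j) * w $ j) \<le> (\<Sum>j\<in>UNIV. A $ i $ j * cmod (w $ j))"
      using pos by (intro order.trans[OF norm_sum] sum_mono) (simp add: norm_mult less_imp_le)
  qed (use up in \<open>simp add: less_imp_le\<close>)
  also have "\<dots> = (\<Sum>i\<in>UNIV. \<Sum>j\<in>UNIV. (A $ i $ j * u $ i) * cmod (w $ j))"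
    by (simp add: sum_distrib_left mult_ac)
  also have "\<dots> = (\<Sum>j\<in>UNIV. (\<Sum>i\<in>UNIV. A $ i $ j * u $ i) * cmod (w $ j))"
    by (subst sum.swap) (simp add: sum_distrib_right)
  also have "\<dots> = r * (\<Sum>i\<in>UNIV. u $ i * cmod (w $ i))" unfolding ul by (simp add: sum_distrib_left mult.assoc)
  finally have "cmod z * (\<Sum>i\<in>UNIV. u $ i * cmod (w $ i)) \<le> r * (\<Sum>i\<in>UNIV. u $ i * cmod (w $ i))" .
  moreover have "(\<Sum>i\<in>UNIV. u $ i * cmod (w $ i)) > 0"
  proof -
    obtain j where "w $ j \<noteq> 0" using w(1) by (auto simp: vec_eq_iff)
    then show ?thesis using up by (intro sum_pos2[where i=j]) (auto simp: less_imp_le)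
  qed
  ultimately show ?thesis by simp
qed

text \<open>A positive eigenvector certifies the spectral radius: a positive left eigenvector exists
  by transposition, has the same eigenvalue, and bounds all complex eigenvalues.\<close>

lemma pf_eigenvalue_eq:
  fixes A :: "real^'n^'n"
  assumes pos: "\<And>i j. A $ i $ j > 0" and v: "pf_vector A r v"
  shows "pf_eigenvalue A = r"
proof -
  obtain s u where u: "pf_vector (transpose A) s u"
    using pf_vector_exists[of "transpose A"] pos by (auto simp: transpose_def)
  have s: "s = r" using pf_value_unique_transpose[OF v u] by simp
  have complex_ev: "eigenvalue (complex_matrix A) (complex_of_real t)" if "eigenvalue A t" for t
  proof -
    obtain w where w: "w \<noteq> 0" "A *v w = t *s w" using \<open>eigenvalue A t\<close> by (auto simp: eigenvalue_def)
    let ?w = "\<chi> i. complex_of_real (w $ i)"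
    have "(complex_matrix A *v ?w) $ i = (complex_of_real t *s ?w) $ i" for i
    proof -
      have "(complex_matrix A *v ?w) $ i = complex_of_real ((A *v w) $ i)"
        by (simp add: matrix_vector_mult_def complex_matrix_def)
      then show ?thesis using w(2) by simp
    qed
    then have "complex_matrix A *v ?w = complex_of_real t *s ?w" by (simp add: vec_eq_iff)
    moreover have "?w \<noteq> 0" using w(1) by (auto simp: vec_eq_iff)
    ultimately show ?thesis unfolding eigenvalue_def by blast
  qed
  have bnd: "cmod z \<le> r" if "eigenvalue (complex_matrix A) z" for z
    using pf_eigenvalue_bound[OF pos u that] s by simp
  have "v \<noteq> 0" using v by (metis pf_vector_def zero_index less_irrefl)
  then have ev: "eigenvalue A r" using v unfolding eigenvalue_def pf_vector_def by blast
  show ?thesis unfolding pf_eigenvalue_def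
  proof (rule the_equality)
    show "eigenvalue A r \<and> (\<forall>z. eigenvalue (complex_matrix A) z \<longrightarrow> cmod z \<le> r)"
      using ev bnd by blast
    fix t assume t: "eigenvalue A t \<and> (\<forall>z. eigenvalue (complex_matrix A) z \<longrightarrow> cmod z \<le> t)"
    have "t \<le> r" using bnd[OF complex_ev[of t]] t by simp
    moreover have "r \<le> t" using t complex_ev[OF ev] by fastforce
    ultimately show "t = r" by simp
  qed
qed

text \<open>The Fredholm alternative for the one-dimensional left kernel of \<open>A - r\<close>.\<close>

lemma pf_corrector:
  fixes A :: "real^'n^'n"
  assumes pos: "\<And>i j. A $ i $ j > 0" and u: "pf_vector (transpose A) r u" and y: "u \<bullet> y = 0"
  shows "\<exists>w. A *v w = r *s w + y"
proof -
  let ?L = "\<lambda>w. A *v w - r *s w"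
  have lin: "linear ?L"
    by (intro linearI)
      (simp_all add: matrix_vector_right_distrib vector_add_ldistrib scalar_mult_eq_scaleR
        matrix_vector_mult_scaleR algebra_simps)
  have "y \<in> range ?L"
  proof (rule ccontr)
    assume ny: "y \<notin> range ?L"
    have sub: "subspace (range ?L)" by (rule linear_subspace_image[OF lin subspace_UNIV])
    \<comment> \<open>The component \<open>z\<close> of \<open>y\<close> orthogonal to the range is
      a left eigenvector for \<open>r\<close>, hence a multiple of \<open>u\<close>, hence
      orthogonal to \<open>y\<close>.\<close>
    obtain a z where az: "a \<in> span (range ?L)" "\<And>w. w \<in> span (range ?L) \<Longrightarrow> orthogonal z w" "y = a + z"
      by (rule orthogonal_subspace_decomp_exists[of "range ?L" y]) blast
    have a: "a \<in> range ?L" using az(1) sub by (metis span_eq_iff)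
    have z: "z \<bullet> ?L w = 0" for w using az(2) by (simp add: orthogonal_def span_base)
    have "(transpose A *v z - r *s z) \<bullet> w = 0" for w
    proof -
      have "(transpose A *v z) \<bullet> w = z \<bullet> (A *v w)"
        by (simp add: dot_lmul_matrix)
      then show ?thesis using z[of w] by (simp add: inner_diff_left inner_diff_right scalar_mult_eq_scaleR)
    qed
    then have "transpose A *v z - r *s z = 0" by (metis inner_eq_zero_iff)
    then have "transpose A *v z = r *s z" by simp
    then obtain c where c: "z = c *s u"
      using pf_vector_unique[of "transpose A" r u z] pos u by (auto simp: transpose_def)
    have "a \<bullet> z = 0" using az(1,2) by (metis orthogonal_def inner_commute)
    moreover have "y \<bullet> z = 0" using c y by (simp add: scalar_mult_eq_scaleR inner_commute)
    ultimately have "z \<bullet> z = 0" using az(3) by (simp add: inner_add_left)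
    then have "y = a" using az(3) by simp
    then show False using a ny by blast
  qed
  then obtain w where "y = A *v w - r *s w" by blast
  then have "A *v w = r *s w + y" by simp
  then show ?thesis by blast
qed

text \<open>On each contracting eigenvector the iterates decay geometrically, and summability passes
  to linear combinations. Later the stable part enters through this summability alone.\<close>

lemma contracting_summable:
  fixes A :: "real^'n^'n"
  assumes "s \<in> contracting_space A"
  shows "summable (\<lambda>k. norm (((*v) A ^^ k) s))"
proof -
  have lin: "linear ((*v) A ^^ k)" for k
  proof (induction k)
    case 0
    show ?case by (simp add: linear_id[unfolded id_def] id_def)
  next
    case (Suc k)
    show ?case using linear_compose[OF Suc matrix_vector_mul_linear[of A]] by (simp add: o_def)
  qed
  have eig: "((*v) A ^^ k) v = (r ^ k) *s v" if "A *v v = r *s v" for k r v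
    by (induction k) (auto simp: that vector_scalar_commute)
  show ?thesis using assms unfolding contracting_space_def
  proof (induction rule: span_induct_alt)
    case base
    then show ?case using linear_0[OF lin] by simp
  next
    case (step c x y)
    then obtain r where r: "\<bar>r\<bar> < 1" "A *v x = r *s x" by blast
    have "summable (\<lambda>k. \<bar>c\<bar> * norm x * \<bar>r\<bar> ^ k + norm (((*v) A ^^ k) y))"
      using r(1) step.IH by (intro summable_add summable_mult summable_geometric) auto
    then show ?case
    proof (rule summable_comparison_test'[where N=0])
      fix k
      have "((*v) A ^^ k) (c *\<^sub>R x + y) = c *\<^sub>R (r ^ k *s x) + ((*v) A ^^ k) y"
        using linear_add[OF lin, of k] linear_scale[OF lin, of k c x] eig[OF r(2), of k] by simp
      then have "norm (((*v) A ^^ k) (c *\<^sub>R x + y)) \<le> norm (c *\<^sub>R (r ^ k *s x)) + norm (((*v) A ^^ k) y)"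
        by (metis norm_triangle_ineq)
      then show "norm (norm (((*v) A ^^ k) (c *\<^sub>R x + y))) \<le> \<bar>c\<bar> * norm x * \<bar>r\<bar> ^ k + norm (((*v) A ^^ k) y)"
        by (simp add: scalar_mult_eq_scaleR abs_mult power_abs mult_ac)
    qed
  qed
qed

text \<open>A product of factors \<open>A - r\<close> with \<open>r \<noteq> 1\<close> kills a combination of eigenvectors for eigenvalues
  other than 1, but only rescales a fixed vector.\<close>

lemma fixed_in_nonfixed_span:
  fixes A :: "real^'n^'n"
  assumes v: "v \<in> span {v. \<exists>r. r \<noteq> 1 \<and> A *v v = r *s v}" and fixv: "A *v v = v"
  shows "v = 0"
proof -
  \<comment> \<open>The factors A - r commute, so a factor that kills one summand can be moved to
    act first.\<close>
  define P where "P = (\<lambda>rs. foldr (\<lambda>r v. A *v v - r *s v) rs)"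
  have P_simps: "P [] v = v" "P (r # rs) v = A *v P rs v - r *s P rs v" for r rs v
    by (simp_all add: P_def)
  have P_append: "P (rs @ qs) v = P rs (P qs v)" for rs qs v by (simp add: P_def)
  have P_add: "P rs (v + w) = P rs v + P rs w" for rs v w
    by (induction rs) (simp_all add: P_simps matrix_vector_right_distrib vector_add_ldistrib)
  have P_scale: "P rs (c *\<^sub>R v) = c *\<^sub>R P rs v" for rs v c
    by (induction rs) (simp_all add: P_simps matrix_vector_mult_scaleR scalar_mult_eq_scaleR algebra_simps)
  have P_A: "P rs (A *v v) = A *v P rs v" for rs v
    by (induction rs) (simp_all add: P_simps matrix_vector_mult_diff_distrib vector_scalar_commute)
  have P_comm1: "P rs (A *v v - r *s v) = A *v P rs v - r *s P rs v" for rs r v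
    using P_add[of rs "A *v v - r *s v" "r *s v"] P_A[of rs v] P_scale[of rs r v]
    by (simp add: scalar_mult_eq_scaleR algebra_simps)
  have P_comm: "P rs (P qs v) = P qs (P rs v)" for rs qs v
    by (induction qs) (simp_all add: P_simps P_comm1)
  have P_0: "P rs 0 = 0" for rs using P_scale[of rs 0 0] by simp
  have "\<exists>rs. 1 \<notin> set rs \<and> P rs v = 0"
    using v
  proof (induction rule: span_induct_alt)
    case base
    show ?case by (intro exI[of _ "[]"]) (simp add: P_simps)
  next
    case (step c x y)
    then obtain r rs where "r \<noteq> 1" "A *v x = r *s x" "1 \<notin> set rs" "P rs y = 0" by blast
    then have "P ([r] @ rs) (c *\<^sub>R x + y) = 0"
      unfolding P_add P_scale
      using P_comm[of "[r]" rs x] by (simp add: P_append P_simps(1,2) P_0)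
    moreover have "1 \<notin> set ([r] @ rs)" using \<open>r \<noteq> 1\<close> \<open>1 \<notin> set rs\<close> by auto
    ultimately show ?case by blast
  qed
  then obtain rs where rs: "1 \<notin> set rs" "P rs v = 0" by blast
  have "P rs v = (\<Prod>r\<leftarrow>rs. 1 - r) *\<^sub>R v"
    by (induction rs) (simp_all add: P_simps matrix_vector_mult_scaleR fixv scalar_mult_eq_scaleR algebra_simps)
  moreover have "(\<Prod>r\<leftarrow>rs. 1 - r) \<noteq> 0" using rs(1) by (auto simp: prod_list_zero_iff)
  ultimately show ?thesis using rs(2) by simp
qed

text \<open>Two candidates differ by a fixed vector that is also a combination of expanding and
  contracting eigenvectors, hence by zero.\<close>

lemma central_part_eq:
  fixes A :: "real^'n^'n"
  assumes "eigen_splitting A v u c s"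
  shows "central_part A v = c"
  unfolding central_part_def
proof (rule the_equality)
  show "\<exists>u s. eigen_splitting A v u c s" using assms by blast
  fix c' assume "\<exists>u s. eigen_splitting A v u c' s"
  then obtain u' s' where c': "eigen_splitting A v u' c' s'" by blast
  let ?S = "{v. \<exists>r. r \<noteq> 1 \<and> A *v v = r *s v}"
  have "expanding_space A \<subseteq> span ?S" "contracting_space A \<subseteq> span ?S"
    unfolding expanding_space_def contracting_space_def
    by (intro span_mono Collect_mono; metis abs_one less_irrefl)+
  then have "(u - u') + (s - s') \<in> span ?S"
    using assms c' unfolding eigen_splitting_def by (intro span_add span_diff) auto
  moreover have "c' - c = (u - u') + (s - s')"
    using assms c' unfolding eigen_splitting_def by (simp add: algebra_simps)
  moreover have "A *v (c' - c) = c' - c"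
    using assms c' unfolding eigen_splitting_def fixed_space_def
    by (simp add: matrix_vector_mult_diff_distrib)
  ultimately have "c' - c = 0" using fixed_in_nonfixed_span[of "c' - c" A] by simp
  then show "c' = c" by simp
qed


section \<open>Affine interval exchanges\<close>

text \<open>Common form of \<open>left_t\<close> and \<open>left_b\<close>, so that facts on the
  partition of the domain and on that of the image are proved once.\<close>

definition prefix_sum :: "('a::finite \<Rightarrow> nat) \<Rightarrow> ('a \<Rightarrow> real) \<Rightarrow> 'a \<Rightarrow> real" where
  "prefix_sum p l \<alpha> = (\<Sum>\<beta> | p \<beta> < p \<alpha>. l \<beta>)"

lemma prefix_sum_step:
  assumes inj: "inj p" and pos: "\<And>\<alpha>. l \<alpha> > (0::real)" and less: "p \<alpha> < p \<beta>"
  shows "prefix_sum p l \<alpha> + l \<alpha> \<le> prefix_sum p l \<beta>"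
proof -
  have "prefix_sum p l \<alpha> + l \<alpha> = (\<Sum>\<gamma>\<in>insert \<alpha> {\<gamma>. p \<gamma> < p \<alpha>}. l \<gamma>)"
    by (simp add: prefix_sum_def)
  also have "\<dots> \<le> prefix_sum p l \<beta>"
    unfolding prefix_sum_def using less pos by (intro sum_mono2) (auto simp: less_imp_le)
  finally show ?thesis .
qed

lemma prefix_sum_disjoint:
  assumes inj: "inj p" and pos: "\<And>\<alpha>. l \<alpha> > (0::real)"
    and x: "prefix_sum p l \<alpha> \<le> x" "x < prefix_sum p l \<alpha> + l \<alpha>"
      "prefix_sum p l \<beta> \<le> x" "x < prefix_sum p l \<beta> + l \<beta>"
  shows "\<alpha> = \<beta>"
proof (rule ccontr)
  assume "\<alpha> \<noteq> \<beta>"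
  then have "p \<alpha> < p \<beta> \<or> p \<beta> < p \<alpha>" using inj by (metis injD linorder_neqE_nat)
  then show False
    using prefix_sum_step[of p l \<alpha> \<beta>, OF inj pos] prefix_sum_step[of p l \<beta> \<alpha>, OF inj pos] x by auto
qed

lemma prefix_sum_nonneg: "(\<And>\<alpha>. l \<alpha> > (0::real)) \<Longrightarrow> prefix_sum p l \<alpha> \<ge> 0"
  unfolding prefix_sum_def by (intro sum_nonneg) (auto simp: less_imp_le)

lemma prefix_sum_le_total:
  assumes pos: "\<And>\<alpha>. l \<alpha> > (0::real)"
  shows "prefix_sum p l \<alpha> + l \<alpha> \<le> (\<Sum>\<beta>\<in>UNIV. l \<beta>)"
proof -
  have "prefix_sum p l \<alpha> + l \<alpha> = (\<Sum>\<gamma>\<in>insert \<alpha> {\<gamma>. p \<gamma> < p \<alpha>}. l \<gamma>)"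
    by (simp add: prefix_sum_def)
  also have "\<dots> \<le> (\<Sum>\<beta>\<in>UNIV. l \<beta>)"
    using pos by (intro sum_mono2) (auto simp: less_imp_le)
  finally show ?thesis .
qed

text \<open>The letter sought is the last one in the order \<open>p\<close> whose interval starts at
  or before \<open>x\<close>: its right end is the start of the next interval, or the total
  length.\<close>

lemma prefix_sum_cover:
  assumes inj: "inj p" and pos: "\<And>\<alpha>. l \<alpha> > (0::real)"
    and x: "0 \<le> x" "x < (\<Sum>\<beta>\<in>UNIV. l \<beta>)"
  shows "\<exists>\<alpha>. prefix_sum p l \<alpha> \<le> x \<and> x < prefix_sum p l \<alpha> + l \<alpha>"
proof -
  let ?S = "{\<alpha>. prefix_sum p l \<alpha> \<le> x}"
  obtain \<alpha>0 where a0: "\<And>\<beta>. p \<alpha>0 \<le> p \<beta>"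
    using ex_has_least_nat[of "\<lambda>_. True" _ p] by blast
  have "\<alpha>0 \<in> ?S" using x a0 by (simp add: prefix_sum_def not_less[symmetric])
  then obtain \<alpha> where a: "\<alpha> \<in> ?S" "\<And>\<beta>. \<beta> \<in> ?S \<Longrightarrow> p \<beta> \<le> p \<alpha>"
    using ex_has_greatest_nat[of "\<lambda>\<alpha>. \<alpha> \<in> ?S" \<alpha>0 p "Suc (Max (range p))"]
    by (auto simp: less_Suc_eq_le)
  have sumeq: "prefix_sum p l \<alpha> + l \<alpha> = (\<Sum>\<gamma> | p \<gamma> \<le> p \<alpha>. l \<gamma>)"
  proof -
    have "{\<gamma>. p \<gamma> \<le> p \<alpha>} = insert \<alpha> {\<gamma>. p \<gamma> < p \<alpha>}" using inj by (auto dest: injD simp: le_less)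
    then show ?thesis by (simp add: prefix_sum_def)
  qed
  have "x < prefix_sum p l \<alpha> + l \<alpha>"
  proof (rule ccontr)
    assume "\<not> ?thesis"
    then have le: "(\<Sum>\<gamma> | p \<gamma> \<le> p \<alpha>. l \<gamma>) \<le> x" using sumeq by simp
    show False
    proof (cases "\<exists>\<beta>. p \<alpha> < p \<beta>")
      case True
      then obtain \<beta> where b: "p \<alpha> < p \<beta>" "\<And>\<gamma>. p \<alpha> < p \<gamma> \<Longrightarrow> p \<beta> \<le> p \<gamma>"
        using ex_has_least_nat[of "\<lambda>\<beta>. p \<alpha> < p \<beta>" _ p] by blast
      have "{\<gamma>. p \<gamma> < p \<beta>} = {\<gamma>. p \<gamma> \<le> p \<alpha>}" using b by (auto simp: not_le[symmetric])
      then have "\<beta> \<in> ?S" using le by (simp add: prefix_sum_def)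
      then show False using a(2)[of \<beta>] b(1) by simp
    next
      case False
      then have "{\<gamma>. p \<gamma> \<le> p \<alpha>} = UNIV" by (auto simp: not_less)
      then show False using le x by simp
    qed
  qed
  then show ?thesis using a(1) by blast
qed

lemma left_t_prefix: "left_t f \<alpha> = prefix_sum (pos_t f) (($) (lengths f)) \<alpha>"
  by (simp add: left_t_def prefix_sum_def)

lemma left_b_prefix:
  "left_b f \<alpha> = prefix_sum (pos_b f) (\<lambda>\<beta>. exp (slopes f $ \<beta>) * lengths f $ \<beta>) \<alpha>"
  by (simp add: left_b_def prefix_sum_def)

text \<open>Bijectivity in \<open>is_aiet\<close> is replaced by an identity between lengths, which
  for an induced map can be checked by computation; \<open>aiet_data_iff\<close> shows that the two
  notions agree.\<close>

locale aiet_data =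
  fixes f :: "('a::finite) aiet"
  assumes irr: "irreducible_perm (pos_t f) (pos_b f)"
    and pos: "\<And>\<alpha>. lengths f $ \<alpha> > 0"
    and total: "(\<Sum>\<alpha>\<in>UNIV. exp (slopes f $ \<alpha>) * lengths f $ \<alpha>) = total_length f"
begin

lemma inj_t: "inj (pos_t f)" and inj_b: "inj (pos_b f)"
  using irr by (auto simp: irreducible_perm_def bij_betw_def)

lemma interval_iff: "x \<in> interval f \<alpha> \<longleftrightarrow> left_t f \<alpha> \<le> x \<and> x < left_t f \<alpha> + lengths f $ \<alpha>"
  by (simp add: interval_def)

lemma interval_unique: "x \<in> interval f \<alpha> \<Longrightarrow> x \<in> interval f \<beta> \<Longrightarrow> \<alpha> = \<beta>"
  unfolding interval_iff left_t_prefix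
  using prefix_sum_disjoint[of "pos_t f" "($) (lengths f)", OF inj_t pos] by blast

lemma domain_eq: "domain f = (\<Union>\<alpha>. interval f \<alpha>)"
proof safe
  fix x assume "x \<in> domain f"
  then have "0 \<le> x" "x < (\<Sum>\<beta>\<in>UNIV. lengths f $ \<beta>)" by (auto simp: domain_def total_length_def)
  from prefix_sum_cover[of "pos_t f" "($) (lengths f)", OF inj_t pos this] show "x \<in> (\<Union>\<alpha>. interval f \<alpha>)"
    by (auto simp: interval_iff left_t_prefix)
next
  fix x \<alpha> assume "x \<in> interval f \<alpha>"
  then show "x \<in> domain f"
    using prefix_sum_nonneg[of "($) (lengths f)" "pos_t f" \<alpha>, OF pos]
      prefix_sum_le_total[of "($) (lengths f)" "pos_t f" \<alpha>, OF pos]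
    by (auto simp: interval_iff domain_def total_length_def left_t_prefix)
qed

lemma interval_domain: "x \<in> interval f \<alpha> \<Longrightarrow> x \<in> domain f"
  using domain_eq by blast

lemma letter_eq: "x \<in> interval f \<alpha> \<Longrightarrow> letter f x = \<alpha>"
  unfolding letter_def using interval_unique by blast

lemma map_interval:
  "x \<in> interval f \<alpha> \<Longrightarrow> aiet_map f x = left_b f \<alpha> + exp (slopes f $ \<alpha>) * (x - left_t f \<alpha>)"
  by (simp add: aiet_map_def letter_eq interval_domain)

lemma map_outside: "x \<notin> domain f \<Longrightarrow> aiet_map f x = x"
  by (simp add: aiet_map_def)

definition image_interval :: "'a \<Rightarrow> real set" where
  "image_interval \<alpha> = {left_b f \<alpha> ..< left_b f \<alpha> + exp (slopes f $ \<alpha>) * lengths f $ \<alpha>}"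

lemma map_in_image: "x \<in> interval f \<alpha> \<Longrightarrow> aiet_map f x \<in> image_interval \<alpha>"
proof -
  assume x: "x \<in> interval f \<alpha>"
  then have "exp (slopes f $ \<alpha>) * (x - left_t f \<alpha>) < exp (slopes f $ \<alpha>) * lengths f $ \<alpha>"
    by (intro mult_strict_left_mono) (auto simp: interval_iff)
  then show ?thesis using x map_interval[OF x] by (simp add: image_interval_def interval_iff)
qed

lemma image_interval_preimage:
  assumes "y \<in> image_interval \<alpha>"
  shows "\<exists>x\<in>interval f \<alpha>. aiet_map f x = y"
proof -
  let ?e = "exp (slopes f $ \<alpha>)"
  let ?x = "left_t f \<alpha> + (y - left_b f \<alpha>) / ?e"
  have "?x \<in> interval f \<alpha>" using assms by (simp add: interval_iff image_interval_def field_simps)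
  moreover from this have "aiet_map f ?x = y" by (simp add: map_interval)
  ultimately show ?thesis by blast
qed

lemma image_interval_unique: "x \<in> image_interval \<alpha> \<Longrightarrow> x \<in> image_interval \<beta> \<Longrightarrow> \<alpha> = \<beta>"
  unfolding image_interval_def left_b_prefix
  using prefix_sum_disjoint[OF inj_b, of "\<lambda>\<beta>. exp (slopes f $ \<beta>) * lengths f $ \<beta>"] pos by auto

lemma domain_eq_images: "domain f = (\<Union>\<alpha>. image_interval \<alpha>)"
proof safe
  let ?l = "\<lambda>\<beta>. exp (slopes f $ \<beta>) * lengths f $ \<beta>"
  have lpos: "?l \<beta> > 0" for \<beta> using pos by simp
  {
    fix x assume "x \<in> domain f"
    then have "0 \<le> x" "x < (\<Sum>\<beta>\<in>UNIV. ?l \<beta>)" by (auto simp: domain_def total)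
    from prefix_sum_cover[of "pos_b f" ?l, OF inj_b lpos this] show "x \<in> (\<Union>\<alpha>. image_interval \<alpha>)"
      by (auto simp: image_interval_def left_b_prefix)
  }
  fix x \<alpha> assume "x \<in> image_interval \<alpha>"
  then show "x \<in> domain f"
    using prefix_sum_nonneg[of ?l "pos_b f" \<alpha>, OF lpos]
      prefix_sum_le_total[of ?l "pos_b f" \<alpha>, OF lpos]
    by (auto simp: image_interval_def domain_def total left_b_prefix)
qed

lemma map_domain: "x \<in> domain f \<Longrightarrow> aiet_map f x \<in> domain f"
  using map_in_image by (auto simp: domain_eq) (use domain_eq domain_eq_images in blast)

text \<open>Global injectivity, thanks to the identity outside the domain: iterates can be cancelled
  and preimages formed without reference to the domain.\<close>

lemma map_inj: "inj (aiet_map f)"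
proof (rule injI)
  fix x y assume eq: "aiet_map f x = aiet_map f y"
  consider "x \<notin> domain f" | "y \<notin> domain f" | "x \<in> domain f" "y \<in> domain f" by blast
  then show "x = y"
  proof cases
    case 3
    then obtain \<alpha> \<beta> where ab: "x \<in> interval f \<alpha>" "y \<in> interval f \<beta>" using domain_eq by blast
    then have "\<alpha> = \<beta>" using image_interval_unique map_in_image eq by metis
    then show ?thesis using ab eq by (simp add: map_interval)
  qed (use eq map_outside map_domain in metis)+
qed

lemma map_bij: "bij_betw (aiet_map f) (domain f) (domain f)"
  unfolding bij_betw_def
proof
  show "inj_on (aiet_map f) (domain f)" using map_inj inj_on_subset by blast
  show "aiet_map f ` domain f = domain f"
  proof safe
    fix x assume "x \<in> domain f"
    then obtain \<alpha> where "x \<in> image_interval \<alpha>" using domain_eq_images by blast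
    then show "x \<in> aiet_map f ` domain f" using image_interval_preimage interval_domain by blast
  qed (rule map_domain)
qed

lemma is_aiet: "is_aiet f"
  using irr pos map_bij by (simp add: is_aiet_def)

lemma map_measurable: "aiet_map f \<in> borel_measurable borel"
proof -
  have "aiet_map f = (\<lambda>x. if x \<in> domain f then \<Sum>\<alpha>\<in>UNIV. indicator (interval f \<alpha>) x *
      (left_b f \<alpha> + exp (slopes f $ \<alpha>) * (x - left_t f \<alpha>)) else x)"
  proof
    fix x
    show "aiet_map f x = (if x \<in> domain f then \<Sum>\<alpha>\<in>UNIV. indicator (interval f \<alpha>) x *
      (left_b f \<alpha> + exp (slopes f $ \<alpha>) * (x - left_t f \<alpha>)) else x)"
    proof (cases "x \<in> domain f")
      case True
      then obtain \<alpha> where a: "x \<in> interval f \<alpha>" using domain_eq by blast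
      have "(\<Sum>\<beta>\<in>UNIV. indicator (interval f \<beta>) x *
          (left_b f \<beta> + exp (slopes f $ \<beta>) * (x - left_t f \<beta>))) =
          (\<Sum>\<beta>\<in>UNIV. if \<beta> = \<alpha> then aiet_map f x else 0)"
        using a interval_unique by (intro sum.cong) (auto simp: indicator_def map_interval)
      then show ?thesis using True by simp
    qed (simp add: map_outside)
  qed
  moreover have "\<dots> \<in> borel_measurable borel"
    unfolding domain_def interval_def by measurable
  ultimately show ?thesis by simp
qed

end

text \<open>For the forward direction, the image of the domain is [0, L) with L the total length of
  the images; bijectivity makes this the domain itself.\<close>

lemma aiet_data_iff: "is_aiet f \<longleftrightarrow> aiet_data (f :: ('a::finite) aiet)"
proof
  assume f: "is_aiet f"
  let ?e = "\<lambda>\<alpha>. exp (slopes f $ \<alpha>)"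
  let ?l = "\<lambda>\<beta>. ?e \<beta> * lengths f $ \<beta>"
  from f have irr: "irreducible_perm (pos_t f) (pos_b f)" and pos: "\<And>\<alpha>. lengths f $ \<alpha> > 0"
    and bij: "bij_betw (aiet_map f) (domain f) (domain f)" by (auto simp: is_aiet_def)
  have inj: "inj (pos_t f)" "inj (pos_b f)" using irr by (auto simp: irreducible_perm_def bij_betw_def)
  have lpos: "?l \<beta> > 0" for \<beta> using pos by simp
  have uniq: "\<alpha> = \<beta>" if "x \<in> interval f \<alpha>" "x \<in> interval f \<beta>" for x \<alpha> \<beta>
    using that prefix_sum_disjoint[of "pos_t f" "($) (lengths f)", OF inj(1) pos]
    by (auto simp: interval_def left_t_prefix)
  have dom: "x \<in> domain f" if "x \<in> interval f \<alpha>" for x \<alpha>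
    using that prefix_sum_nonneg[of "($) (lengths f)" "pos_t f" \<alpha>, OF pos]
      prefix_sum_le_total[of "($) (lengths f)" "pos_t f" \<alpha>, OF pos]
    by (auto simp: interval_def domain_def total_length_def left_t_prefix)
  have val: "aiet_map f x = left_b f \<alpha> + ?e \<alpha> * (x - left_t f \<alpha>)" if "x \<in> interval f \<alpha>" for x \<alpha>
    using dom[OF that] uniq that by (auto simp: aiet_map_def letter_def the_equality)
  have "aiet_map f ` domain f = {0..<(\<Sum>\<alpha>\<in>UNIV. ?l \<alpha>)}"
  proof safe
    fix x assume "x \<in> domain f"
    then have "0 \<le> x" "x < (\<Sum>\<beta>\<in>UNIV. lengths f $ \<beta>)" by (auto simp: domain_def total_length_def)
    from prefix_sum_cover[of "pos_t f" "($) (lengths f)", OF inj(1) pos this]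
    obtain \<alpha> where a: "x \<in> interval f \<alpha>" by (auto simp: interval_def left_t_prefix)
    then have "?e \<alpha> * (x - left_t f \<alpha>) < ?l \<alpha>" "?e \<alpha> * (x - left_t f \<alpha>) \<ge> 0"
      by (auto simp: interval_def)
    then show "aiet_map f x \<in> {0..<(\<Sum>\<alpha>\<in>UNIV. ?l \<alpha>)}"
      using val[OF a] prefix_sum_nonneg[of ?l "pos_b f" \<alpha>, OF lpos]
        prefix_sum_le_total[of ?l "pos_b f" \<alpha>, OF lpos]
      unfolding atLeastLessThan_iff left_b_prefix by linarith
  next
    fix y assume "y \<in> {0..<(\<Sum>\<alpha>\<in>UNIV. ?l \<alpha>)}"
    then obtain \<alpha> where a: "left_b f \<alpha> \<le> y" "y < left_b f \<alpha> + ?l \<alpha>"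
      using prefix_sum_cover[of "pos_b f" ?l y, OF inj(2) lpos] by (auto simp: left_b_prefix)
    let ?x = "left_t f \<alpha> + (y - left_b f \<alpha>) / ?e \<alpha>"
    have "?x \<in> interval f \<alpha>" using a by (simp add: interval_def field_simps)
    then show "y \<in> aiet_map f ` domain f" using val[of ?x \<alpha>] dom[of ?x \<alpha>] by (intro image_eqI[of _ _ ?x]) auto
  qed
  then have "{0..<(\<Sum>\<alpha>\<in>UNIV. ?l \<alpha>)} = {0..<total_length f}"
    using bij by (simp add: bij_betw_def domain_def)
  moreover have "(\<Sum>\<alpha>\<in>UNIV. ?l \<alpha>) > 0" "total_length f > 0"
    unfolding total_length_def using pos by (auto intro!: sum_pos)
  ultimately have "(\<Sum>\<alpha>\<in>UNIV. ?l \<alpha>) = total_length f" by (metis atLeastLessThan_eq_iff)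
  then show "aiet_data f" using irr pos by unfold_locales
qed (rule aiet_data.is_aiet)


section \<open>One step of Rauzy--Veech induction\<close>

text \<open>New order of the row in which the loser \<open>l\<close> was last: \<open>l\<close> is
  reinserted right after the winner \<open>w\<close>, and the letters behind \<open>w\<close> move
  up by one.\<close>

definition move_after :: "('a \<Rightarrow> nat) \<Rightarrow> 'a \<Rightarrow> 'a \<Rightarrow> 'a \<Rightarrow> nat" where
  "move_after p w l \<alpha> = (if \<alpha> = l then p w + 1 else if p \<alpha> \<le> p w then p \<alpha> else p \<alpha> + 1)"

lemma bij_betw_move_after:
  fixes p :: "'a::finite \<Rightarrow> nat"
  assumes bij: "bij_betw p UNIV {1..CARD('a)}" and l: "p l = CARD('a)" and wl: "w \<noteq> l"
  shows "bij_betw (move_after p w l) UNIV {1..CARD('a)}"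
proof -
  have inj: "inj p" and ran: "\<And>\<alpha>. 1 \<le> p \<alpha> \<and> p \<alpha> \<le> CARD('a)" using bij by (auto simp: bij_betw_def)
  have lt: "p \<alpha> < CARD('a)" if "\<alpha> \<noteq> l" for \<alpha>
    using ran[of \<alpha>] l that inj by (metis injD le_less)
  have "inj (move_after p w l)"
    by (rule injI) (auto simp: move_after_def split: if_splits dest: injD[OF inj])
  moreover have "range (move_after p w l) \<subseteq> {1..CARD('a)}"
  proof safe
    fix \<alpha>
    show "move_after p w l \<alpha> \<in> {1..CARD('a)}"
      using lt[of \<alpha>] lt[OF wl] ran[of \<alpha>] ran[of w] by (auto simp: move_after_def)
  qed
  ultimately show ?thesis
    unfolding bij_betw_def by (simp add: card_image card_subset_eq)
qed

lemma irreducible_perm_commute: "irreducible_perm p q \<longleftrightarrow> irreducible_perm q p"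
  unfolding irreducible_perm_def by metis

text \<open>A common initial set of k < d letters does not contain \<open>w\<close>, which is last
  for \<open>p\<close>. In the new row it therefore ends before \<open>w\<close>, where old and new
  row agree, and the old pair would be reducible.\<close>

lemma irreducible_perm_move_after:
  fixes p q :: "'a::finite \<Rightarrow> nat"
  assumes irr: "irreducible_perm p q" and w: "p w = CARD('a)" and l: "q l = CARD('a)" and wl: "w \<noteq> l"
  shows "irreducible_perm p (move_after q w l)"
  unfolding irreducible_perm_def
proof (intro conjI allI impI notI)
  show "bij_betw p UNIV {1..CARD('a)}" using irr by (simp add: irreducible_perm_def)
  have q: "bij_betw q UNIV {1..CARD('a)}" using irr by (simp add: irreducible_perm_def)
  then show "bij_betw (move_after q w l) UNIV {1..CARD('a)}" using l wl by (rule bij_betw_move_after)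
  fix k assume k: "1 \<le> k \<and> k < CARD('a)" and eq: "p -` {1..k} = move_after q w l -` {1..k}"
  have q1: "1 \<le> q \<alpha>" for \<alpha> using q by (auto simp: bij_betw_def)
  have "w \<notin> p -` {1..k}" using w k by simp
  then have "k < q w" using eq wl q1[of w] by (auto simp: move_after_def)
  then have "move_after q w l -` {1..k} = q -` {1..k}"
    using k l by (auto simp: move_after_def split: if_splits)
  then show False using irr k eq by (auto simp: irreducible_perm_def)
qed

text \<open>Geometrically the interval of length \<open>n w\<close> is cut into a left piece for
  \<open>w\<close> and a right piece for \<open>l\<close>; all other left endpoints stay in
  place.\<close>

lemma prefix_sum_move_after:
  fixes p :: "'a::finite \<Rightarrow> nat"
  assumes inj: "inj p" and l: "\<And>\<alpha>. p \<alpha> \<le> p l" and wl: "w \<noteq> l"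
    and sum: "m w + m l = (n w :: real)" and other: "\<And>\<alpha>. \<alpha> \<noteq> w \<Longrightarrow> \<alpha> \<noteq> l \<Longrightarrow> m \<alpha> = n \<alpha>"
  shows "prefix_sum (move_after p w l) m \<alpha> = (if \<alpha> = l then prefix_sum p n w + m w else prefix_sum p n \<alpha>)"
proof -
  have lt: "p \<alpha> < p l" if "\<alpha> \<noteq> l" for \<alpha> using l[of \<alpha>] that inj by (metis injD le_less)
  consider "\<alpha> = l" | "\<alpha> \<noteq> l" "p \<alpha> \<le> p w" | "\<alpha> \<noteq> l" "p w < p \<alpha>" by linarith
  then show ?thesis
  proof cases
    case 1
    have "{\<beta>. move_after p w l \<beta> < move_after p w l l} = insert w {\<beta>. p \<beta> < p w}"
      using lt[OF wl] wl by (auto simp: move_after_def le_less dest: injD[OF inj])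
    moreover have "sum m {\<beta>. p \<beta> < p w} = sum n {\<beta>. p \<beta> < p w}"
      using lt[OF wl] by (intro sum.cong) (auto intro: other)
    ultimately show ?thesis using 1 by (simp add: prefix_sum_def)
  next
    case 2
    have "{\<beta>. move_after p w l \<beta> < move_after p w l \<alpha>} = {\<beta>. p \<beta> < p \<alpha>}"
      using 2 lt[OF wl] lt[OF 2(1)] by (auto simp: move_after_def)
    moreover have "sum m {\<beta>. p \<beta> < p \<alpha>} = sum n {\<beta>. p \<beta> < p \<alpha>}"
      using 2 lt[OF wl] lt[OF 2(1)] by (intro sum.cong) (auto intro: other)
    ultimately show ?thesis using 2 by (simp add: prefix_sum_def)
  next
    case 3
    define R where "R = {\<beta>. p \<beta> < p \<alpha>} - {w}"
    have "{\<beta>. move_after p w l \<beta> < move_after p w l \<alpha>} = insert l (insert w R)"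
      using 3 lt[OF 3(1)] wl by (auto simp: move_after_def R_def)
    moreover have "l \<notin> insert w R" "w \<notin> R" using wl lt[OF 3(1)] by (auto simp: R_def)
    moreover have "sum m R = sum n R"
      using lt[OF 3(1)] by (intro sum.cong) (auto intro: other simp: R_def)
    moreover have "{\<beta>. p \<beta> < p \<alpha>} = insert w R" using 3 by (auto simp: R_def)
    ultimately have "prefix_sum (move_after p w l) m \<alpha> = m l + (m w + sum n R)"
      "prefix_sum p n \<alpha> = n w + sum n R"
      unfolding prefix_sum_def by simp_all
    then show ?thesis using 3 sum by simp
  qed
qed

lemma prefix_sum_last_irrelevant:
  assumes "\<And>\<alpha>. p \<alpha> \<le> p l" "\<And>\<alpha>. \<alpha> \<noteq> l \<Longrightarrow> m \<alpha> = n \<alpha>"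
  shows "prefix_sum p m \<alpha> = prefix_sum p n \<alpha>"
  unfolding prefix_sum_def
proof (rule sum.cong)
  fix \<beta> assume "\<beta> \<in> {\<beta>. p \<beta> < p \<alpha>}"
  then have "\<beta> \<noteq> l" using assms(1)[of \<alpha>] by auto
  then show "m \<beta> = n \<beta>" by (rule assms(2))
qed simp

text \<open>Explicit candidate for \<open>rv_next\<close>. The loser passes through the intervals of
  \<open>b\<close> and then \<open>t\<close> before returning, so its log-slope is the sum of
  theirs; in the bottom case it lives on the preimage of the last interval, whence the division by
  \<open>e\<close>.\<close>

definition rv_induced :: "('a::finite) aiet \<Rightarrow> 'a aiet" where
  "rv_induced f = (let t = last_t f; b = last_b f;
       lt = lengths f $ t; lb = lengths f $ b; e = exp (slopes f $ b) in
     case rv_step_type f of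
       Top \<Rightarrow> \<lparr>pos_t = pos_t f, pos_b = move_after (pos_b f) t b,
         lengths = (\<chi> \<alpha>. if \<alpha> = t then lt - e * lb else lengths f $ \<alpha>),
         slopes = (\<chi> \<alpha>. if \<alpha> = b then slopes f $ b + slopes f $ t else slopes f $ \<alpha>)\<rparr>
     | Bottom \<Rightarrow> \<lparr>pos_t = move_after (pos_t f) b t, pos_b = pos_b f,
         lengths = (\<chi> \<alpha>. if \<alpha> = t then lt / e else if \<alpha> = b then lb - lt / e else lengths f $ \<alpha>),
         slopes = (\<chi> \<alpha>. if \<alpha> = t then slopes f $ b + slopes f $ t else slopes f $ \<alpha>)\<rparr>)"

text \<open>Uniqueness for the definite description in \<open>rv_next\<close>. Left endpoints
  determine the orders of the letters, a position is the number of letters up to it, and a slope is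
  read off from two points of an interval.\<close>

lemma aiet_eqI:
  fixes g h :: "('a::finite) aiet"
  assumes g: "aiet_data g" and h: "aiet_data h"
    and int: "\<And>\<alpha>. interval g \<alpha> = interval h \<alpha>" and map: "\<And>x. x \<in> domain g \<Longrightarrow> aiet_map g x = aiet_map h x"
  shows "g = h"
proof -
  interpret g: aiet_data g by fact
  interpret h: aiet_data h by fact
  have len: "lengths g $ \<alpha> = lengths h $ \<alpha>" and left: "left_t g \<alpha> = left_t h \<alpha>" for \<alpha>
    using int[of \<alpha>] g.pos[of \<alpha>] h.pos[of \<alpha>] by (auto simp: interval_def atLeastLessThan_eq_iff)
  have aff: "left_b g \<alpha> + exp (slopes g $ \<alpha>) * s = left_b h \<alpha> + exp (slopes h $ \<alpha>) * s"
    if "0 \<le> s" "s < lengths g $ \<alpha>" for \<alpha> s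
  proof -
    have "left_t g \<alpha> + s \<in> interval g \<alpha>" using that by (simp add: interval_def)
    moreover from this have "left_t g \<alpha> + s \<in> interval h \<alpha>" using int by simp
    ultimately show ?thesis
      using map[of "left_t g \<alpha> + s"] g.map_interval h.map_interval g.interval_domain left by simp
  qed
  have lb: "left_b g \<alpha> = left_b h \<alpha>" for \<alpha> using aff[of 0 \<alpha>] g.pos[of \<alpha>] by simp
  have sl: "slopes g $ \<alpha> = slopes h $ \<alpha>" for \<alpha>
    using aff[of "lengths g $ \<alpha> / 2" \<alpha>] g.pos[of \<alpha>] lb[of \<alpha>] by simp
  have order: "p \<alpha> \<le> p \<beta> \<longleftrightarrow> prefix_sum p l \<alpha> \<le> prefix_sum p l \<beta>"
    if "inj p" "\<And>\<alpha>. l \<alpha> > 0" for p :: "'a \<Rightarrow> nat" and l \<alpha> \<beta>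
    using prefix_sum_step[of p l \<alpha> \<beta>, OF that] prefix_sum_step[of p l \<beta> \<alpha>, OF that] that(2)[of \<alpha>] that(2)[of \<beta>]
      injD[OF that(1), of \<alpha> \<beta>]
    by (cases "p \<alpha>" "p \<beta>" rule: linorder_cases) auto
  have rank: "p = q" if "bij_betw p UNIV {1..CARD('a)}" "bij_betw q UNIV {1..CARD('a)}"
    "\<And>\<alpha> \<beta>. p \<alpha> \<le> p \<beta> \<longleftrightarrow> q \<alpha> \<le> q \<beta>" for p q :: "'a \<Rightarrow> nat"
  proof -
    have "r \<alpha> = card {\<beta>. r \<beta> \<le> r \<alpha>}" if r: "bij_betw r UNIV {1..CARD('a)}" for r :: "'a \<Rightarrow> nat" and \<alpha>
    proof -
      have "r ` {\<beta>. r \<beta> \<le> r \<alpha>} = {1..r \<alpha>}"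
      proof safe
        fix \<beta> assume "r \<beta> \<le> r \<alpha>" then show "r \<beta> \<in> {1..r \<alpha>}" using r by (auto simp: bij_betw_def)
      next
        fix k assume k: "k \<in> {1..r \<alpha>}"
        have "r \<alpha> \<in> {1..CARD('a)}" using r by (auto simp: bij_betw_def)
        then have "k \<in> range r" using r k by (auto simp: bij_betw_def)
        then show "k \<in> r ` {\<beta>. r \<beta> \<le> r \<alpha>}" using k by auto
      qed
      moreover have "inj_on r {\<beta>. r \<beta> \<le> r \<alpha>}" using r by (auto simp: bij_betw_def inj_on_def)
      ultimately show ?thesis using card_image by fastforce
    qed
    from this[OF that(1)] this[OF that(2)] that(3) show ?thesis by (intro ext) simp
  qed
  have gl: "exp (slopes g $ \<alpha>) * lengths g $ \<alpha> = exp (slopes h $ \<alpha>) * lengths h $ \<alpha>" for \<alpha>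
    using len sl by simp
  have "pos_t g \<alpha> \<le> pos_t g \<beta> \<longleftrightarrow> pos_t h \<alpha> \<le> pos_t h \<beta>" for \<alpha> \<beta>
    using order[OF g.inj_t, of "($) (lengths g)" \<alpha> \<beta>] order[OF h.inj_t, of "($) (lengths h)" \<alpha> \<beta>]
      left[of \<alpha>] left[of \<beta>] g.pos h.pos
    by (simp add: left_t_prefix)
  then have pt: "pos_t g = pos_t h"
    using g.irr h.irr by (intro rank) (auto simp: irreducible_perm_def)
  have "pos_b g \<alpha> \<le> pos_b g \<beta> \<longleftrightarrow> pos_b h \<alpha> \<le> pos_b h \<beta>" for \<alpha> \<beta>
    using order[OF g.inj_b, of "\<lambda>\<beta>. exp (slopes g $ \<beta>) * lengths g $ \<beta>" \<alpha> \<beta>]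
      order[OF h.inj_b, of "\<lambda>\<beta>. exp (slopes h $ \<beta>) * lengths h $ \<beta>" \<alpha> \<beta>]
      lb[of \<alpha>] lb[of \<beta>] g.pos h.pos
    by (simp add: left_b_prefix)
  then have pb: "pos_b g = pos_b h"
    using g.irr h.irr by (intro rank) (auto simp: irreducible_perm_def)
  show ?thesis using pt pb len sl by (intro aiet.equality) (auto simp: vec_eq_iff)
qed

locale rv_step = aiet_data f for f :: "('a::finite) aiet" +
  assumes card2: "CARD('a) \<ge> 2" and ren: "renormalizable f"
begin

abbreviation "t \<equiv> last_t f"
abbreviation "b \<equiv> last_b f"
abbreviation "e \<equiv> exp (slopes f $ b)"

lemma bij_t: "bij_betw (pos_t f) UNIV {1..CARD('a)}" and bij_b: "bij_betw (pos_b f) UNIV {1..CARD('a)}"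
  using irr by (auto simp: irreducible_perm_def)

lemma pos_last: "pos_t f t = CARD('a)" "pos_b f b = CARD('a)"
proof -
  have "CARD('a) \<in> {1..CARD('a)}" using card2 by simp
  then have "CARD('a) \<in> range (pos_t f)" "CARD('a) \<in> range (pos_b f)"
    using bij_t bij_b by (simp_all add: bij_betw_def)
  then show "pos_t f t = CARD('a)" "pos_b f b = CARD('a)"
    by (simp_all add: last_t_def last_b_def f_inv_into_f)
qed

lemma pos_le: "pos_t f \<alpha> \<le> pos_t f t" "pos_b f \<alpha> \<le> pos_b f b"
  using bij_t bij_b unfolding pos_last by (auto simp: bij_betw_def)

text \<open>Otherwise the first d - 1 letters of both rows form the same set, against irreducibility
  with k = d - 1, which is admissible since d \<ge> 2.\<close>

lemma t_neq_b: "t \<noteq> b"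
proof
  assume eq: "t = b"
  have *: "r -` {1..CARD('a) - 1} = UNIV - {x}"
    if r: "bij_betw r UNIV {1..CARD('a)}" "r x = CARD('a)" for r :: "'a \<Rightarrow> nat" and x
  proof -
    have "r y \<in> {1..CARD('a) - 1} \<longleftrightarrow> y \<noteq> x" for y
    proof
      assume "y \<noteq> x"
      then have "r y \<noteq> CARD('a)" using r by (metis bij_betw_def injD)
      moreover have "r y \<in> {1..CARD('a)}" using r(1) by (metis bij_betw_def rangeI)
      ultimately show "r y \<in> {1..CARD('a) - 1}" unfolding atLeastAtMost_iff by linarith
    next
      assume "r y \<in> {1..CARD('a) - 1}"
      then have "r y \<noteq> r x" using card2 unfolding r(2) atLeastAtMost_iff by linarith
      then show "y \<noteq> x" by blast
    qed
    then show ?thesis unfolding set_eq_iff vimage_eq by blast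
  qed
  have "pos_t f -` {1..CARD('a) - 1} = pos_b f -` {1..CARD('a) - 1}"
    using *[OF bij_t pos_last(1)] *[OF bij_b pos_last(2)] eq by simp
  then show False
    using irr card2 unfolding irreducible_perm_def by (auto dest!: spec[of _ "CARD('a) - 1"])
qed

lemma prefix_sum_last: "\<lbrakk>inj p; \<And>\<alpha>. p \<alpha> \<le> p l\<rbrakk> \<Longrightarrow> prefix_sum p m l + m l = (\<Sum>\<alpha>\<in>UNIV. m \<alpha> :: real)"
proof -
  assume p: "inj p" "\<And>\<alpha>. p \<alpha> \<le> p l"
  have "UNIV = insert l {\<beta>. p \<beta> < p l}" using p by (auto simp: le_less dest: injD)
  then show ?thesis by (simp add: prefix_sum_def) (metis finite sum.insert add.commute less_irrefl mem_Collect_eq)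
qed

lemma last_right: "left_t f t + lengths f $ t = total_length f"
  "left_b f b + e * lengths f $ b = total_length f"
proof -
  show "left_t f t + lengths f $ t = total_length f"
    unfolding left_t_prefix total_length_def by (rule prefix_sum_last[OF inj_t pos_le(1)])
  show "left_b f b + e * lengths f $ b = total_length f"
    unfolding left_b_prefix total[symmetric] by (rule prefix_sum_last[OF inj_b pos_le(2)])
qed

lemma image_b: "aiet_map f ` interval f b = image_interval b"
  using map_in_image image_interval_preimage by blast

lemma sum_split2:
  "(\<Sum>\<alpha>\<in>UNIV. h \<alpha> :: real) = h t + h b + (\<Sum>\<alpha>\<in>UNIV - {t, b}. h \<alpha>)"
proof -
  have "(\<Sum>\<alpha>\<in>UNIV. h \<alpha>) = h t + (\<Sum>\<alpha>\<in>UNIV - {t}. h \<alpha>)" by (subst sum.remove[of _ t]) auto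
  also have "(\<Sum>\<alpha>\<in>UNIV - {t}. h \<alpha>) = h b + (\<Sum>\<alpha>\<in>UNIV - {t} - {b}. h \<alpha>)"
    using t_neq_b by (subst sum.remove[of _ b]) auto
  also have "UNIV - {t} - {b} = UNIV - {t, b}" by blast
  finally show ?thesis by simp
qed


lemma first_return_1:
  assumes "aiet_map f x \<in> J"
  shows "first_return (aiet_map f) J x = aiet_map f x"
proof -
  have "return_time (aiet_map f) J x = 1"
    unfolding return_time_def using assms by (intro Least_equality) auto
  then show ?thesis by (simp add: first_return_def)
qed

lemma first_return_2:
  assumes "aiet_map f x \<notin> J" "aiet_map f (aiet_map f x) \<in> J"
  shows "first_return (aiet_map f) J x = aiet_map f (aiet_map f x)"
proof -
  have "return_time (aiet_map f) J x = 2"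
    unfolding return_time_def
  proof (rule Least_equality)
    show "0 < (2::nat) \<and> (aiet_map f ^^ 2) x \<in> J" using assms by (simp add: numeral_2_eq_2)
    fix k assume k: "0 < k \<and> (aiet_map f ^^ k) x \<in> J"
    show "2 \<le> k"
    proof (rule ccontr)
      assume "\<not> 2 \<le> k"
      then have "k = 1" using k by auto
      then show False using k assms by simp
    qed
  qed
  then show ?thesis by (simp add: first_return_def numeral_2_eq_2)
qed

definition loser :: 'a where "loser = (if rv_step_type f = Top then b else t)"

text \<open>Both types of step are alike: the loser runs through the two last intervals before it returns.\<close>

definition induced_by :: "'a aiet \<Rightarrow> bool" where
  "induced_by g \<longleftrightarrow> aiet_data g \<and> domain g = rv_domain f \<and> (\<forall>\<alpha>. interval g \<alpha> = rv_interval f \<alpha>) \<and>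
     (\<forall>\<alpha>. slopes g $ \<alpha> = (if \<alpha> = loser then slopes f $ b + slopes f $ t else slopes f $ \<alpha>)) \<and>
     (\<forall>\<alpha>. \<forall>x\<in>interval g \<alpha>. \<alpha> \<noteq> loser \<longrightarrow> x \<in> interval f \<alpha> \<and> aiet_map g x = aiet_map f x) \<and>
     (\<forall>x\<in>interval g loser. x \<in> interval f b \<and> aiet_map f x \<in> interval f t \<and>
        aiet_map f x \<notin> domain g \<and> aiet_map g x = aiet_map f (aiet_map f x)) \<and>
     domain g \<subseteq> domain f \<and> domain f - domain g \<subseteq> aiet_map f ` interval g loser"

text \<open>The interval of \<open>t\<close> and the image of that of \<open>b\<close> both end at
  the right end of the domain, and the image is shorter. Removing it shortens \<open>t\<close>,
  while points of \<open>b\<close> land in the removed piece and come back after one more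
  step.\<close>

lemma induced_top:
  assumes top: "rv_step_type f = Top"
  shows "induced_by (rv_induced f)"
proof -
  define g where "g = rv_induced f"
  let ?lt = "lengths f $ t" and ?lb = "lengths f $ b"
  have lt: "e * ?lb < ?lt" using top ren by (auto simp: rv_step_type_def split: if_splits)
  have lb0: "e * ?lb > 0" using pos by simp
  have g: "pos_t g = pos_t f" "pos_b g = move_after (pos_b f) t b"
    "\<And>\<alpha>. lengths g $ \<alpha> = (if \<alpha> = t then ?lt - e * ?lb else lengths f $ \<alpha>)"
    "\<And>\<alpha>. slopes g $ \<alpha> = (if \<alpha> = b then slopes f $ b + slopes f $ t else slopes f $ \<alpha>)"
    by (simp_all add: g_def rv_induced_def top Let_def)
  let ?m = "\<lambda>\<alpha>. exp (slopes g $ \<alpha>) * lengths g $ \<alpha>"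
  let ?n = "\<lambda>\<alpha>. exp (slopes f $ \<alpha>) * lengths f $ \<alpha>"
  have m: "?m t + ?m b = ?n t" "\<And>\<alpha>. \<alpha> \<noteq> t \<Longrightarrow> \<alpha> \<noteq> b \<Longrightarrow> ?m \<alpha> = ?n \<alpha>"
    using t_neq_b by (auto simp: g exp_add algebra_simps)
  have tot: "total_length g = total_length f - e * ?lb"
    unfolding total_length_def sum_split2[of "($) (lengths g)"] sum_split2[of "($) (lengths f)"]
    using t_neq_b by (simp add: g)
  have gdata: "aiet_data g"
  proof
    show "irreducible_perm (pos_t g) (pos_b g)"
      unfolding g using irreducible_perm_move_after[OF irr pos_last t_neq_b] .
    show "lengths g $ \<alpha> > 0" for \<alpha> using lt pos by (simp add: g)
    have "(\<Sum>\<alpha>\<in>UNIV. ?m \<alpha>) = (\<Sum>\<alpha>\<in>UNIV. ?n \<alpha>) - ?n b"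
    proof -
      have "(\<Sum>\<alpha>\<in>UNIV - {t, b}. ?m \<alpha>) = (\<Sum>\<alpha>\<in>UNIV - {t, b}. ?n \<alpha>)"
        using m(2) by (intro sum.cong) auto
      then show ?thesis using m(1) sum_split2[of ?m] sum_split2[of ?n] by linarith
    qed
    then show "(\<Sum>\<alpha>\<in>UNIV. ?m \<alpha>) = total_length g" using tot total by simp
  qed
  interpret g: aiet_data g by fact
  have left_t: "left_t g \<alpha> = left_t f \<alpha>" for \<alpha>
    unfolding left_t_prefix g(1) using pos_le(1) by (intro prefix_sum_last_irrelevant[of _ t]) (auto simp: g)
  have left_b: "left_b g \<alpha> = (if \<alpha> = b then left_b f t + exp (slopes f $ t) * (?lt - e * ?lb) else left_b f \<alpha>)" for \<alpha>
    unfolding left_b_prefix g(2)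
    using prefix_sum_move_after[of "pos_b f" b t ?m ?n \<alpha>, OF inj_b pos_le(2) t_neq_b m] t_neq_b
    by (simp add: g)
  have im_b: "image_interval b = {total_length f - e * ?lb ..< total_length f}"
  proof -
    have "left_b f b = total_length f - e * ?lb" using last_right(2) by simp
    then show ?thesis by (simp add: image_interval_def)
  qed
  have dom: "domain g = rv_domain f"
    unfolding rv_domain_def top using image_b im_b lt lb0 last_right(1) prefix_sum_nonneg[of "($) (lengths f)" "pos_t f" t, OF pos]
    by (auto simp: domain_def tot left_t_prefix)
  have int: "interval g \<alpha> = rv_interval f \<alpha>" for \<alpha>
    unfolding rv_interval_def top using image_b im_b lt last_right(1) lb0
    by (auto simp: interval_def left_t g)
  have sub: "x \<in> interval f \<alpha>" if "x \<in> interval g \<alpha>" for x \<alpha>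
    using that unfolding int rv_interval_def top by (auto split: if_splits)
  have loser: "loser = b" by (simp add: loser_def top)
  have nl: "aiet_map g x = aiet_map f x" if x: "x \<in> interval g \<alpha>" "\<alpha> \<noteq> b" for x \<alpha>
    using x by (simp add: g.map_interval map_interval[OF sub] left_t left_b g)
  have l: "aiet_map f x \<in> interval f t" "aiet_map f x \<notin> domain g" "aiet_map g x = aiet_map f (aiet_map f x)"
    if x: "x \<in> interval g b" for x
  proof -
    have im: "aiet_map f x \<in> image_interval b" using map_in_image sub[OF x] .
    then show 1: "aiet_map f x \<in> interval f t"
      using im_b lt last_right(1) by (auto simp: interval_iff)
    show "aiet_map f x \<notin> domain g" using im im_b by (auto simp: domain_def tot)
    \<comment> \<open>Measured from the left end of the interval of \<open>t\<close>, the image of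
      the interval of \<open>b\<close> starts at \<open>?lt - e * ?lb\<close>, since both end at
      \<open>total_length f\<close>.\<close>
    have "aiet_map f x - left_t f t = (?lt - e * ?lb) + e * (x - left_t f b)"
      using map_interval[OF sub[OF x]] last_right by simp
    then have "aiet_map f (aiet_map f x) =
        left_b f t + exp (slopes f $ t) * ((?lt - e * ?lb) + e * (x - left_t f b))"
      using map_interval[OF 1] by simp
    then show "aiet_map g x = aiet_map f (aiet_map f x)"
      by (simp add: g.map_interval[OF x] left_t left_b g exp_add algebra_simps)
  qed
  have "domain f - domain g \<subseteq> image_interval b"
    unfolding im_b by (auto simp: domain_def tot)
  moreover have "interval g b = interval f b"
    using t_neq_b by (simp add: int rv_interval_def top)
  ultimately have "domain f - domain g \<subseteq> aiet_map f ` interval g b" by (simp add: image_b)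
  moreover have "domain g \<subseteq> domain f" using lb0 by (auto simp: domain_def tot)
  ultimately show ?thesis
    unfolding induced_by_def g_def[symmetric] loser using gdata dom int g(4) sub nl l by auto
qed

text \<open>Now the interval of \<open>t\<close> lies inside the image of that of \<open>b\<close>,
  so its preimage is the right end of the interval of \<open>b\<close>; this piece takes over the
  name \<open>t\<close>, and \<open>b\<close> keeps the rest.\<close>

lemma induced_bottom:
  assumes bot: "rv_step_type f = Bottom"
  shows "induced_by (rv_induced f)"
proof -
  define g where "g = rv_induced f"
  let ?lt = "lengths f $ t" and ?lb = "lengths f $ b"
  have lt: "?lt < e * ?lb" using bot ren by (auto simp: rv_step_type_def renormalizable_def split: if_splits)
  then have lt': "?lt / e < ?lb" by (simp add: field_simps)
  have lt0: "?lt > 0" "?lt / e > 0" using pos by simp_all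
  have g: "pos_t g = move_after (pos_t f) b t" "pos_b g = pos_b f"
    "\<And>\<alpha>. lengths g $ \<alpha> = (if \<alpha> = t then ?lt / e else if \<alpha> = b then ?lb - ?lt / e else lengths f $ \<alpha>)"
    "\<And>\<alpha>. slopes g $ \<alpha> = (if \<alpha> = t then slopes f $ b + slopes f $ t else slopes f $ \<alpha>)"
    by (simp_all add: g_def rv_induced_def bot Let_def)
  have b_neq_t: "b \<noteq> t" using t_neq_b by simp
  let ?m = "\<lambda>\<alpha>. exp (slopes g $ \<alpha>) * lengths g $ \<alpha>"
  let ?n = "\<lambda>\<alpha>. exp (slopes f $ \<alpha>) * lengths f $ \<alpha>"
  have m: "\<And>\<alpha>. \<alpha> \<noteq> b \<Longrightarrow> ?m \<alpha> = ?n \<alpha>" "?m b = ?n b - ?lt"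
    using t_neq_b by (auto simp: g exp_add field_simps)
  have len: "lengths g $ b + lengths g $ t = lengths f $ b" using t_neq_b by (simp add: g)
  have tot: "total_length g = total_length f - ?lt"
    unfolding total_length_def sum_split2[of "($) (lengths g)"] sum_split2[of "($) (lengths f)"]
    using t_neq_b by (simp add: g)
  have gdata: "aiet_data g"
  proof
    show "irreducible_perm (pos_t g) (pos_b g)"
      unfolding g using irreducible_perm_move_after[of "pos_b f" "pos_t f", OF _ pos_last(2,1) b_neq_t] irr
      by (metis irreducible_perm_commute)
    show "lengths g $ \<alpha> > 0" for \<alpha> using lt' lt0 pos by (simp add: g)
    have "(\<Sum>\<alpha>\<in>UNIV. ?m \<alpha>) = (\<Sum>\<alpha>\<in>UNIV. ?n \<alpha>) - ?lt"
    proof -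
      have "(\<Sum>\<alpha>\<in>UNIV - {t, b}. ?m \<alpha>) = (\<Sum>\<alpha>\<in>UNIV - {t, b}. ?n \<alpha>)"
        using m(1) by (intro sum.cong) auto
      then show ?thesis using m(1)[OF t_neq_b] m(2) sum_split2[of ?m] sum_split2[of ?n] by linarith
    qed
    then show "(\<Sum>\<alpha>\<in>UNIV. ?m \<alpha>) = total_length g" using tot total by simp
  qed
  interpret g: aiet_data g by fact
  have left_b: "left_b g \<alpha> = left_b f \<alpha>" for \<alpha>
    unfolding left_b_prefix g(2) using pos_le(2) m(1) by (intro prefix_sum_last_irrelevant[of _ b]) auto
  have left_t: "left_t g \<alpha> = (if \<alpha> = t then left_t f b + (?lb - ?lt / e) else left_t f \<alpha>)" for \<alpha>
    unfolding left_t_prefix g(1)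
    using prefix_sum_move_after[of "pos_t f" t b "($) (lengths g)" "($) (lengths f)" \<alpha>,
        OF inj_t pos_le(1) b_neq_t len] b_neq_t
    by (simp add: g)
  have lbt: "left_b f b = total_length f - e * ?lb" and ltt: "left_t f t = total_length f - ?lt"
    using last_right by simp_all
  have int_t: "interval f t = {total_length f - ?lt ..< total_length f}"
    by (simp add: interval_def ltt)
  have dom: "domain g = rv_domain f"
    unfolding rv_domain_def bot using int_t lt0 prefix_sum_nonneg[of "($) (lengths f)" "pos_t f" t, OF pos] last_right(1)
    by (auto simp: domain_def tot left_t_prefix)
  \<comment> \<open>The preimage is taken in all reals; points outside the domain are fixed and
    cannot reach the interval of \<open>t\<close>.\<close>
  have pre: "aiet_map f -` interval f t = {left_t f b + (?lb - ?lt / e) ..< left_t f b + ?lb}" (is "?P = ?Q")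
  proof
    show "?Q \<subseteq> ?P"
    proof
      fix x assume x: "x \<in> ?Q"
      then have xb: "x \<in> interval f b" using lt' by (auto simp: interval_iff)
      have "e * (x - left_t f b) \<ge> e * (?lb - ?lt / e)" "e * (x - left_t f b) < e * ?lb"
        using x by (intro mult_left_mono mult_strict_left_mono; simp)+
      then show "x \<in> ?P"
        using map_interval[OF xb] lbt by (auto simp: int_t algebra_simps)
    qed
    show "?P \<subseteq> ?Q"
    proof
      fix x assume x: "x \<in> ?P"
      then have ft: "aiet_map f x \<in> interval f t" by simp
      then have "x \<in> domain f" using map_outside interval_domain by metis
      then obtain \<alpha> where a: "x \<in> interval f \<alpha>" using domain_eq by blast
      have "aiet_map f x \<in> image_interval b"
        using ft lt lbt by (auto simp: image_interval_def int_t)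
      then have "\<alpha> = b" using map_in_image[OF a] image_interval_unique by blast
      then have xb: "x \<in> interval f b" using a by simp
      have "e * (x - left_t f b) \<ge> e * ?lb - ?lt"
        using ft map_interval[OF xb] lbt by (auto simp: int_t)
      then have "e * (x - left_t f b) \<ge> e * (?lb - ?lt / e)" by (simp add: right_diff_distrib)
      then have "x - left_t f b \<ge> ?lb - ?lt / e" by (rule mult_left_le_imp_le) simp
      then show "x \<in> ?Q" using xb by (simp add: interval_iff)
    qed
  qed
  have int: "interval g \<alpha> = rv_interval f \<alpha>" for \<alpha>
  proof (cases "\<alpha> = b")
    case True
    have "x \<in> interval g b \<longleftrightarrow> x \<in> interval f b - ?P" for x
      unfolding pre Diff_iff g.interval_iff interval_iff atLeastLessThan_iff left_t g
      using lt0(2) b_neq_t by (simp only: if_False if_True simp_thms) argo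
    then show ?thesis unfolding rv_interval_def bot using True b_neq_t by auto
  next
    case False
    then show ?thesis unfolding rv_interval_def bot using pre
      by (auto simp: interval_def left_t g)
  qed
  have sub: "x \<in> interval f \<alpha>" if "x \<in> interval g \<alpha>" "\<alpha> \<noteq> t" for x \<alpha>
    using that unfolding int rv_interval_def bot by (auto split: if_splits)
  have loser: "loser = t" by (simp add: loser_def bot)
  have nl: "aiet_map g x = aiet_map f x" if x: "x \<in> interval g \<alpha>" "\<alpha> \<noteq> t" for x \<alpha>
    using x by (simp add: g.map_interval map_interval[OF sub] left_t left_b g)
  have l: "x \<in> interval f b" "aiet_map f x \<in> interval f t" "aiet_map f x \<notin> domain g" "aiet_map g x = aiet_map f (aiet_map f x)"
    if x: "x \<in> interval g t" for x
  proof -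
    have x': "x \<in> ?P" using x unfolding int rv_interval_def bot by simp
    then show 1: "aiet_map f x \<in> interval f t" by simp
    show xb: "x \<in> interval f b" using x' lt' unfolding pre by (auto simp: interval_iff)
    show "aiet_map f x \<notin> domain g" using 1 int_t by (auto simp: domain_def tot)
    have "aiet_map f x - left_t f t = (?lt - e * ?lb) + e * (x - left_t f b)"
      using map_interval[OF xb] lbt ltt by simp
    then have "aiet_map f (aiet_map f x) =
        left_b f t + exp (slopes f $ t) * ((?lt - e * ?lb) + e * (x - left_t f b))"
      using map_interval[OF 1] by simp
    then show "aiet_map g x = aiet_map f (aiet_map f x)"
      by (simp add: g.map_interval[OF x] left_t left_b g exp_add algebra_simps)
  qed
  have "domain f - domain g \<subseteq> interval f t"
    unfolding int_t by (auto simp: domain_def tot)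
  moreover have "interval f t \<subseteq> aiet_map f ` interval g t"
  proof
    fix y assume y: "y \<in> interval f t"
    then have "y \<in> domain f" by (rule interval_domain)
    then obtain x where "y = aiet_map f x" using map_bij by (auto simp: bij_betw_def)
    then show "y \<in> aiet_map f ` interval g t" using y by (auto simp: int rv_interval_def bot)
  qed
  moreover have "domain g \<subseteq> domain f" using lt0 by (auto simp: domain_def tot)
  ultimately show ?thesis
    unfolding induced_by_def g_def[symmetric] loser using gdata dom int g(4) sub nl l by auto
qed

lemma induced: "induced_by (rv_induced f)"
  using induced_top induced_bottom by (cases "rv_step_type f") auto

text \<open>The return time is 2 on the interval of the loser, whose image leaves the new domain,
  and 1 elsewhere.\<close>

lemma induced_first_return:
  assumes g: "induced_by g" and x: "x \<in> rv_domain f"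
  shows "aiet_map g x = first_return (aiet_map f) (rv_domain f) x"
proof -
  interpret g: aiet_data g using g by (simp add: induced_by_def)
  have dom: "domain g = rv_domain f" using g by (simp add: induced_by_def)
  obtain \<alpha> where a: "x \<in> interval g \<alpha>" using x dom g.domain_eq by blast
  have gx: "aiet_map g x \<in> domain g" using x dom g.map_domain by blast
  show ?thesis
  proof (cases "\<alpha> = loser")
    case True
    then show ?thesis using g a gx unfolding induced_by_def by (metis first_return_2)
  next
    case False
    then show ?thesis using g a gx unfolding induced_by_def by (metis first_return_1)
  qed
qed

lemma rv_next_induced: "induced_by (rv_next f)"
proof -
  define g where "g = rv_induced f"
  have g: "induced_by g" using induced g_def by simp
  have "rv_next f = g"
    unfolding rv_next_def
  proof (rule the_equality)
    show "is_aiet g \<and> domain g = rv_domain f \<and> (\<forall>\<alpha>. interval g \<alpha> = rv_interval f \<alpha>) \<and>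
      (\<forall>x\<in>rv_domain f. aiet_map g x = first_return (aiet_map f) (rv_domain f) x)"
      using g induced_first_return[OF g] by (auto simp: induced_by_def aiet_data_iff)
    fix h assume h: "is_aiet h \<and> domain h = rv_domain f \<and> (\<forall>\<alpha>. interval h \<alpha> = rv_interval f \<alpha>) \<and>
      (\<forall>x\<in>rv_domain f. aiet_map h x = first_return (aiet_map f) (rv_domain f) x)"
    show "h = g"
      using h g induced_first_return[OF g] by (intro aiet_eqI) (auto simp: induced_by_def aiet_data_iff)
  qed
  then show ?thesis using g by simp
qed

end


section \<open>Towers\<close>

text \<open>A Birkhoff sum of a function that is constant on the exchanged intervals, once the orbit
  is replaced by its coding word.\<close>

definition psum :: "('a \<Rightarrow> real) \<Rightarrow> 'a list \<Rightarrow> nat \<Rightarrow> real" where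
  "psum v ws i = (\<Sum>\<beta>\<leftarrow>take i ws. v \<beta>)"

lemma psum_0 [simp]: "psum v ws 0 = 0" by (simp add: psum_def)

lemma psum_Suc: "i < length ws \<Longrightarrow> psum v ws (Suc i) = psum v ws i + v (ws ! i)"
  by (simp add: psum_def take_Suc_conv_app_nth)

primrec visits :: "(real \<Rightarrow> real) \<Rightarrow> ('a \<Rightarrow> real set) \<Rightarrow> real \<Rightarrow> 'a list \<Rightarrow> bool" where
  "visits F J x [] \<longleftrightarrow> True"
| "visits F J x (\<beta> # bs) \<longleftrightarrow> x \<in> J \<beta> \<and> visits F J (F x) bs"

lemma funpow_add_apply: "(F ^^ (m + n)) x = (F ^^ n) ((F ^^ m) x)"
  by (metis add.commute comp_apply funpow_add)

lemma visits_append: "visits F J x (bs @ cs) \<longleftrightarrow> visits F J x bs \<and> visits F J ((F ^^ length bs) x) cs"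
  by (induction bs arbitrary: x) (auto simp: funpow_swap1)

lemma visits_nth: "visits F J x bs \<Longrightarrow> i < length bs \<Longrightarrow> (F ^^ i) x \<in> J (bs ! i)"
proof (induction bs arbitrary: x i)
  case (Cons \<beta> bs)
  then show ?case by (cases i) (auto simp: funpow_swap1)
qed simp

lemma visits_take: "visits F J x bs \<Longrightarrow> visits F J x (take i bs)"
  by (metis append_take_drop_id visits_append)

text \<open>\<open>g\<close> is the first return map of \<open>f\<close> to its domain, and the orbit of a point of the interval of
  \<open>\<alpha>\<close> runs through the letters of \<open>w \<alpha>\<close> before it returns.\<close>

definition tower_over :: "('a::finite) aiet \<Rightarrow> ('a \<Rightarrow> 'a list) \<Rightarrow> 'a aiet \<Rightarrow> bool" where
  "tower_over f w g \<longleftrightarrow> domain g \<subseteq> domain f \<and> (\<forall>\<alpha>. w \<alpha> \<noteq> []) \<and>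
     (\<forall>\<alpha>. \<forall>x\<in>interval g \<alpha>. visits (aiet_map f) (interval f) x (w \<alpha>) \<and>
        (aiet_map f ^^ length (w \<alpha>)) x = aiet_map g x \<and>
        (\<forall>j. 0 < j \<and> j < length (w \<alpha>) \<longrightarrow> (aiet_map f ^^ j) x \<notin> domain g)) \<and>
     (\<forall>x\<in>domain f. \<exists>\<alpha>. \<exists>y\<in>interval g \<alpha>. \<exists>j<length (w \<alpha>). x = (aiet_map f ^^ j) y) \<and>
     (\<forall>\<alpha>. slopes g $ \<alpha> = (\<Sum>\<beta>\<leftarrow>w \<alpha>. slopes f $ \<beta>))"

lemma tower_over_refl: "aiet_data f \<Longrightarrow> tower_over f (\<lambda>\<alpha>. [\<alpha>]) f"
  unfolding tower_over_def using aiet_data.domain_eq[of f] by (auto intro!: exI[of _ "0::nat"])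

text \<open>Stated for arbitrary itineraries \<open>bs\<close>, because the induction along a word
  passes to tails, which are not words of a tower.\<close>

lemma tower_over_visits:
  assumes t: "tower_over f w g" and v: "visits (aiet_map g) (interval g) x bs"
  shows "visits (aiet_map f) (interval f) x (concat (map w bs))"
    and "(aiet_map f ^^ length (concat (map w bs))) x = (aiet_map g ^^ length bs) x"
proof -
  have "visits (aiet_map f) (interval f) x (concat (map w bs)) \<and>
    (aiet_map f ^^ length (concat (map w bs))) x = (aiet_map g ^^ length bs) x"
    using v
  proof (induction bs arbitrary: x)
    case (Cons \<beta> bs)
    then have x: "x \<in> interval g \<beta>" and v: "visits (aiet_map g) (interval g) (aiet_map g x) bs" by auto
    have w: "visits (aiet_map f) (interval f) x (w \<beta>)" "(aiet_map f ^^ length (w \<beta>)) x = aiet_map g x"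
      using t x by (auto simp: tower_over_def)
    have "(aiet_map f ^^ length (concat (map w (\<beta> # bs)))) x = (aiet_map g ^^ length (\<beta> # bs)) x"
      using Cons.IH[OF v] w(2)
        funpow_add_apply[where m="length (w \<beta>)" and n="length (concat (map w bs))" and F="aiet_map f" and x=x]
      by (simp add: funpow_swap1)
    then show ?case using Cons.IH[OF v] w by (simp add: visits_append)
  qed simp
  then show "visits (aiet_map f) (interval f) x (concat (map w bs))"
    and "(aiet_map f ^^ length (concat (map w bs))) x = (aiet_map g ^^ length bs) x" by auto
qed

text \<open>Inside a block the orbit is off \<open>domain g\<close>, hence off \<open>D\<close>; at
  the starts of blocks it is an orbit of \<open>g\<close>, to which the assumption applies.\<close>

lemma tower_over_avoids:
  assumes t: "tower_over f w g" and D: "D \<subseteq> domain g"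
    and v: "visits (aiet_map g) (interval g) x bs" and a: "\<And>j. j < length bs \<Longrightarrow> (aiet_map g ^^ j) x \<notin> D"
    and j: "j < length (concat (map w bs))"
  shows "(aiet_map f ^^ j) x \<notin> D"
  using v a j
proof (induction bs arbitrary: x j)
  case (Cons \<beta> bs)
  then have x: "x \<in> interval g \<beta>" and v: "visits (aiet_map g) (interval g) (aiet_map g x) bs" by auto
  have w: "(aiet_map f ^^ length (w \<beta>)) x = aiet_map g x"
    "\<And>j. 0 < j \<Longrightarrow> j < length (w \<beta>) \<Longrightarrow> (aiet_map f ^^ j) x \<notin> domain g"
    using t x by (auto simp: tower_over_def)
  show ?case
  proof (cases "j < length (w \<beta>)")
    case True
    then show ?thesis using Cons.prems(2)[of 0] w(2)[of j] D by (cases "j = 0") auto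
  next
    case False
    then obtain i where i: "j = length (w \<beta>) + i" by (metis le_add_diff_inverse not_less)
    have "(aiet_map f ^^ i) (aiet_map g x) \<notin> D"
    proof (rule Cons.IH[OF v])
      fix k assume "k < length bs"
      then show "(aiet_map g ^^ k) (aiet_map g x) \<notin> D"
        using Cons.prems(2)[of "Suc k"] by (simp add: funpow_swap1)
    qed (use Cons.prems(3) i in simp)
    then show ?thesis by (simp add: i funpow_add_apply w(1))
  qed
qed simp

lemma tower_over_trans:
  assumes t: "tower_over f w g" and t': "tower_over g w' h" and g: "aiet_data g" and h: "aiet_data h"
  shows "tower_over f (\<lambda>\<alpha>. concat (map w (w' \<alpha>))) h"
  unfolding tower_over_def
proof (intro conjI allI ballI impI)
  interpret g: aiet_data g by fact
  interpret h: aiet_data h by fact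
  show "domain h \<subseteq> domain f" using t t' by (auto simp: tower_over_def)
  show ne: "concat (map w (w' \<alpha>)) \<noteq> []" for \<alpha>
    using t t' by (cases "w' \<alpha>") (auto simp: tower_over_def)
  show "slopes h $ \<alpha> = (\<Sum>\<beta>\<leftarrow>concat (map w (w' \<alpha>)). slopes f $ \<beta>)" for \<alpha>
  proof -
    have "(\<Sum>\<beta>\<leftarrow>concat (map w bs). slopes f $ \<beta>) = (\<Sum>\<beta>\<leftarrow>bs. slopes g $ \<beta>)" for bs
      using t by (induction bs) (auto simp: tower_over_def)
    then show ?thesis using t' by (simp add: tower_over_def)
  qed
  {
    fix \<alpha> x assume x: "x \<in> interval h \<alpha>"
    have v: "visits (aiet_map g) (interval g) x (w' \<alpha>)"
      and r: "(aiet_map g ^^ length (w' \<alpha>)) x = aiet_map h x"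
      and av: "\<And>j. 0 < j \<Longrightarrow> j < length (w' \<alpha>) \<Longrightarrow> (aiet_map g ^^ j) x \<notin> domain h"
      using t' x by (auto simp: tower_over_def)
    show "visits (aiet_map f) (interval f) x (concat (map w (w' \<alpha>)))"
      and "(aiet_map f ^^ length (concat (map w (w' \<alpha>)))) x = aiet_map h x"
      using tower_over_visits[OF t v] r by auto
    fix j assume j: "0 < j \<and> j < length (concat (map w (w' \<alpha>)))"
    \<comment> \<open>The first block is treated apart, because at time 0 the orbit is in
      \<open>domain h\<close>; the avoidance lemma applies from the next block on.\<close>
    obtain \<beta> bs where bs: "w' \<alpha> = \<beta> # bs" using t' by (metis tower_over_def neq_Nil_conv)
    have xb: "x \<in> interval g \<beta>" and vb: "visits (aiet_map g) (interval g) (aiet_map g x) bs"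
      using v by (auto simp: bs)
    have w: "(aiet_map f ^^ length (w \<beta>)) x = aiet_map g x"
      "\<And>j. 0 < j \<Longrightarrow> j < length (w \<beta>) \<Longrightarrow> (aiet_map f ^^ j) x \<notin> domain g"
      using t xb by (auto simp: tower_over_def)
    have D: "domain h \<subseteq> domain g" using t' by (simp add: tower_over_def)
    show "(aiet_map f ^^ j) x \<notin> domain h"
    proof (cases "j < length (w \<beta>)")
      case True
      then show ?thesis using w(2) j D by blast
    next
      case False
      then obtain i where i: "j = length (w \<beta>) + i" by (metis le_add_diff_inverse not_less)
      have "(aiet_map f ^^ i) (aiet_map g x) \<notin> domain h"
      proof (rule tower_over_avoids[OF t D vb])
        fix k assume "k < length bs"
        then show "(aiet_map g ^^ k) (aiet_map g x) \<notin> domain h"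
          using av[of "Suc k"] by (simp add: funpow_swap1 bs)
      qed (use j i in \<open>simp add: bs\<close>)
      then show ?thesis by (simp add: i funpow_add_apply w(1))
    qed
  }
  fix x assume "x \<in> domain f"
  then obtain \<beta> y j where y: "y \<in> interval g \<beta>" "j < length (w \<beta>)" "x = (aiet_map f ^^ j) y"
    using t unfolding tower_over_def by blast
  then have "y \<in> domain g" by (simp add: g.interval_domain)
  then obtain \<alpha> z i where z: "z \<in> interval h \<alpha>" "i < length (w' \<alpha>)" "y = (aiet_map g ^^ i) z"
    using t' unfolding tower_over_def by blast
  have v: "visits (aiet_map g) (interval g) z (w' \<alpha>)" using t' z(1) by (simp add: tower_over_def)
  have beta: "w' \<alpha> ! i = \<beta>" using visits_nth[OF v z(2)] z(3) y(1) g.interval_unique by simp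
  let ?l = "length (concat (map w (take i (w' \<alpha>))))"
  have "(aiet_map f ^^ ?l) z = y"
    using tower_over_visits(2)[OF t visits_take[OF v, of i]] z by simp
  then have "x = (aiet_map f ^^ (?l + j)) z" by (simp add: funpow_add_apply y(3))
  moreover have "?l + j < length (concat (map w (w' \<alpha>)))"
  proof -
    have "concat (map w (w' \<alpha>)) = concat (map w (take i (w' \<alpha>))) @ w \<beta> @ concat (map w (drop (Suc i) (w' \<alpha>)))"
      using id_take_nth_drop[OF z(2)] beta
      by (metis concat.simps(2) concat_append list.simps(9) map_append)
    then show ?thesis using y(2) by simp
  qed
  ultimately show "\<exists>\<alpha>. \<exists>y\<in>interval h \<alpha>. \<exists>j<length (concat (map w (w' \<alpha>))). x = (aiet_map f ^^ j) y"
    using z(1) by blast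
qed

text \<open>One step of the induction as a substitution: in both types the loser becomes the word b
  t, in the order of the visits. Only combinatorial data enter, so maps with equal rotation numbers
  get equal words.\<close>

fun rv_letters :: "((('a::finite) \<Rightarrow> nat) \<times> ('a \<Rightarrow> nat)) \<times> rv_type \<Rightarrow> 'a \<Rightarrow> 'a list" where
  "rv_letters ((p, q), ty) \<alpha> = (let t = inv p CARD('a); b = inv q CARD('a) in
     if \<alpha> = (if ty = Top then b else t) then [b, t] else [\<alpha>])"

declare rv_letters.simps [simp del]

primrec rv_word :: "(nat \<Rightarrow> ((('a::finite) \<Rightarrow> nat) \<times> ('a \<Rightarrow> nat)) \<times> rv_type) \<Rightarrow> nat \<Rightarrow> 'a \<Rightarrow> 'a list" where
  "rv_word r 0 \<alpha> = [\<alpha>]"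
| "rv_word r (Suc n) \<alpha> = concat (map (rv_word r n) (rv_letters (r n) \<alpha>))"

lemma concat_map_concat: "concat (map f (concat xss)) = concat (map (\<lambda>xs. concat (map f xs)) xss)"
  by (induction xss) auto

text \<open>With \<open>m\<close> a multiple of a period, this exhibits the words as iterates of one
  substitution.\<close>

lemma rv_word_add:
  "rv_word r (m + n) \<alpha> = concat (map (rv_word r m) (rv_word (\<lambda>i. r (i + m)) n \<alpha>))"
proof (induction n arbitrary: \<alpha>)
  case (Suc n)
  have "rv_word r (m + Suc n) \<alpha> = concat (map (\<lambda>\<beta>. rv_word r (m + n) \<beta>) (rv_letters (r (n + m)) \<alpha>))"
    by (simp add: add.commute)
  also have "\<dots> = concat (map (rv_word r m) (rv_word (\<lambda>i. r (i + m)) (Suc n) \<alpha>))"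
    by (simp add: Suc concat_map_concat o_def)
  finally show ?case .
qed simp

lemma rv_step_tower:
  assumes "rv_step f"
  shows "aiet_data (rv_next f)" "tower_over f (rv_letters ((pos_t f, pos_b f), rv_step_type f)) (rv_next f)"
proof -
  interpret rv_step f by fact
  define g where "g = rv_next f"
  have g: "induced_by g" using rv_next_induced g_def by simp
  then show "aiet_data (rv_next f)" by (simp add: induced_by_def g_def)
  have gd: "aiet_data g" using g by (simp add: induced_by_def)
  let ?w = "rv_letters ((pos_t f, pos_b f), rv_step_type f)"
  have w: "?w \<alpha> = (if \<alpha> = loser then [b, t] else [\<alpha>])" for \<alpha>
    by (simp add: rv_letters.simps loser_def last_t_def last_b_def Let_def)
  have sl: "slopes g $ \<alpha> = (if \<alpha> = loser then slopes f $ b + slopes f $ t else slopes f $ \<alpha>)" for \<alpha>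
    using g unfolding induced_by_def by blast
  have nl: "x \<in> interval f \<alpha> \<and> aiet_map g x = aiet_map f x" if "x \<in> interval g \<alpha>" "\<alpha> \<noteq> loser" for x \<alpha>
    using g that unfolding induced_by_def by blast
  have l: "x \<in> interval f b \<and> aiet_map f x \<in> interval f t \<and>
        aiet_map f x \<notin> domain g \<and> aiet_map g x = aiet_map f (aiet_map f x)" if "x \<in> interval g loser" for x
    using g that unfolding induced_by_def by blast
  have "tower_over f ?w g"
    unfolding tower_over_def
  proof (intro conjI allI ballI impI)
    show "domain g \<subseteq> domain f" using g unfolding induced_by_def by blast
    show "?w \<alpha> \<noteq> []" for \<alpha> by (simp add: w)
    show "slopes g $ \<alpha> = (\<Sum>\<beta>\<leftarrow>?w \<alpha>. slopes f $ \<beta>)" for \<alpha>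
      by (simp add: sl w)
    fix \<alpha> x assume x: "x \<in> interval g \<alpha>"
    show "visits (aiet_map f) (interval f) x (?w \<alpha>)"
      using nl[OF x] l x by (auto simp: w)
    show "(aiet_map f ^^ length (?w \<alpha>)) x = aiet_map g x"
      using nl[OF x] l x by (auto simp: w)
    fix j assume j: "0 < j \<and> j < length (?w \<alpha>)"
    then have "\<alpha> = loser" "j = 1" by (auto simp: w split: if_splits)
    then show "(aiet_map f ^^ j) x \<notin> domain g" using l x by auto
  next
    fix x assume x: "x \<in> domain f"
    show "\<exists>\<alpha>. \<exists>y\<in>interval g \<alpha>. \<exists>j<length (?w \<alpha>). x = (aiet_map f ^^ j) y"
    proof (cases "x \<in> domain g")
      case True
      then obtain \<alpha> where "x \<in> interval g \<alpha>" using aiet_data.domain_eq[OF gd] by blast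
      then show ?thesis by (intro exI[of _ \<alpha>] bexI[of _ x] exI[of _ 0]) (simp_all add: w)
    next
      case False
      then obtain y where "y \<in> interval g loser" "x = aiet_map f y"
        using x g unfolding induced_by_def by blast
      then show ?thesis by (intro exI[of _ loser] bexI[of _ y] exI[of _ 1]) (simp_all add: w)
    qed
  qed
  then show "tower_over f ?w (rv_next f)" by (simp add: g_def)
qed

lemma rv_iter_tower:
  fixes f :: "('a::finite) aiet"
  assumes f: "aiet_data f" and card: "CARD('a) \<ge> 2" and ren: "infinitely_renormalizable f"
  shows "aiet_data (rv_iter n f) \<and> tower_over f (rv_word (rotation_number f) n) (rv_iter n f)"
proof (induction n)
  case 0
  show ?case using f tower_over_refl[OF f] by (simp add: rv_iter_def)
next
  case (Suc n)
  have ren': "renormalizable (rv_iter n f)" using ren by (simp add: infinitely_renormalizable_def)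
  interpret rv_step "rv_iter n f"
    using Suc card ren' by (simp add: rv_step_def rv_step_axioms_def)
  have step: "rv_iter (Suc n) f = rv_next (rv_iter n f)" by (simp add: rv_iter_def)
  have "tower_over (rv_iter n f) (rv_letters (rotation_number f n)) (rv_iter (Suc n) f)"
    using rv_step_tower(2)[OF rv_step_axioms] by (simp add: rotation_number_def step)
  from tower_over_trans[OF conjunct2[OF Suc] this] show ?case
    using rv_step_tower(1)[OF rv_step_axioms] Suc by (simp add: step)
qed

lemma rv_iter_rv_iter: "rv_iter n (rv_iter m f) = rv_iter (n + m) f"
  by (simp add: rv_iter_def funpow_add)

lemma rotation_number_rv_iter: "rotation_number (rv_iter m f) = (\<lambda>n. rotation_number f (n + m))"
  by (simp add: rotation_number_def rv_iter_rv_iter fun_eq_iff)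

lemma infinitely_renormalizable_rv_iter:
  "infinitely_renormalizable f \<Longrightarrow> infinitely_renormalizable (rv_iter m f)"
  by (simp add: infinitely_renormalizable_def rv_iter_rv_iter)

section \<open>Floors of a tower: geometry and measure\<close>

locale tower =
  fixes f g :: "('a::finite) aiet" and w
  assumes f_data: "aiet_data f" and g_data: "aiet_data g" and tower: "tower_over f w g"
begin

sublocale f: aiet_data f by (rule f_data)
sublocale g: aiet_data g by (rule g_data)

definition idx :: "('a \<times> nat) set" where "idx = (SIGMA \<alpha>:UNIV. {..<length (w \<alpha>)})"

lemma finite_idx: "finite idx" by (simp add: idx_def)

lemma idx_iff: "(\<alpha>, i) \<in> idx \<longleftrightarrow> i < length (w \<alpha>)" by (simp add: idx_def)

lemma sum_idx: "(\<Sum>(\<alpha>, i)\<in>idx. h \<alpha> i) = (\<Sum>\<alpha>\<in>UNIV. \<Sum>i<length (w \<alpha>). h \<alpha> i)"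
  unfolding idx_def by (rule sum.Sigma[symmetric]) auto

definition floor :: "'a \<times> nat \<Rightarrow> real set" where
  "floor p = (aiet_map f ^^ snd p) ` interval g (fst p)"

definition floor_length :: "'a \<times> nat \<Rightarrow> real" where
  "floor_length p = exp (psum (($) (slopes f)) (w (fst p)) (snd p)) * lengths g $ fst p"

text \<open>Up to the return time each image of the base interval stays inside one exchanged
  interval, so the slopes along the word multiply.\<close>

lemma floor_affine:
  assumes "x \<in> interval g \<alpha>" "i \<le> length (w \<alpha>)"
  shows "(aiet_map f ^^ i) x = (aiet_map f ^^ i) (left_t g \<alpha>) +
    exp (psum (($) (slopes f)) (w \<alpha>) i) * (x - left_t g \<alpha>)"
  using assms(2)
proof (induction i)
  case (Suc i)
  have l: "left_t g \<alpha> \<in> interval g \<alpha>" using g.pos by (simp add: interval_def)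
  have "(aiet_map f ^^ i) y \<in> interval f (w \<alpha> ! i)" if "y \<in> interval g \<alpha>" for y
    using that Suc.prems tower visits_nth by (metis Suc_le_lessD tower_over_def)
  then have "(aiet_map f ^^ Suc i) x - (aiet_map f ^^ Suc i) (left_t g \<alpha>) =
      exp (slopes f $ (w \<alpha> ! i)) * ((aiet_map f ^^ i) x - (aiet_map f ^^ i) (left_t g \<alpha>))"
    using f.map_interval[of _ "w \<alpha> ! i"] assms(1) l by (simp add: right_diff_distrib)
  also have "(aiet_map f ^^ i) x - (aiet_map f ^^ i) (left_t g \<alpha>) =
      exp (psum (($) (slopes f)) (w \<alpha>) i) * (x - left_t g \<alpha>)"
    using Suc by simp
  finally show ?case using Suc.prems by (simp add: psum_Suc exp_add algebra_simps)
qed simp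

lemma floor_eq:
  assumes "i \<le> length (w \<alpha>)"
  shows "floor (\<alpha>, i) = {(aiet_map f ^^ i) (left_t g \<alpha>) ..< (aiet_map f ^^ i) (left_t g \<alpha>) + floor_length (\<alpha>, i)}"
    (is "_ = {?a ..< ?a + _}")
proof -
  let ?s = "exp (psum (($) (slopes f)) (w \<alpha>) i)"
  have "floor (\<alpha>, i) = (\<lambda>x. ?a + ?s * (x - left_t g \<alpha>)) ` interval g \<alpha>"
    unfolding floor_def using floor_affine[OF _ assms] by (intro image_cong) auto
  also have "\<dots> = {?a ..< ?a + ?s * lengths g $ \<alpha>}"
  proof
    show "(\<lambda>x. ?a + ?s * (x - left_t g \<alpha>)) ` interval g \<alpha> \<subseteq> {?a ..< ?a + ?s * lengths g $ \<alpha>}"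
      by (auto simp: interval_def)
    show "{?a ..< ?a + ?s * lengths g $ \<alpha>} \<subseteq> (\<lambda>x. ?a + ?s * (x - left_t g \<alpha>)) ` interval g \<alpha>"
    proof
      fix y assume y: "y \<in> {?a ..< ?a + ?s * lengths g $ \<alpha>}"
      let ?x = "left_t g \<alpha> + (y - ?a) / ?s"
      have "?x \<in> interval g \<alpha>" "y = ?a + ?s * (?x - left_t g \<alpha>)"
        using y by (auto simp: interval_def field_simps)
      then show "y \<in> (\<lambda>x. ?a + ?s * (x - left_t g \<alpha>)) ` interval g \<alpha>" by blast
    qed
  qed
  finally show ?thesis by (simp add: floor_length_def)
qed

lemma floor_length_pos: "floor_length p > 0"
  using g.pos by (simp add: floor_length_def)

lemma floor_subset: "(\<alpha>, i) \<in> idx \<Longrightarrow> floor (\<alpha>, i) \<subseteq> interval f (w \<alpha> ! i)"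
  using tower visits_nth unfolding floor_def idx_iff tower_over_def by fastforce

text \<open>Cancelling the smaller number of iterates leaves a point of a base that reaches
  \<open>domain g\<close> in fewer steps than its return time, so the remaining number of steps is
  0.\<close>

lemma floor_disjoint:
  assumes p: "p \<in> idx" "q \<in> idx" "x \<in> floor p" "x \<in> floor q"
  shows "p = q"
proof -
  have *: "(\<alpha>, i) = (\<beta>, j)" if "i \<le> j" "i < length (w \<alpha>)" "j < length (w \<beta>)" "y \<in> interval g \<alpha>" "z \<in> interval g \<beta>"
    "(aiet_map f ^^ i) y = (aiet_map f ^^ j) z" for \<alpha> i \<beta> j y z
  proof -
    have "(aiet_map f ^^ i) y = (aiet_map f ^^ i) ((aiet_map f ^^ (j - i)) z)"
      using that(1,6) funpow_add_apply[of "j - i" i "aiet_map f" z] by simp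
    then have eq: "y = (aiet_map f ^^ (j - i)) z"
      using inj_fn[OF f.map_inj, of i] by (simp add: inj_eq)
    moreover have "y \<in> domain g" using that(4) by (rule g.interval_domain)
    ultimately have "j - i = 0" using tower that(3,5) unfolding tower_over_def
      by (metis less_imp_diff_less not_gr_zero)
    then have "i = j" "y = z" using eq that(1) by auto
    then show ?thesis using that(4,5) g.interval_unique by auto
  qed
  obtain \<alpha> i \<beta> j where "p = (\<alpha>, i)" "q = (\<beta>, j)" by (metis surj_pair)
  moreover from this p obtain y z where "y \<in> interval g \<alpha>" "z \<in> interval g \<beta>"
    "(aiet_map f ^^ i) y = (aiet_map f ^^ j) z" by (auto simp: floor_def)
  ultimately show ?thesis using p(1,2) *[of i j \<alpha> \<beta> y z] *[of j i \<beta> \<alpha> z y]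
    by (cases i j rule: linorder_le_cases) (auto simp: idx_iff)
qed

lemma disjoint_family_floor: "A \<subseteq> idx \<Longrightarrow> disjoint_family_on floor A"
  unfolding disjoint_family_on_def using floor_disjoint by blast

lemma domain_floors: "domain f = (\<Union>p\<in>idx. floor p)"
proof
  show "domain f \<subseteq> (\<Union>p\<in>idx. floor p)"
  proof
    fix x assume "x \<in> domain f"
    then obtain \<alpha> y j where "y \<in> interval g \<alpha>" "j < length (w \<alpha>)" "x = (aiet_map f ^^ j) y"
      using tower unfolding tower_over_def by blast
    then show "x \<in> (\<Union>p\<in>idx. floor p)"
      by (intro UN_I[of "(\<alpha>, j)"]) (auto simp: idx_iff floor_def)
  qed
  show "(\<Union>p\<in>idx. floor p) \<subseteq> domain f"
    using floor_subset f.interval_domain by fastforce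
qed

lemma interval_floors: "interval f \<beta> = (\<Union>p\<in>{p \<in> idx. w (fst p) ! snd p = \<beta>}. floor p)"
proof
  show "interval f \<beta> \<subseteq> (\<Union>p\<in>{p \<in> idx. w (fst p) ! snd p = \<beta>}. floor p)"
  proof
    fix x assume x: "x \<in> interval f \<beta>"
    then obtain \<alpha> i where p: "(\<alpha>, i) \<in> idx" "x \<in> floor (\<alpha>, i)"
      using f.interval_domain domain_floors by (metis UN_E surj_pair)
    then have "w \<alpha> ! i = \<beta>" using floor_subset[OF p(1)] x f.interval_unique by blast
    then show "x \<in> (\<Union>p\<in>{p \<in> idx. w (fst p) ! snd p = \<beta>}. floor p)" using p by force
  qed
  show "(\<Union>p\<in>{p \<in> idx. w (fst p) ! snd p = \<beta>}. floor p) \<subseteq> interval f \<beta>"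
    using floor_subset by fastforce
qed

lemma floor_borel: "p \<in> idx \<Longrightarrow> floor p \<in> sets borel"
  using floor_eq[of "snd p" "fst p"] by (cases p) (simp add: idx_iff)

lemma measure_floor: "p \<in> idx \<Longrightarrow> measure lborel (floor p) = floor_length p"
  using floor_eq[of "snd p" "fst p"] floor_length_pos[of p] by (cases p) (simp add: idx_iff)

lemma emeasure_floor_finite: "p \<in> idx \<Longrightarrow> emeasure lborel (floor p) \<noteq> \<infinity>"
  using floor_eq[of "snd p" "fst p"] floor_length_pos[of p] by (cases p) (simp add: idx_iff)

lemma lengths_floors: "lengths f $ \<beta> = (\<Sum>p\<in>{p \<in> idx. w (fst p) ! snd p = \<beta>}. floor_length p)"
proof -
  have "lengths f $ \<beta> = measure lborel (interval f \<beta>)"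
    using f.pos[of \<beta>] by (simp add: interval_def)
  also have "\<dots> = (\<Sum>p\<in>{p \<in> idx. w (fst p) ! snd p = \<beta>}. measure lborel (floor p))"
    unfolding interval_floors
    by (intro measure_finite_Union)
      (auto intro!: floor_borel disjoint_family_floor simp: finite_idx dest: emeasure_floor_finite)
  also have "\<dots> = (\<Sum>p\<in>{p \<in> idx. w (fst p) ! snd p = \<beta>}. floor_length p)"
    by (intro sum.cong) (auto simp: measure_floor)
  finally show ?thesis .
qed

lemma total_length_floors: "total_length f = (\<Sum>p\<in>idx. floor_length p)"
  unfolding total_length_def lengths_floors by (rule sum.group) (auto simp: finite_idx)

lemma measure_domain_floors:
  assumes fin: "finite_measure \<mu>" and sets: "sets \<mu> = sets borel"
  shows "measure \<mu> (domain f) = (\<Sum>p\<in>idx. measure \<mu> (floor p))"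
proof -
  interpret finite_measure \<mu> by fact
  show ?thesis unfolding domain_floors
    by (intro measure_finite_Union)
      (auto intro!: floor_borel disjoint_family_floor simp: finite_idx sets)
qed

text \<open>By injectivity the preimage of a floor is exactly the floor below it.\<close>

lemma measure_floor_invariant:
  assumes inv: "distr \<mu> borel (aiet_map f) = \<mu>" and sets: "sets \<mu> = sets borel"
    and i: "i \<le> length (w \<alpha>)"
  shows "measure \<mu> (floor (\<alpha>, i)) = measure \<mu> (interval g \<alpha>)"
  using i
proof (induction i)
  case 0
  show ?case by (simp add: floor_def)
next
  case (Suc i)
  have meas: "aiet_map f \<in> measurable \<mu> borel"
    using f.map_measurable sets by (simp cong: measurable_cong_sets)
  have "floor (\<alpha>, Suc i) \<in> sets borel" using floor_eq[OF Suc.prems] by simp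
  then have "measure \<mu> (floor (\<alpha>, Suc i)) = measure \<mu> (aiet_map f -` floor (\<alpha>, Suc i) \<inter> space \<mu>)"
    by (subst inv[symmetric], subst measure_distr[OF meas]) auto
  also have "aiet_map f -` floor (\<alpha>, Suc i) \<inter> space \<mu> = floor (\<alpha>, i)"
  proof -
    have "space \<mu> = UNIV" using sets_eq_imp_space_eq[OF sets] by simp
    moreover have "aiet_map f -` floor (\<alpha>, Suc i) = floor (\<alpha>, i)"
      unfolding floor_def using f.map_inj by (auto simp: inj_eq)
    ultimately show ?thesis by simp
  qed
  finally show ?case using Suc by simp
qed

end


section \<open>Iterated substitutions and large deviations\<close>

lemma psum_add: "psum (\<lambda>\<beta>. u \<beta> + v \<beta>) ws i = psum u ws i + psum v ws i"
  unfolding psum_def by (rule sum_list_addf)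

lemma psum_scale: "psum (\<lambda>\<beta>. t * v \<beta>) ws i = t * psum v ws i"
  unfolding psum_def by (rule sum_list_const_mult)

lemma psum_append: "psum v (xs @ ys) i =
    (if i \<le> length xs then psum v xs i else sum_list (map v xs) + psum v ys (i - length xs))"
  by (simp add: psum_def)

text \<open>The total length of a tower with word \<open>ws\<close>, log-slopes \<open>v\<close> and
  base of length 1; in thermodynamic terms a partition function.\<close>

definition partition_sum :: "('a \<Rightarrow> real) \<Rightarrow> 'a list \<Rightarrow> real" where
  "partition_sum v ws = (\<Sum>i<length ws. exp (psum v ws i))"

lemma partition_sum_append:
  "partition_sum v (xs @ ys) = partition_sum v xs + exp (sum_list (map v xs)) * partition_sum v ys"
proof -
  have "partition_sum v (xs @ ys) = (\<Sum>i<length xs + length ys. exp (psum v (xs @ ys) i))"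
    by (simp add: partition_sum_def)
  also have "\<dots> = (\<Sum>i<length xs. exp (psum v (xs @ ys) i)) +
      (\<Sum>i<length ys. exp (psum v (xs @ ys) (length xs + i)))"
  proof -
    have "(\<Sum>i<m + n. h i) = (\<Sum>i<m. h i) + (\<Sum>i<n. h (m + i))" for m n and h :: "nat \<Rightarrow> real"
      by (induction n) simp_all
    then show ?thesis .
  qed
  also have "(\<Sum>i<length ys. exp (psum v (xs @ ys) (length xs + i))) =
      exp (sum_list (map v xs)) * partition_sum v ys"
    unfolding partition_sum_def sum_distrib_left by (intro sum.cong) (auto simp: psum_def exp_add)
  finally show ?thesis by (simp add: partition_sum_def psum_append)
qed

text \<open>Entering block j multiplies all weights by the exponential of the totals of the earlier
  blocks; these totals act as a new potential on the letters of \<open>bs\<close>.\<close>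

lemma partition_sum_concat:
  "partition_sum v (concat (map W bs)) =
    (\<Sum>j<length bs. exp (psum (\<lambda>\<beta>. sum_list (map v (W \<beta>))) bs j) * partition_sum v (W (bs ! j)))"
proof (induction bs rule: rev_induct)
  case (snoc \<beta> bs)
  have tot: "sum_list (map v (concat (map W bs))) = sum_list (map (\<lambda>\<beta>. sum_list (map v (W \<beta>))) bs)"
    by (induction bs) auto
  show ?case
    by (simp add: partition_sum_append snoc tot) (simp add: psum_append psum_def nth_append)
qed (simp add: partition_sum_def)

text \<open>The last level is split off at the letter \<alpha>, so that passing from k to k + 1 is
  multiplication by the matrix of \<sigma> from the left.\<close>

primrec subst_iter :: "('a \<Rightarrow> 'a list) \<Rightarrow> nat \<Rightarrow> 'a \<Rightarrow> 'a list" where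
  "subst_iter \<sigma> 0 \<alpha> = [\<alpha>]"
| "subst_iter \<sigma> (Suc k) \<alpha> = concat (map (subst_iter \<sigma> k) (\<sigma> \<alpha>))"

text \<open>For the words of one period this is the weighted matrix M(v), and for
  \<open>v = 0\<close> the self-similarity matrix M.\<close>

definition subst_matrix :: "('a::finite \<Rightarrow> 'a list) \<Rightarrow> real^'a \<Rightarrow> real^'a^'a" where
  "subst_matrix \<sigma> v = (\<chi> \<alpha> \<beta>. \<Sum>i | i < length (\<sigma> \<alpha>) \<and> \<sigma> \<alpha> ! i = \<beta>. exp (psum (($) v) (\<sigma> \<alpha>) i))"

lemma subst_matrix_apply:
  "(subst_matrix \<sigma> v *v u) $ \<alpha> = (\<Sum>i<length (\<sigma> \<alpha>). exp (psum (($) v) (\<sigma> \<alpha>) i) * u $ (\<sigma> \<alpha> ! i))"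
proof -
  have "(subst_matrix \<sigma> v *v u) $ \<alpha> = (\<Sum>\<beta>\<in>UNIV. \<Sum>i\<in>{i\<in>{..<length (\<sigma> \<alpha>)}. \<sigma> \<alpha> ! i = \<beta>}.
      exp (psum (($) v) (\<sigma> \<alpha>) i) * u $ (\<sigma> \<alpha> ! i))"
    by (auto simp: matrix_vector_mult_def subst_matrix_def sum_distrib_right intro!: sum.cong)
  also have "\<dots> = (\<Sum>i<length (\<sigma> \<alpha>). exp (psum (($) v) (\<sigma> \<alpha>) i) * u $ (\<sigma> \<alpha> ! i))"
    by (rule sum.group) auto
  finally show ?thesis .
qed

text \<open>The pattern of positive entries does not depend on \<open>v\<close>, so M(v) inherits
  positivity from M.\<close>

lemma subst_matrix_pos_iff: "subst_matrix \<sigma> v $ \<alpha> $ \<beta> > 0 \<longleftrightarrow> (\<exists>j<length (\<sigma> \<alpha>). \<sigma> \<alpha> ! j = \<beta>)"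
proof (cases "{i. i < length (\<sigma> \<alpha>) \<and> \<sigma> \<alpha> ! i = \<beta>} = {}")
  case True
  then have "subst_matrix \<sigma> v $ \<alpha> $ \<beta> = 0" by (simp only: subst_matrix_def vec_lambda_beta sum.empty)
  then show ?thesis using True by auto
next
  case False
  then have "subst_matrix \<sigma> v $ \<alpha> $ \<beta> > 0"
    unfolding subst_matrix_def vec_lambda_beta by (intro sum_pos) auto
  then show ?thesis using False by blast
qed

lemma psum_zero: "psum (($) 0) ws i = 0"
  by (induction "take i ws") (auto simp: psum_def sum_list_0)

lemma subst_matrix_0_apply: "(subst_matrix \<sigma> 0 *v u) $ \<alpha> = (\<Sum>i<length (\<sigma> \<alpha>). u $ (\<sigma> \<alpha> ! i))"
  by (simp add: subst_matrix_apply psum_zero)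

lemma subst_matrix_0_apply_list: "(subst_matrix \<sigma> 0 *v u) $ \<alpha> = sum_list (map (($) u) (\<sigma> \<alpha>))"
  by (simp add: subst_matrix_0_apply sum_list_sum_nth lessThan_atLeast0)

lemma sum_list_subst_iter: "sum_list (map (($) v) (subst_iter \<sigma> k \<alpha>)) = ((*v) (subst_matrix \<sigma> 0) ^^ k) v $ \<alpha>"
proof (induction k arbitrary: \<alpha>)
  case (Suc k)
  have "sum_list (map (($) v) (concat (map W bs))) = sum_list (map (\<lambda>\<beta>. sum_list (map (($) v) (W \<beta>))) bs)"
    for W :: "'a \<Rightarrow> 'a list" and bs
    by (induction bs) auto
  then show ?case by (simp add: Suc subst_matrix_0_apply_list)
qed simp

lemma fixed_power: "A *v c = c \<Longrightarrow> ((*v) A ^^ k) c = c"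
  by (induction k) auto

text \<open>Here M c = c is decisive: the total of \<open>c\<close> over the word of level k of a
  letter is the value of \<open>c\<close> at that letter, so the weights of the blocks are the same
  for all k.\<close>

lemma partition_sum_subst_iter_Suc:
  assumes "subst_matrix \<sigma> 0 *v c = c"
  shows "partition_sum (($) c) (subst_iter \<sigma> (Suc k) \<alpha>) =
    (subst_matrix \<sigma> c *v (\<chi> \<beta>. partition_sum (($) c) (subst_iter \<sigma> k \<beta>))) $ \<alpha>"
proof -
  have "(\<lambda>\<beta>. sum_list (map (($) c) (subst_iter \<sigma> k \<beta>))) = ($) c"
    by (simp add: sum_list_subst_iter fixed_power[OF assms] fun_eq_iff)
  then show ?thesis by (simp add: partition_sum_concat subst_matrix_apply)
qed

lemma subst_matrix_mono:
  assumes "\<And>\<beta>. u $ \<beta> \<le> v $ \<beta>"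
  shows "(subst_matrix \<sigma> c *v u) $ \<alpha> \<le> (subst_matrix \<sigma> c *v v) $ \<alpha>"
  unfolding subst_matrix_apply using assms by (intro sum_mono mult_left_mono) auto

text \<open>A positive vector with M(c) u \<le> R u dominates the partition sums up to the ratio of
  its extreme entries. The hypothesis is an inequality so as to fit the perturbed vector of
  \<open>tilted_growth\<close>.\<close>

lemma partition_sum_upper:
  fixes \<sigma> :: "'a::finite \<Rightarrow> 'a list"
  assumes c: "subst_matrix \<sigma> 0 *v c = c" and u: "\<And>\<alpha>. u $ \<alpha> > 0"
    and R: "\<And>\<alpha>. (subst_matrix \<sigma> c *v u) $ \<alpha> \<le> R * u $ \<alpha>" and R0: "R \<ge> 0"
  shows "\<exists>C>0. \<forall>k \<alpha>. partition_sum (($) c) (subst_iter \<sigma> k \<alpha>) \<le> C * R ^ k"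
proof -
  define m where "m = Min (range (($) u))"
  define m' where "m' = Max (range (($) u))"
  have "m \<in> range (($) u)" unfolding m_def by (rule Min_in) auto
  then have m0: "m > 0" using u by auto
  have mle: "m \<le> u $ \<alpha>" "u $ \<alpha> \<le> m'" for \<alpha> unfolding m_def m'_def by auto
  have *: "partition_sum (($) c) (subst_iter \<sigma> k \<alpha>) \<le> (R ^ k / m) * u $ \<alpha>" for k \<alpha>
  proof (induction k arbitrary: \<alpha>)
    case 0
    show ?case using mle(1)[of \<alpha>] m0 by (simp add: partition_sum_def)
  next
    case (Suc k)
    have "partition_sum (($) c) (subst_iter \<sigma> (Suc k) \<alpha>) \<le> (subst_matrix \<sigma> c *v ((R ^ k / m) *\<^sub>R u)) $ \<alpha>"
      unfolding partition_sum_subst_iter_Suc[OF c] using Suc by (intro subst_matrix_mono) simp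
    also have "\<dots> = (R ^ k / m) * (subst_matrix \<sigma> c *v u) $ \<alpha>" by (simp add: matrix_vector_mult_scaleR)
    also have "\<dots> \<le> (R ^ k / m) * (R * u $ \<alpha>)" using R R0 m0 by (intro mult_left_mono) auto
    finally show ?case by (simp add: mult_ac)
  qed
  show ?thesis
  proof (intro exI[of _ "m' / m"] conjI allI)
    show "m' / m > 0" using m0 mle[of undefined] by simp
    fix k \<alpha>
    have "(R ^ k / m) * u $ \<alpha> \<le> (R ^ k / m) * m'" using mle R0 m0 by (intro mult_left_mono) auto
    then show "partition_sum (($) c) (subst_iter \<sigma> k \<alpha>) \<le> m' / m * R ^ k" using *[of k \<alpha>] by (simp add: mult_ac)
  qed
qed

lemma partition_sum_lower:
  fixes \<sigma> :: "'a::finite \<Rightarrow> 'a list"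
  assumes c: "subst_matrix \<sigma> 0 *v c = c" and u: "\<And>\<alpha>. u $ \<alpha> > 0"
    and R: "\<And>\<alpha>. (subst_matrix \<sigma> c *v u) $ \<alpha> \<ge> R * u $ \<alpha>" and R0: "R \<ge> 0"
  shows "\<exists>C>0. \<forall>k \<alpha>. partition_sum (($) c) (subst_iter \<sigma> k \<alpha>) \<ge> C * R ^ k"
proof -
  define m where "m = Min (range (($) u))"
  define m' where "m' = Max (range (($) u))"
  have "m \<in> range (($) u)" unfolding m_def by (rule Min_in) auto
  then have m0: "m > 0" using u by auto
  have mle: "m \<le> u $ \<alpha>" "u $ \<alpha> \<le> m'" for \<alpha> unfolding m_def m'_def by auto
  have m'0: "m' > 0" using m0 mle[of undefined] by simp
  have *: "partition_sum (($) c) (subst_iter \<sigma> k \<alpha>) \<ge> (R ^ k / m') * u $ \<alpha>" for k \<alpha>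
  proof (induction k arbitrary: \<alpha>)
    case 0
    show ?case using mle(2)[of \<alpha>] m'0 by (simp add: partition_sum_def)
  next
    case (Suc k)
    have "(R ^ k / m') * (R * u $ \<alpha>) \<le> (R ^ k / m') * (subst_matrix \<sigma> c *v u) $ \<alpha>"
      using R R0 m'0 by (intro mult_left_mono) auto
    also have "\<dots> = (subst_matrix \<sigma> c *v ((R ^ k / m') *\<^sub>R u)) $ \<alpha>" by (simp add: matrix_vector_mult_scaleR)
    also have "\<dots> \<le> partition_sum (($) c) (subst_iter \<sigma> (Suc k) \<alpha>)"
      unfolding partition_sum_subst_iter_Suc[OF c] using Suc by (intro subst_matrix_mono) simp
    finally show ?case by (simp add: mult_ac)
  qed
  show ?thesis
  proof (intro exI[of _ "m / m'"] conjI allI)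
    show "m / m' > 0" using m0 m'0 by simp
    fix k \<alpha>
    have "(R ^ k / m') * u $ \<alpha> \<ge> (R ^ k / m') * m" using mle R0 m'0 by (intro mult_left_mono) auto
    then show "partition_sum (($) c) (subst_iter \<sigma> k \<alpha>) \<ge> m / m' * R ^ k" using *[of k \<alpha>] by (simp add: mult_ac)
  qed
qed

lemma partition_sum_0: "partition_sum (($) 0) ws = real (length ws)"
  by (simp add: partition_sum_def psum_zero)

lemma subst_iter_length_bounds:
  assumes "pf_vector (subst_matrix \<sigma> 0) r u" "r > 0"
  shows "\<exists>C>0. \<forall>k \<alpha>. real (length (subst_iter \<sigma> k \<alpha>)) \<le> C * r ^ k"
    and "\<exists>C>0. \<forall>k \<alpha>. real (length (subst_iter \<sigma> k \<alpha>)) \<ge> C * r ^ k"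
  using partition_sum_upper[of \<sigma> 0 u r] partition_sum_lower[of \<sigma> 0 u r] assms
  by (auto simp: pf_vector_def partition_sum_0)

text \<open>A prefix of a word of level \<open>k + 1\<close> consists of full words of level \<open>k\<close> and a prefix of one.\<close>

lemma psum_subst_iter_bounded:
  fixes \<sigma> :: "'a::finite \<Rightarrow> 'a list"
  assumes summable: "summable (\<lambda>k. norm (((*v) (subst_matrix \<sigma> 0) ^^ k) s))"
  shows "\<exists>B\<ge>0. \<forall>k \<alpha> i. \<bar>psum (($) s) (subst_iter \<sigma> k \<alpha>) i\<bar> \<le> B"
proof -
  let ?n = "\<lambda>k. norm (((*v) (subst_matrix \<sigma> 0) ^^ k) s)"
  define Q where "Q = real (Max (range (\<lambda>\<alpha>. length (\<sigma> \<alpha>))))"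
  have Q: "real (length (\<sigma> \<alpha>)) \<le> Q" for \<alpha> unfolding Q_def by (intro of_nat_mono Max_ge) auto
  have Q0: "Q \<ge> 0" by (simp add: Q_def)
  \<comment> \<open>A prefix crosses at most \<open>length bs\<close> full blocks, each of total at
    most \<open>t\<close>, and ends inside one block, where \<open>b\<close> bounds the sum.\<close>
  have step: "\<bar>psum (($) s) (concat (map W bs)) i\<bar> \<le> real (length bs) * t + b"
    if W: "\<And>\<beta> i. \<bar>psum (($) s) (W \<beta>) i\<bar> \<le> b" and t: "\<And>\<beta>. \<bar>sum_list (map (($) s) (W \<beta>))\<bar> \<le> t"
      and b: "0 \<le> b" "0 \<le> t" for W bs i b t
  proof (induction bs arbitrary: i)
    case Nil
    then show ?case using b by (simp add: psum_def)
  next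
    case (Cons \<beta> bs)
    show ?case
    proof (cases "i \<le> length (W \<beta>)")
      case True
      then have "psum (($) s) (concat (map W (\<beta> # bs))) i = psum (($) s) (W \<beta>) i" by (simp add: psum_append)
      moreover have "0 \<le> real (length (\<beta> # bs)) * t" using b by (intro mult_nonneg_nonneg) auto
      ultimately show ?thesis using W[of \<beta> i] by linarith
    next
      case False
      then have "psum (($) s) (concat (map W (\<beta> # bs))) i =
        sum_list (map (($) s) (W \<beta>)) + psum (($) s) (concat (map W bs)) (i - length (W \<beta>))"
        by (simp add: psum_append)
      then show ?thesis using t[of \<beta>] Cons[of "i - length (W \<beta>)"] by (simp add: algebra_simps)
    qed
  qed
  have *: "\<bar>psum (($) s) (subst_iter \<sigma> k \<alpha>) i\<bar> \<le> norm s + Q * (\<Sum>j<k. ?n j)" for k \<alpha> i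
  proof (induction k arbitrary: \<alpha> i)
    case 0
    have "\<bar>s $ \<alpha>\<bar> \<le> norm s" by (rule component_le_norm_cart)
    then show ?case by (cases i) (auto simp: psum_def)
  next
    case (Suc k)
    have "\<bar>psum (($) s) (subst_iter \<sigma> (Suc k) \<alpha>) i\<bar> \<le>
      real (length (\<sigma> \<alpha>)) * ?n k + (norm s + Q * (\<Sum>j<k. ?n j))"
      unfolding subst_iter.simps
    proof (rule step)
      show "\<bar>sum_list (map (($) s) (subst_iter \<sigma> k \<beta>))\<bar> \<le> ?n k" for \<beta>
        unfolding sum_list_subst_iter by (rule component_le_norm_cart)
      show "0 \<le> norm s + Q * (\<Sum>j<k. ?n j)" using Q0 by (simp add: sum_nonneg)
    qed (use Suc in auto)
    also have "\<dots> \<le> Q * ?n k + (norm s + Q * (\<Sum>j<k. ?n j))"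
      using Q[of \<alpha>] by (intro add_right_mono mult_right_mono) auto
    finally show ?case by (simp add: algebra_simps)
  qed
  have "norm s + Q * (\<Sum>j<k. ?n j) \<le> norm s + Q * suminf ?n" for k
    using sum_le_suminf[OF summable, of "{..<k}"] Q0 by (intro add_left_mono mult_left_mono) auto
  then have "\<forall>k \<alpha> i. \<bar>psum (($) s) (subst_iter \<sigma> k \<alpha>) i\<bar> \<le> norm s + Q * suminf ?n"
    using * order.trans by blast
  moreover have "norm s + Q * suminf ?n \<ge> 0" using suminf_nonneg[OF summable] Q0 by simp
  ultimately show ?thesis by blast
qed

locale pf_subst =
  fixes \<sigma> :: "'a::finite \<Rightarrow> 'a list" and r :: real and l \<theta> c :: "real^'a"
  assumes M_pos: "\<And>\<alpha> \<beta>. subst_matrix \<sigma> 0 $ \<alpha> $ \<beta> > 0"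
    and r_pos: "r > 0"
    and left: "pf_vector (transpose (subst_matrix \<sigma> 0)) r l"
    and right: "pf_vector (subst_matrix \<sigma> 0) r \<theta>"
    and normal: "l \<bullet> \<theta> = 1"
    and fixed: "subst_matrix \<sigma> 0 *v c = c"
begin

definition \<psi> :: "'a \<Rightarrow> nat \<Rightarrow> real" where "\<psi> \<alpha> j = psum (($) c) (\<sigma> \<alpha>) j"

text \<open>Expectation of \<psi> under the probability weights
  \<open>l $ \<alpha> * \<theta> $ (\<sigma> \<alpha> ! j) / r\<close> on pairs (\<alpha>, j). It
  becomes the double sum in \<open>G_const\<close>, with \<open>1 / r\<close> for exp (-
  \<rho>_T).\<close>

definition mean :: real where
  "mean = (\<Sum>\<alpha>\<in>UNIV. \<Sum>j<length (\<sigma> \<alpha>). \<theta> $ (\<sigma> \<alpha> ! j) * (1 / r) * l $ \<alpha> * \<psi> \<alpha> j)"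

lemma l_pos: "l $ \<alpha> > 0" and \<theta>_pos: "\<theta> $ \<alpha> > 0"
  using left right by (auto simp: pf_vector_def)

lemma right_sum: "(\<Sum>j<length (\<sigma> \<alpha>). \<theta> $ (\<sigma> \<alpha> ! j)) = r * \<theta> $ \<alpha>"
proof -
  have "(subst_matrix \<sigma> 0 *v \<theta>) $ \<alpha> = (r *s \<theta>) $ \<alpha>" using right by (simp only: pf_vector_def)
  then show ?thesis by (simp add: subst_matrix_0_apply)
qed

lemma left_sum: "(\<Sum>\<alpha>\<in>UNIV. l $ \<alpha> * (\<Sum>j<length (\<sigma> \<alpha>). g (\<sigma> \<alpha> ! j))) = r * (\<Sum>\<alpha>\<in>UNIV. l $ \<alpha> * g \<alpha>)"
proof -
  have "l \<bullet> (subst_matrix \<sigma> 0 *v (\<chi> \<beta>. g \<beta>)) = (transpose (subst_matrix \<sigma> 0) *v l) \<bullet> (\<chi> \<beta>. g \<beta>)"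
    by (simp add: dot_lmul_matrix)
  also have "\<dots> = r * (l \<bullet> (\<chi> \<beta>. g \<beta>))" using left by (simp add: pf_vector_def scalar_mult_eq_scaleR)
  finally show ?thesis by (simp add: inner_vec_def subst_matrix_0_apply)
qed

lemma normal_sum: "(\<Sum>\<alpha>\<in>UNIV. l $ \<alpha> * \<theta> $ \<alpha>) = 1"
  using normal by (simp add: inner_vec_def)

text \<open>For u = \<theta> + t w the inequality is an equality at t = 0; the corrector
  \<open>w\<close> is chosen so that the difference of the two sides has derivative r \<epsilon>
  \<theta> > 0 there, in every coordinate.\<close>

lemma tilted_growth:
  assumes eps: "\<epsilon> > 0"
  shows "\<exists>t>0. \<exists>u. (\<forall>\<alpha>. u $ \<alpha> > 0) \<and>
    (\<forall>\<alpha>. (subst_matrix \<sigma> (t *\<^sub>R c) *v u) $ \<alpha> \<le> (r * exp (t * (mean + \<epsilon>))) * u $ \<alpha>)"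
proof -
  define y' where "y' = (\<chi> \<alpha>. \<Sum>j<length (\<sigma> \<alpha>). \<psi> \<alpha> j * \<theta> $ (\<sigma> \<alpha> ! j))"
  have ly': "l \<bullet> y' = r * mean"
    unfolding mean_def y'_def inner_vec_def using r_pos
    by (simp add: sum_distrib_left mult_ac)
  \<comment> \<open>Solvability condition for the corrector; it singles out \<open>mean\<close> as
    the drift.\<close>
  have "l \<bullet> ((r * mean) *\<^sub>R \<theta> - y') = 0" using ly' normal by (simp add: inner_diff_right)
  from pf_corrector[OF M_pos left this]
  obtain w where w: "subst_matrix \<sigma> 0 *v w = r *s w + ((r * mean) *\<^sub>R \<theta> - y')" by blast
  define h where "h \<alpha> t = r * exp (t * (mean + \<epsilon>)) * (\<theta> $ \<alpha> + t * w $ \<alpha>) -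
    (\<Sum>j<length (\<sigma> \<alpha>). exp (t * \<psi> \<alpha> j) * (\<theta> $ (\<sigma> \<alpha> ! j) + t * w $ (\<sigma> \<alpha> ! j)))" for \<alpha> t
  have h_pos: "eventually (\<lambda>t. h \<alpha> t > 0) (at_right 0)" for \<alpha>
  proof -
    have h0: "h \<alpha> 0 = 0" by (simp add: h_def right_sum)
    have d: "(h \<alpha> has_real_derivative
      (r * (mean + \<epsilon>) * \<theta> $ \<alpha> + r * w $ \<alpha> -
       (\<Sum>j<length (\<sigma> \<alpha>). \<psi> \<alpha> j * \<theta> $ (\<sigma> \<alpha> ! j) + w $ (\<sigma> \<alpha> ! j)))) (at 0)"
      unfolding h_def
      by (auto intro!: derivative_eq_intros sum.cong simp: algebra_simps)
    have "(subst_matrix \<sigma> 0 *v w) $ \<alpha> = (r *s w + ((r * mean) *\<^sub>R \<theta> - y')) $ \<alpha>" by (simp only: w)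
    then have "(\<Sum>j<length (\<sigma> \<alpha>). w $ (\<sigma> \<alpha> ! j)) = r * w $ \<alpha> + r * mean * \<theta> $ \<alpha> - y' $ \<alpha>"
      by (simp add: subst_matrix_0_apply)
    moreover have "y' $ \<alpha> = (\<Sum>j<length (\<sigma> \<alpha>). \<psi> \<alpha> j * \<theta> $ (\<sigma> \<alpha> ! j))" by (simp add: y'_def)
    ultimately have "r * (mean + \<epsilon>) * \<theta> $ \<alpha> + r * w $ \<alpha> -
       (\<Sum>j<length (\<sigma> \<alpha>). \<psi> \<alpha> j * \<theta> $ (\<sigma> \<alpha> ! j) + w $ (\<sigma> \<alpha> ! j)) = r * \<epsilon> * \<theta> $ \<alpha>"
      by (simp add: sum.distrib algebra_simps)
    moreover have "r * \<epsilon> * \<theta> $ \<alpha> > 0" using r_pos eps \<theta>_pos by simp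
    ultimately obtain d where "d > 0" "\<forall>x>0. x < d \<longrightarrow> h \<alpha> 0 < h \<alpha> (0 + x)"
      using DERIV_pos_inc_right[OF d] by auto
    then show ?thesis using h0 unfolding eventually_at_right_field by auto
  qed
  have u_pos: "eventually (\<lambda>t. \<theta> $ \<alpha> + t * w $ \<alpha> > 0) (at_right 0)" for \<alpha>
  proof -
    have "((\<lambda>t. \<theta> $ \<alpha> + t * w $ \<alpha>) \<longlongrightarrow> \<theta> $ \<alpha> + 0 * w $ \<alpha>) (at_right 0)" by (intro tendsto_intros)
    then show ?thesis using \<theta>_pos[of \<alpha>] by (intro order_tendstoD(1)) auto
  qed
  have "eventually (\<lambda>t. (\<forall>\<alpha>. h \<alpha> t > 0) \<and> (\<forall>\<alpha>. \<theta> $ \<alpha> + t * w $ \<alpha> > 0) \<and> t > 0) (at_right 0)"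
    using h_pos u_pos by (intro eventually_conj eventually_all_finite eventually_at_right_less) auto
  then obtain t where t: "\<forall>\<alpha>. h \<alpha> t > 0" "\<forall>\<alpha>. \<theta> $ \<alpha> + t * w $ \<alpha> > 0" "t > 0"
    using eventually_happens'[OF trivial_limit_at_right_real] by blast
  let ?u = "\<theta> + t *\<^sub>R w"
  have "psum (($) (t *\<^sub>R c)) (\<sigma> \<alpha>) j = t * \<psi> \<alpha> j" for \<alpha> j
    unfolding \<psi>_def using psum_scale[of t "($) c" "\<sigma> \<alpha>" j] by (simp add: vector_scaleR_component[abs_def])
  then have "(subst_matrix \<sigma> (t *\<^sub>R c) *v ?u) $ \<alpha> \<le> (r * exp (t * (mean + \<epsilon>))) * ?u $ \<alpha>" for \<alpha>
    using t(1)[rule_format, of \<alpha>] by (simp add: subst_matrix_apply h_def)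
  then show ?thesis using t by (intro exI[of _ t] conjI exI[of _ ?u]) auto
qed

text \<open>Exponential Markov inequality: half of \<epsilon> is spent on the growth rate of the
  tilted partition sum, the other half leaves \<delta> = t \<epsilon> / 2.\<close>

lemma large_deviation_upper:
  assumes eps: "\<epsilon> > 0"
  shows "\<exists>\<delta>>0. \<exists>C>0. \<forall>k. real (card (SIGMA \<alpha>:UNIV. {i. i < length (subst_iter \<sigma> k \<alpha>) \<and>
     real k * (mean + \<epsilon>) \<le> psum (($) c) (subst_iter \<sigma> k \<alpha>) i})) \<le> C * (r * exp (- \<delta>)) ^ k"
proof -
  obtain t u where t: "t > 0" and u: "\<forall>\<alpha>. u $ \<alpha> > 0"
    and tu: "\<forall>\<alpha>. (subst_matrix \<sigma> (t *\<^sub>R c) *v u) $ \<alpha> \<le> (r * exp (t * (mean + \<epsilon> / 2))) * u $ \<alpha>"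
    using tilted_growth[of "\<epsilon> / 2"] eps by auto
  have fixt: "subst_matrix \<sigma> 0 *v (t *\<^sub>R c) = t *\<^sub>R c" by (simp add: matrix_vector_mult_scaleR fixed)
  obtain C where C: "C > 0" and bnd: "\<And>k \<alpha>. partition_sum (($) (t *\<^sub>R c)) (subst_iter \<sigma> k \<alpha>) \<le>
      C * (r * exp (t * (mean + \<epsilon> / 2))) ^ k"
    using partition_sum_upper[OF fixt, of u "r * exp (t * (mean + \<epsilon> / 2))"] u tu r_pos by auto
  have ps: "psum (($) (t *\<^sub>R c)) ws j = t * psum (($) c) ws j" for ws j
    using psum_scale[of t "($) c" ws j] by (simp add: vector_scaleR_component[abs_def])
  let ?B = "\<lambda>k \<alpha>. {i. i < length (subst_iter \<sigma> k \<alpha>) \<and> real k * (mean + \<epsilon>) \<le> psum (($) c) (subst_iter \<sigma> k \<alpha>) i}"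
  have card1: "real (card (?B k \<alpha>)) \<le> C * (r * exp (- (t * \<epsilon> / 2))) ^ k" for k \<alpha>
  proof -
    let ?e = "exp (t * (real k * (mean + \<epsilon>)))"
    have "real (card (?B k \<alpha>)) * ?e = (\<Sum>i\<in>?B k \<alpha>. ?e)" by simp
    also have "\<dots> \<le> (\<Sum>i\<in>?B k \<alpha>. exp (psum (($) (t *\<^sub>R c)) (subst_iter \<sigma> k \<alpha>) i))"
      using t by (intro sum_mono) (auto simp: ps)
    also have "\<dots> \<le> partition_sum (($) (t *\<^sub>R c)) (subst_iter \<sigma> k \<alpha>)"
      unfolding partition_sum_def by (intro sum_mono2) auto
    also have "\<dots> \<le> C * (r * exp (t * (mean + \<epsilon> / 2))) ^ k" by (rule bnd)
    also have "\<dots> = C * (r * exp (- (t * \<epsilon> / 2))) ^ k * ?e"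
    proof -
      have "(r * exp (t * (mean + \<epsilon> / 2))) ^ k = (r * exp (- (t * \<epsilon> / 2)) * exp (t * (mean + \<epsilon>))) ^ k"
        by (simp add: mult_exp_exp algebra_simps)
      also have "\<dots> = (r * exp (- (t * \<epsilon> / 2))) ^ k * ?e"
        by (simp add: power_mult_distrib exp_of_nat_mult[symmetric] mult_ac)
      finally show ?thesis by simp
    qed
    finally show ?thesis by simp
  qed
  have "real (card (Sigma UNIV (?B k))) \<le> (real CARD('a) * C) * (r * exp (- (t * \<epsilon> / 2))) ^ k" for k
  proof -
    have "real (card (Sigma UNIV (?B k))) = (\<Sum>\<alpha>\<in>UNIV. real (card (?B k \<alpha>)))"
      by (subst card_SigmaI) auto
    also have "\<dots> \<le> (\<Sum>\<alpha>\<in>(UNIV::'a set). C * (r * exp (- (t * \<epsilon> / 2))) ^ k)"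
      by (intro sum_mono card1)
    finally show ?thesis by (simp add: mult_ac)
  qed
  then show ?thesis using t eps C by (intro exI[of _ "t * \<epsilon> / 2"] conjI exI[of _ "real CARD('a) * C"]) auto
qed

text \<open>\<open>\<theta> $ (\<sigma> \<alpha> ! j) / (r * \<theta> $ \<alpha>)\<close> and \<open>exp (\<psi> \<alpha> j) * \<eta> $ (\<sigma> \<alpha> ! j) / (s * \<eta> $ \<alpha>)\<close> are two families of
  probability vectors, and Gibbs' inequality compares them. In case of equality \<open>x = \<eta> / \<theta>\<close> is
  constant along first letters.\<close>

lemma mean_strict:
  assumes c0: "c \<noteq> 0" and card: "CARD('a) \<ge> 2"
    and eta: "pf_vector (subst_matrix \<sigma> c) s \<eta>" and s: "s > 0"
    and first: "\<And>\<alpha>. subst_iter \<sigma> k \<alpha> ! 0 = \<alpha>0"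
  shows "ln r < ln s - mean"
proof (rule ccontr)
  assume neg: "\<not> ?thesis"
  have \<eta>_pos: "\<eta> $ \<alpha> > 0" for \<alpha> using eta by (simp add: pf_vector_def)
  have eta_sum: "(\<Sum>j<length (\<sigma> \<alpha>). exp (\<psi> \<alpha> j) * \<eta> $ (\<sigma> \<alpha> ! j)) = s * \<eta> $ \<alpha>" for \<alpha>
  proof -
    have "(subst_matrix \<sigma> c *v \<eta>) $ \<alpha> = (s *s \<eta>) $ \<alpha>" using eta by (simp only: pf_vector_def)
    then show ?thesis by (simp add: subst_matrix_apply \<psi>_def)
  qed
  define x where "x \<alpha> = \<eta> $ \<alpha> / \<theta> $ \<alpha>" for \<alpha>
  have x_pos: "x \<alpha> > 0" for \<alpha> using \<eta>_pos \<theta>_pos by (simp add: x_def)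
  \<comment> \<open>The quotient of the second family of probability vectors by the first.\<close>
  define q where "q \<alpha> j = exp (\<psi> \<alpha> j) * x (\<sigma> \<alpha> ! j) * r / (s * x \<alpha>)" for \<alpha> j
  have q_pos: "q \<alpha> j > 0" for \<alpha> j using x_pos r_pos s by (simp add: q_def)
  \<comment> \<open>The first family, weighted by the distribution
    \<open>l $ \<alpha> * \<theta> $ \<alpha>\<close> of \<alpha>; the sum of \<open>D\<close> is
    then a relative entropy.\<close>
  define W where "W \<alpha> j = l $ \<alpha> * \<theta> $ (\<sigma> \<alpha> ! j) / r" for \<alpha> j
  have W_pos: "W \<alpha> j > 0" for \<alpha> j using l_pos \<theta>_pos r_pos by (simp add: W_def)
  define D where "D \<alpha> j = W \<alpha> j * (q \<alpha> j - 1 - ln (q \<alpha> j))" for \<alpha> j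
  have D_nonneg: "D \<alpha> j \<ge> 0" for \<alpha> j
    using ln_le_minus_one[OF q_pos] W_pos[of \<alpha> j] by (simp add: D_def)
  have sum_W: "(\<Sum>\<alpha>\<in>UNIV. \<Sum>j<length (\<sigma> \<alpha>). W \<alpha> j) = 1"
  proof -
    have "(\<Sum>j<length (\<sigma> \<alpha>). W \<alpha> j) = l $ \<alpha> * \<theta> $ \<alpha>" for \<alpha>
      using right_sum[of \<alpha>] r_pos by (simp add: W_def sum_distrib_left[symmetric] sum_divide_distrib[symmetric])
    then show ?thesis by (simp add: normal_sum)
  qed
  have sum_Wq: "(\<Sum>\<alpha>\<in>UNIV. \<Sum>j<length (\<sigma> \<alpha>). W \<alpha> j * q \<alpha> j) = 1"
  proof -
    have "(\<Sum>j<length (\<sigma> \<alpha>). W \<alpha> j * q \<alpha> j) = l $ \<alpha> * \<theta> $ \<alpha>" for \<alpha>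
    proof -
      have "(\<Sum>j<length (\<sigma> \<alpha>). W \<alpha> j * q \<alpha> j) =
        (\<Sum>j<length (\<sigma> \<alpha>). (l $ \<alpha> / (s * x \<alpha>)) * (exp (\<psi> \<alpha> j) * \<eta> $ (\<sigma> \<alpha> ! j)))"
      proof (intro sum.cong refl)
        fix j
        have "\<theta> $ (\<sigma> \<alpha> ! j) * x (\<sigma> \<alpha> ! j) = \<eta> $ (\<sigma> \<alpha> ! j)"
          using \<theta>_pos[of "\<sigma> \<alpha> ! j"] by (simp add: x_def)
        then show "W \<alpha> j * q \<alpha> j = (l $ \<alpha> / (s * x \<alpha>)) * (exp (\<psi> \<alpha> j) * \<eta> $ (\<sigma> \<alpha> ! j))"
          using r_pos by (simp add: W_def q_def field_simps)
      qed
      also have "\<dots> = (l $ \<alpha> / (s * x \<alpha>)) * (s * \<eta> $ \<alpha>)" by (simp only: sum_distrib_left[symmetric] eta_sum)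
      also have "\<dots> = l $ \<alpha> * \<theta> $ \<alpha>" using s \<eta>_pos[of \<alpha>] \<theta>_pos[of \<alpha>] by (simp add: x_def)
      finally show ?thesis .
    qed
    then show ?thesis by (simp add: normal_sum)
  qed
  \<comment> \<open>The terms with \<open>ln (x ...)\<close> form a coboundary and cancel, since the
    distribution of \<alpha> is stationary by the left eigenvector equation.\<close>
  have sum_Wln: "(\<Sum>\<alpha>\<in>UNIV. \<Sum>j<length (\<sigma> \<alpha>). W \<alpha> j * ln (q \<alpha> j)) = mean + ln r - ln s"
  proof -
    have lnq: "ln (q \<alpha> j) = \<psi> \<alpha> j + ln (x (\<sigma> \<alpha> ! j)) - ln (x \<alpha>) + (ln r - ln s)" for \<alpha> j
      unfolding q_def using x_pos[of \<alpha>] x_pos[of "\<sigma> \<alpha> ! j"] r_pos s by (simp add: ln_mult ln_div)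
    have "W \<alpha> j * ln (q \<alpha> j) = \<theta> $ (\<sigma> \<alpha> ! j) * (1 / r) * l $ \<alpha> * \<psi> \<alpha> j
        + (1 / r) * (l $ \<alpha> * (\<theta> $ (\<sigma> \<alpha> ! j) * ln (x (\<sigma> \<alpha> ! j))))
        - (l $ \<alpha> * ln (x \<alpha>) / r) * \<theta> $ (\<sigma> \<alpha> ! j) + W \<alpha> j * (ln r - ln s)" for \<alpha> j
      unfolding lnq W_def by (simp add: algebra_simps add_divide_distrib diff_divide_distrib)
    then have "(\<Sum>\<alpha>\<in>UNIV. \<Sum>j<length (\<sigma> \<alpha>). W \<alpha> j * ln (q \<alpha> j)) = mean
        + (1 / r) * (\<Sum>\<alpha>\<in>UNIV. l $ \<alpha> * (\<Sum>j<length (\<sigma> \<alpha>). \<theta> $ (\<sigma> \<alpha> ! j) * ln (x (\<sigma> \<alpha> ! j))))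
        - (\<Sum>\<alpha>\<in>UNIV. (l $ \<alpha> * ln (x \<alpha>) / r) * (\<Sum>j<length (\<sigma> \<alpha>). \<theta> $ (\<sigma> \<alpha> ! j)))
        + (\<Sum>\<alpha>\<in>UNIV. \<Sum>j<length (\<sigma> \<alpha>). W \<alpha> j) * (ln r - ln s)"
      unfolding mean_def by (simp only: sum.distrib sum_subtractf sum_distrib_left sum_distrib_right)
    also have "(1 / r) * (\<Sum>\<alpha>\<in>UNIV. l $ \<alpha> * (\<Sum>j<length (\<sigma> \<alpha>). \<theta> $ (\<sigma> \<alpha> ! j) * ln (x (\<sigma> \<alpha> ! j)))) =
        (\<Sum>\<alpha>\<in>UNIV. l $ \<alpha> * (\<theta> $ \<alpha> * ln (x \<alpha>)))"
      using left_sum[of "\<lambda>\<beta>. \<theta> $ \<beta> * ln (x \<beta>)"] r_pos by simp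
    also have "(\<Sum>\<alpha>\<in>UNIV. (l $ \<alpha> * ln (x \<alpha>) / r) * (\<Sum>j<length (\<sigma> \<alpha>). \<theta> $ (\<sigma> \<alpha> ! j))) =
        (\<Sum>\<alpha>\<in>UNIV. l $ \<alpha> * (\<theta> $ \<alpha> * ln (x \<alpha>)))"
      using r_pos by (simp add: right_sum mult_ac)
    finally show ?thesis by (simp add: sum_W)
  qed
  have "(\<Sum>\<alpha>\<in>UNIV. \<Sum>j<length (\<sigma> \<alpha>). D \<alpha> j) = ln s - ln r - mean"
    using sum_W sum_Wq sum_Wln by (simp add: D_def algebra_simps sum.distrib sum_subtractf)
  then have "(\<Sum>\<alpha>\<in>UNIV. \<Sum>j<length (\<sigma> \<alpha>). D \<alpha> j) \<le> 0" using neg by simp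
  moreover have "(\<Sum>j<length (\<sigma> \<alpha>). D \<alpha> j) \<ge> 0" for \<alpha> using D_nonneg by (simp add: sum_nonneg)
  ultimately have "(\<Sum>j<length (\<sigma> \<alpha>). D \<alpha> j) = 0" for \<alpha>
    by (meson UNIV_I finite order_antisym sum_nonneg sum_nonneg_eq_0_iff)
  then have D0: "D \<alpha> j = 0" if "j < length (\<sigma> \<alpha>)" for \<alpha> j
    using D_nonneg that by (metis finite_lessThan lessThan_iff sum_nonneg_eq_0_iff)
  have q1: "q \<alpha> j = 1" if "j < length (\<sigma> \<alpha>)" for \<alpha> j
    using D0[OF that] W_pos[of \<alpha> j] ln_eq_minus_one[OF q_pos, of \<alpha> j] by (simp add: D_def)
  have ne: "\<sigma> \<alpha> \<noteq> []" for \<alpha>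
    using M_pos[of \<alpha> \<alpha>] unfolding subst_matrix_pos_iff by auto
  have eqn: "exp (\<psi> \<alpha> j) * x (\<sigma> \<alpha> ! j) = (s / r) * x \<alpha>" if "j < length (\<sigma> \<alpha>)" for \<alpha> j
    using q1[OF that] s r_pos x_pos[of \<alpha>] by (simp add: q_def field_simps)
  have eqn0: "x (\<sigma> \<alpha> ! 0) = (s / r) * x \<alpha>" for \<alpha> using eqn[of 0 \<alpha>] ne[of \<alpha>] by (simp add: \<psi>_def)
  \<comment> \<open>For j = 0 the prefix sum is empty; at a maximum or minimum of \<open>x\<close>,
    a factor s / r other than 1 would lead out of the range of \<open>x\<close>.\<close>
  have sr: "s / r = 1"
  proof (rule antisym)
    define b where "b = Max (range x)"
    have b: "b \<in> range x" "\<And>\<alpha>. x \<alpha> \<le> b" unfolding b_def by (auto intro: Max_in)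
    then obtain \<alpha> where "b = x \<alpha>" by blast
    then have "(s / r) * b \<le> 1 * b" "b > 0" using eqn0[of \<alpha>] b(2) x_pos by (metis mult_1)+
    then show "s / r \<le> 1" by (meson mult_le_cancel_right_pos)
    define a where "a = Min (range x)"
    have a: "a \<in> range x" "\<And>\<alpha>. a \<le> x \<alpha>" unfolding a_def by (auto intro: Min_in)
    then obtain \<alpha> where "a = x \<alpha>" by blast
    then have "1 * a \<le> (s / r) * a" "a > 0" using eqn0[of \<alpha>] a(2) x_pos by (metis mult_1)+
    then show "1 \<le> s / r" by (meson mult_le_cancel_right_pos)
  qed
  have swne: "subst_iter \<sigma> k \<alpha> \<noteq> []" for k \<alpha>
    by (induction k arbitrary: \<alpha>) (auto simp: ne)
  have "x (subst_iter \<sigma> k \<alpha> ! 0) = x \<alpha>" for k \<alpha>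
  proof (induction k arbitrary: \<alpha>)
    case (Suc k)
    obtain \<beta> bs where bs: "\<sigma> \<alpha> = \<beta> # bs" using ne[of \<alpha>] by (metis neq_Nil_conv)
    have "subst_iter \<sigma> (Suc k) \<alpha> ! 0 = subst_iter \<sigma> k \<beta> ! 0" using swne[of k \<beta>] by (simp add: bs nth_append)
    then show ?case using Suc[of \<beta>] eqn0[of \<alpha>] sr by (simp add: bs)
  qed simp
  then have x_const: "x \<alpha> = x \<alpha>0" for \<alpha> using first by metis
  have psi0: "\<psi> \<alpha> j = 0" if "j < length (\<sigma> \<alpha>)" for \<alpha> j
  proof -
    have "exp (\<psi> \<alpha> j) * x \<alpha>0 = x \<alpha>0" using eqn[OF that] sr x_const by (metis mult_1)
    then show ?thesis using x_pos[of \<alpha>0] by simp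
  qed
  \<comment> \<open>All proper prefix sums vanish, so only the last letter of each word can carry
    \<open>c\<close>.\<close>
  have inner0: "c $ (\<sigma> \<alpha> ! j) = 0" if "Suc j < length (\<sigma> \<alpha>)" for \<alpha> j
    using psi0[of j \<alpha>] psi0[of "Suc j" \<alpha>] that by (simp add: \<psi>_def psum_Suc)
  have last: "c $ \<alpha> = c $ last (\<sigma> \<alpha>)" for \<alpha>
  proof -
    let ?n = "length (\<sigma> \<alpha>) - 1"
    have n: "?n < length (\<sigma> \<alpha>)" using ne[of \<alpha>] by simp
    have "c $ \<alpha> = sum_list (map (($) c) (\<sigma> \<alpha>))" using fixed subst_matrix_0_apply_list[of \<sigma> c \<alpha>] by simp
    also have "\<dots> = psum (($) c) (\<sigma> \<alpha>) (Suc ?n)" using n by (simp add: psum_def)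
    also have "\<dots> = c $ (\<sigma> \<alpha> ! ?n)" using n psi0[OF n] by (simp only: psum_Suc \<psi>_def)
    finally show ?thesis using ne[of \<alpha>] by (simp add: last_conv_nth)
  qed
  have occurs: "\<exists>j<length (\<sigma> \<alpha>). \<sigma> \<alpha> ! j = \<beta>" for \<alpha> \<beta>
    using M_pos[of \<alpha> \<beta>] by (simp only: subst_matrix_pos_iff)
  \<comment> \<open>Contradiction: a letter \<beta> with \<open>c $ \<beta> \<noteq> 0\<close>
    occurs in every word and must be its last letter. Then \<open>c\<close> is also nonzero at any
    other letter \<gamma>, so that \<gamma> would have to be last in its own word.\<close>
  obtain \<beta> where b: "c $ \<beta> \<noteq> 0" using c0 by (auto simp: vec_eq_iff)
  have lb: "last (\<sigma> \<alpha>) = \<beta>" for \<alpha>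
  proof -
    obtain j where j: "j < length (\<sigma> \<alpha>)" "\<sigma> \<alpha> ! j = \<beta>" using occurs by blast
    then have "\<not> Suc j < length (\<sigma> \<alpha>)" using inner0 b by blast
    then have "j = length (\<sigma> \<alpha>) - 1" using j(1) by simp
    then show ?thesis using j ne[of \<alpha>] by (simp add: last_conv_nth)
  qed
  obtain \<gamma> where g: "\<gamma> \<noteq> \<beta>"
    using card by (metis (full_types) card_1_singleton_iff UNIV_eq_I insertI1 Suc_1 One_nat_def not_less_eq_eq order_refl)
  have "c $ \<gamma> \<noteq> 0" using last[of \<gamma>] lb b by simp
  moreover obtain j where j: "j < length (\<sigma> \<gamma>)" "\<sigma> \<gamma> ! j = \<gamma>" using occurs by blast
  ultimately have "\<not> Suc j < length (\<sigma> \<gamma>)" using inner0 by metis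
  then have "j = length (\<sigma> \<gamma>) - 1" using j(1) by simp
  then have "last (\<sigma> \<gamma>) = \<gamma>" using j ne[of \<gamma>] by (simp add: last_conv_nth)
  then show False using lb g by simp
qed

end

text \<open>The upper bound for \<open>- c\<close>, whose mean is the negative.\<close>

lemma large_deviation_lower:
  assumes "pf_subst \<sigma> r l \<theta> c" "\<epsilon> > 0"
  shows "\<exists>\<delta>>0. \<exists>C>0. \<forall>k. real (card (SIGMA \<alpha>:UNIV. {i. i < length (subst_iter \<sigma> k \<alpha>) \<and>
     psum (($) c) (subst_iter \<sigma> k \<alpha>) i \<le> real k * (pf_subst.mean \<sigma> r l \<theta> c - \<epsilon>)})) \<le> C * (r * exp (- \<delta>)) ^ k"
proof -
  interpret pf_subst \<sigma> r l \<theta> c by fact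
  interpret neg: pf_subst \<sigma> r l \<theta> "- c"
    by unfold_locales
      (use M_pos r_pos left right normal fixed matrix_vector_mult_scaleR[of "subst_matrix \<sigma> 0" "-1" c] in auto)
  have ps: "psum (($) (- c)) ws j = - psum (($) c) ws j" for ws j
    using psum_scale[of "-1" "($) c" ws j] by (simp add: vector_uminus_component[abs_def])
  have "neg.mean = - mean"
    by (simp add: mean_def neg.mean_def \<psi>_def neg.\<psi>_def ps sum_negf)
  then have "real k * (neg.mean + \<epsilon>) \<le> psum (($) (- c)) ws i \<longleftrightarrow> psum (($) c) ws i \<le> real k * (mean - \<epsilon>)" for k ws i
    by (auto simp: ps algebra_simps)
  then show ?thesis using neg.large_deviation_upper[OF assms(2)] by simp
qed

text \<open>Each step forward contracts the ratios to the Perron--Frobenius eigenvector by a fixed factor.\<close>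

lemma pf_backward_orbit:
  fixes A :: "real^'n^'n" and v :: "nat \<Rightarrow> real^'n"
  assumes A: "\<And>i j. A $ i $ j > 0" and l: "pf_vector A r l"
    and vpos: "\<And>k i. v k $ i > 0" and step: "\<And>k. v k = A *v v (Suc k)"
  shows "A *v v 0 = r *s v 0"
proof -
  have lpos: "l $ i > 0" for i using l by (simp add: pf_vector_def)
  have Al: "(\<Sum>j\<in>UNIV. A $ i $ j * l $ j) = r * l $ i" for i
  proof -
    have "(A *v l) $ i = (r *s l) $ i" using l by (simp only: pf_vector_def)
    then show ?thesis by (simp add: matrix_vector_mult_def)
  qed
  \<comment> \<open>Every column of A is comparable to \<open>l\<close> with constants
    \<open>a\<close> and \<open>b\<close>, hence so is the image of any nonnegative vector, relative
    to the sum of its entries.\<close>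
  define a where "a = Min (range (\<lambda>(i, j). A $ i $ j / l $ i))"
  define b where "b = Max (range (\<lambda>(i, j). A $ i $ j / l $ i))"
  have "a \<in> range (\<lambda>(i, j). A $ i $ j / l $ i)" unfolding a_def by (intro Min_in) auto
  then have a0: "a > 0" using A lpos by auto
  have ab: "a \<le> A $ i $ j / l $ i" "A $ i $ j / l $ i \<le> b" for i j
    unfolding a_def b_def by (auto intro!: Min_le Max_ge image_eqI[of _ _ "(i, j)"])
  have aA: "a * l $ i \<le> A $ i $ j" and bA: "A $ i $ j \<le> b * l $ i" for i j
    using ab[of i j] lpos[of i] by (simp_all add: field_simps)
  have lower: "(A *v z) $ i \<ge> a * (\<Sum>j\<in>UNIV. z $ j) * l $ i" if "\<And>j. z $ j \<ge> 0" for z i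
  proof -
    have "a * (\<Sum>j\<in>UNIV. z $ j) * l $ i = (\<Sum>j\<in>UNIV. (a * l $ i) * z $ j)"
      by (simp add: sum_distrib_left sum_distrib_right mult_ac)
    also have "\<dots> \<le> (A *v z) $ i"
      unfolding matrix_vector_mult_def using aA that by (auto intro!: sum_mono mult_right_mono)
    finally show ?thesis .
  qed
  define L where "L = (\<Sum>j\<in>UNIV. l $ j)"
  have L0: "L > 0" unfolding L_def using lpos by (intro sum_pos) auto
  have r0: "r > 0"
  proof -
    have "(\<Sum>j\<in>UNIV. A $ undefined $ j * l $ j) > 0" using A lpos by (intro sum_pos) auto
    then show ?thesis using Al[of undefined] lpos[of undefined] by (metis zero_less_mult_pos2)
  qed
  \<comment> \<open>The share of the oscillation that one application of A removes.\<close>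
  define d where "d = a * L / r"
  have d: "d > 0" "d \<le> 1"
  proof -
    show "d > 0" using a0 L0 r0 by (simp add: d_def)
    have "(A *v l) $ i \<ge> a * L * l $ i" for i using lower[of l i] lpos by (simp add: L_def less_imp_le)
    then have "r * l $ i \<ge> a * L * l $ i" for i using l by (simp add: pf_vector_def)
    then have "a * L \<le> r" using lpos[of undefined] by (meson mult_le_cancel_right_pos)
    then show "d \<le> 1" using r0 by (simp add: d_def)
  qed
  \<comment> \<open>\<open>P q\<close> says that every \<open>v k\<close> lies within a factor 1 + q
    of a multiple of \<open>l\<close>. Uniformity in k allows arbitrarily many contractions to end
    at \<open>v 0\<close>.\<close>
  define P where "P q \<longleftrightarrow> (\<forall>k. \<exists>m>0. \<forall>i. m * l $ i \<le> v k $ i \<and> v k $ i \<le> m * (1 + q) * l $ i)" for q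
  define Q where "Q = b / a"
  have "b \<ge> a" using ab[of undefined undefined] by simp
  then have Q0: "Q \<ge> 0" using a0 by (simp add: Q_def)
  have PQ: "P Q" unfolding P_def
  proof
    fix k
    define S where "S = (\<Sum>j\<in>UNIV. v (Suc k) $ j)"
    have S: "S > 0" unfolding S_def using vpos by (intro sum_pos) auto
    have "v k $ i \<le> b * S * l $ i" for i
    proof -
      have "v k $ i = (\<Sum>j\<in>UNIV. A $ i $ j * v (Suc k) $ j)" by (simp add: step[of k] matrix_vector_mult_def)
      also have "\<dots> \<le> (\<Sum>j\<in>UNIV. (b * l $ i) * v (Suc k) $ j)"
        using bA vpos by (intro sum_mono mult_right_mono) (auto simp: less_imp_le)
      finally show ?thesis by (simp add: S_def sum_distrib_left sum_distrib_right mult_ac)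
    qed
    moreover have "b * S * l $ i \<le> (a * S) * (1 + Q) * l $ i" for i
      using a0 S lpos[of i] by (simp add: Q_def field_simps)
    moreover have "(a * S) * l $ i \<le> v k $ i" for i
      using lower[of "v (Suc k)" i] vpos by (simp add: step[of k] S_def less_imp_le)
    ultimately show "\<exists>m>0. \<forall>i. m * l $ i \<le> v k $ i \<and> v k $ i \<le> m * (1 + Q) * l $ i"
      using a0 S by (intro exI[of _ "a * S"]) (metis mult_pos_pos order.trans)
  qed
  have Pstep: "P ((1 - d) * q)" if P: "P q" and q: "q \<ge> 0" for q
    unfolding P_def
  proof
    fix k
    obtain m where m: "m > 0" "\<And>i. m * l $ i \<le> v (Suc k) $ i" "\<And>i. v (Suc k) $ i \<le> m * (1 + q) * l $ i"
      using P unfolding P_def by blast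
    \<comment> \<open>The excess \<open>z\<close> over the lower multiple of \<open>l\<close> and
      the deficit \<open>z'\<close> below the upper one are both nonnegative. A spreads each over
      all coordinates, which raises the lower bound and reduces the upper one.\<close>
    define z where "z = v (Suc k) - m *\<^sub>R l"
    define z' where "z' = (m * q) *\<^sub>R l - z"
    define S where "S = (\<Sum>j\<in>UNIV. z $ j)"
    have z: "z $ j \<ge> 0" and z': "z' $ j \<ge> 0" for j
      using m(2)[of j] m(3)[of j] by (simp_all add: z_def z'_def algebra_simps)
    have S0: "S \<ge> 0" unfolding S_def using z by (intro sum_nonneg) auto
    have S': "(\<Sum>j\<in>UNIV. z' $ j) = m * q * L - S"
      by (simp add: z'_def S_def L_def sum_subtractf sum_distrib_left)
    have vk: "v k $ i = m * r * l $ i + (A *v z) $ i" for i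
    proof -
      have "v (Suc k) = m *\<^sub>R l + z" by (simp add: z_def)
      then have "v k = m *\<^sub>R (A *v l) + A *v z"
        by (simp add: step[of k] matrix_vector_right_distrib matrix_vector_mult_scaleR)
      then show ?thesis using l by (simp add: pf_vector_def)
    qed
    have Az': "(A *v z') $ i = m * q * r * l $ i - (A *v z) $ i" for i
    proof -
      have "A *v z' = (m * q) *\<^sub>R (A *v l) - A *v z"
        by (simp add: z'_def matrix_vector_mult_diff_distrib matrix_vector_mult_scaleR)
      then show ?thesis using l by (simp add: pf_vector_def)
    qed
    define \<mu> where "\<mu> = m * r + a * S"
    have \<mu>0: "\<mu> > 0" using m(1) r0 a0 S0 by (simp add: \<mu>_def add_pos_nonneg)
    have "\<mu> * l $ i \<le> v k $ i" for i
      using lower[of z i] z by (simp add: vk \<mu>_def S_def algebra_simps)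
    moreover have "v k $ i \<le> \<mu> * (1 + (1 - d) * q) * l $ i" for i
    proof -
      have "a * (m * q * L - S) * l $ i \<le> m * q * r * l $ i - (A *v z) $ i"
        using lower[of z' i] z' by (simp add: S' Az')
      then have "v k $ i \<le> (m * r + m * q * r - a * (m * q * L - S)) * l $ i"
        by (simp add: vk algebra_simps)
      also have "\<dots> = (\<mu> + m * r * ((1 - d) * q)) * l $ i"
        using r0 by (simp add: \<mu>_def d_def field_simps)
      also have "\<dots> \<le> (\<mu> + \<mu> * ((1 - d) * q)) * l $ i"
        using lpos[of i] q d(2) a0 S0
        by (intro mult_right_mono add_left_mono) (auto simp: \<mu>_def)
      finally show ?thesis by (simp add: algebra_simps)
    qed
    ultimately show "\<exists>m>0. \<forall>i. m * l $ i \<le> v k $ i \<and> v k $ i \<le> m * (1 + (1 - d) * q) * l $ i"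
      using \<mu>0 by blast
  qed
  have Pn: "P ((1 - d) ^ n * Q)" for n
  proof (induction n)
    case (Suc n)
    from Pstep[OF Suc] d Q0 show ?case by (simp add: mult_ac)
  qed (simp add: PQ)
  have "v 0 $ i / l $ i \<le> v 0 $ j / l $ j" for i j
  proof (rule LIMSEQ_le_const)
    show "(\<lambda>n. (1 + (1 - d) ^ n * Q) * (v 0 $ j / l $ j)) \<longlonglongrightarrow> v 0 $ j / l $ j"
      using d lpos[of j] by (auto intro!: tendsto_eq_intros LIMSEQ_power_zero)
    show "\<exists>N. \<forall>n\<ge>N. v 0 $ i / l $ i \<le> (1 + (1 - d) ^ n * Q) * (v 0 $ j / l $ j)"
    proof (intro exI allI impI)
      fix n
      let ?q = "(1 - d) ^ n * Q"
      have q: "?q \<ge> 0" using d Q0 by simp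
      obtain m where m: "m > 0" "\<And>i. m * l $ i \<le> v 0 $ i" "\<And>i. v 0 $ i \<le> m * (1 + ?q) * l $ i"
        using Pn[of n] unfolding P_def by blast
      have "v 0 $ i / l $ i \<le> m * (1 + ?q)" using m(3)[of i] lpos[of i] by (simp add: field_simps)
      also have "\<dots> = (1 + ?q) * m" by simp
      also have "\<dots> \<le> (1 + ?q) * (v 0 $ j / l $ j)"
        using m(2)[of j] lpos[of j] q by (intro mult_left_mono) (auto simp: field_simps)
      finally show "v 0 $ i / l $ i \<le> (1 + ?q) * (v 0 $ j / l $ j)" .
    qed
  qed
  then have eq: "v 0 $ i / l $ i = v 0 $ undefined / l $ undefined" for i by (meson order_antisym)
  define x where "x = v 0 $ undefined / l $ undefined"
  have "v 0 $ i = x * l $ i" for i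
    using eq[of i] lpos[of i] unfolding x_def[symmetric] by (subst (asm) nonzero_divide_eq_eq) auto
  then have "v 0 = x *s l" by (simp add: vec_eq_iff)
  then show ?thesis using l by (simp add: pf_vector_def vector_scalar_commute mult.commute)
qed


section \<open>Measures on systems of atoms\<close>

text \<open>What the dimension computation needs from the dynamics: at most about r^k disjoint
  atoms, each of mass at most about 1 / r^k, and all but an exponentially small proportion of length
  exp (- k (G + o(1))).\<close>

locale atom_system =
  fixes \<mu> :: "real measure" and I :: "nat \<Rightarrow> 'i set" and a L :: "nat \<Rightarrow> 'i \<Rightarrow> real" and r C G :: real
  assumes prob: "prob_space \<mu>" and sets: "sets \<mu> = sets borel"
    and fin: "finite (I k)"
    and L_pos: "p \<in> I k \<Longrightarrow> L k p > 0"
    and disj: "\<lbrakk>p \<in> I k; q \<in> I k; x \<in> {a k p ..< a k p + L k p}; x \<in> {a k q ..< a k q + L k q}\<rbrakk> \<Longrightarrow> p = q"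
    and full: "measure \<mu> (\<Union>p\<in>I k. {a k p ..< a k p + L k p}) = 1"
    and card_le: "real (card (I k)) \<le> C * r ^ k"
    and mass_le: "p \<in> I k \<Longrightarrow> measure \<mu> {a k p ..< a k p + L k p} \<le> C / r ^ k"
    and r_gt: "r > 1" and C_pos: "C > 0" and G_pos: "G > 0"
    and few_long: "\<epsilon> > 0 \<Longrightarrow> \<exists>\<delta>>0. \<exists>B k0. \<forall>k\<ge>k0. real (card {p \<in> I k. L k p > exp (- real k * (G - \<epsilon>))}) \<le> B * (r * exp (- \<delta>)) ^ k"
    and few_short: "\<epsilon> > 0 \<Longrightarrow> \<exists>\<delta>>0. \<exists>B k0. \<forall>k\<ge>k0. real (card {p \<in> I k. L k p < exp (- real k * (G + \<epsilon>))}) \<le> B * (r * exp (- \<delta>)) ^ k"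
begin

interpretation prob_space \<mu> by (rule prob)

abbreviation atom :: "nat \<Rightarrow> 'i \<Rightarrow> real set" where "atom k p \<equiv> {a k p ..< a k p + L k p}"

definition good :: "(nat \<Rightarrow> 'i \<Rightarrow> bool) \<Rightarrow> nat \<Rightarrow> real set" where
  "good P k = (\<Union>p\<in>{p \<in> I k. P k p}. atom k p)"

lemma good_sets: "good P k \<in> sets \<mu>"
  unfolding good_def sets using fin by (intro sets.finite_UN) auto

text \<open>Borel-Cantelli: the number of bad atoms times the mass bound \<open>C / r ^ k\<close> is
  at most geometric of ratio exp (- \<delta>).\<close>

lemma AE_good:
  assumes d: "\<delta> > 0" and B: "\<And>k. k \<ge> k0 \<Longrightarrow> real (card {p \<in> I k. \<not> P k p}) \<le> B * (r * exp (- \<delta>)) ^ k"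
  shows "AE x in \<mu>. eventually (\<lambda>k. x \<in> good P k) sequentially"
proof -
  have space: "space \<mu> = UNIV" using sets_eq_imp_space_eq[OF sets] by simp
  have bad: "measure \<mu> (UNIV - good P k) \<le> (B * C) * exp (- \<delta>) ^ k" if "k \<ge> k0" for k
  proof -
    let ?all = "\<Union>p\<in>I k. atom k p" and ?bad = "\<Union>p\<in>{p \<in> I k. \<not> P k p}. atom k p"
    have all: "?all \<in> sets \<mu>" and bad: "?bad \<in> sets \<mu>"
      unfolding sets using fin by (auto intro!: sets.finite_UN)
    have compl: "UNIV - ?all \<in> sets \<mu>" using sets.compl_sets[OF all] space by simp
    have "measure \<mu> (UNIV - good P k) \<le> measure \<mu> ((UNIV - ?all) \<union> ?bad)"
      using compl bad by (intro finite_measure_mono sets.Un) (auto simp: good_def)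
    also have "\<dots> \<le> measure \<mu> (UNIV - ?all) + measure \<mu> ?bad"
      using compl bad by (rule measure_Un_le)
    also have "measure \<mu> (UNIV - ?all) = 0"
      using prob_compl[OF all] full by (simp add: space)
    also have "measure \<mu> ?bad \<le> (\<Sum>p\<in>{p \<in> I k. \<not> P k p}. measure \<mu> (atom k p))"
      using fin by (intro finite_measure_subadditive_finite) (auto simp: sets)
    also have "\<dots> \<le> (\<Sum>p\<in>{p \<in> I k. \<not> P k p}. C / r ^ k)"
      by (intro sum_mono mass_le) auto
    also have "\<dots> = real (card {p \<in> I k. \<not> P k p}) * (C / r ^ k)" by simp
    also have "\<dots> \<le> (B * (r * exp (- \<delta>)) ^ k) * (C / r ^ k)"
      using C_pos r_gt that by (intro mult_right_mono B) auto
    also have "\<dots> = (B * C) * exp (- \<delta>) ^ k" using r_gt by (simp add: power_mult_distrib)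
    finally show ?thesis by simp
  qed
  have "AE x in \<mu>. eventually (\<lambda>k. x \<in> space \<mu> - (UNIV - good P k)) sequentially"
  proof (rule borel_cantelli_AE1)
    show "UNIV - good P k \<in> sets \<mu>" for k using good_sets space by (metis sets.compl_sets)
    show "emeasure \<mu> (UNIV - good P k) < \<infinity>" for k by (simp add: emeasure_eq_measure)
    show "summable (\<lambda>k. measure \<mu> (UNIV - good P k))"
    proof (rule summable_comparison_test'[where N=k0])
      show "summable (\<lambda>k. (B * C) * exp (- \<delta>) ^ k)"
        using d by (intro summable_mult summable_geometric) auto
    qed (use bad in auto)
  qed
  then show ?thesis by (simp add: space)
qed

lemma dim_upper:
  assumes s: "s > ln r / G"
  shows "measure_hausdorff_dim \<mu> \<le> ennreal s"
proof -
  have lnr: "ln r > 0" using r_gt by simp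
  have s0: "s > 0" using s lnr G_pos by (meson divide_pos_pos order.strict_trans)
  \<comment> \<open>This makes \<open>D\<close> the midpoint of G and ln r / s, so that r exp (- s
    D) < 1.\<close>
  define \<epsilon> where "\<epsilon> = (G - ln r / s) / 2"
  have sG: "ln r < s * G" using s G_pos by (simp add: pos_divide_less_eq)
  then have "ln r / s < G" using s0 by (simp add: pos_divide_less_eq mult.commute)
  then have eps: "\<epsilon> > 0" by (simp add: \<epsilon>_def)
  define D where "D = G - \<epsilon>"
  have D: "D = (G + ln r / s) / 2" by (simp add: D_def \<epsilon>_def field_simps)
  have D0: "D > 0" unfolding D using G_pos lnr s0 by (simp add: add_pos_pos)
  have "s * D = (s * G + ln r) / 2" unfolding D using s0 by (simp add: field_simps)
  then have sD: "s * D > ln r" using sG by simp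
  define P where "P k p \<longleftrightarrow> L k p \<le> exp (- real k * D)" for k p
  obtain \<delta> B k0 where dB: "\<delta> > 0" "\<And>k. k \<ge> k0 \<Longrightarrow> real (card {p \<in> I k. L k p > exp (- real k * (G - \<epsilon>))}) \<le> B * (r * exp (- \<delta>)) ^ k"
    using few_long[OF eps] by blast
  have ae: "AE x in \<mu>. eventually (\<lambda>k. x \<in> good P k) sequentially"
    using dB by (intro AE_good[of \<delta> k0 _ B]) (auto simp: P_def D_def not_le)
  \<comment> \<open>Points that are good at infinitely many levels. The good atoms of all levels
    from any K on cover them, at a cost bounded by the tail of a geometric series of ratio
    \<tau>.\<close>
  define E where "E = (\<Inter>k0. \<Union>k. good P (k0 + k))"
  have Eb: "E \<in> sets borel" unfolding E_def sets[symmetric] using good_sets by auto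
  have "AE x in \<mu>. x \<in> E"
    using ae
  proof eventually_elim
    fix x assume "eventually (\<lambda>k. x \<in> good P k) sequentially"
    then obtain K where K: "\<And>k. k \<ge> K \<Longrightarrow> x \<in> good P k" by (auto simp: eventually_sequentially)
    have "x \<in> (\<Union>k. good P (k0 + k))" for k0
      by (rule UN_I[of K]) (simp_all add: K)
    then show "x \<in> E" unfolding E_def by blast
  qed
  then have E1: "emeasure \<mu> E = 1"
    using emeasure_eq_1_AE[of E] Eb sets by auto
  define \<tau> where "\<tau> = r * exp (- s * D)"
  have tau: "0 < \<tau>" "\<tau> < 1"
  proof -
    show "0 < \<tau>" using r_gt by (simp add: \<tau>_def)
    have "\<tau> = exp (ln r - s * D)" using r_gt by (simp add: \<tau>_def exp_diff exp_minus field_simps)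
    then show "\<tau> < 1" using sD by simp
  qed
  have pre: "hausdorff_premeasure s \<delta> E \<le> ennreal e" if del: "\<delta> > 0" and e: "e > 0" for \<delta> e
  proof -
    have "(\<lambda>k. exp (- D) ^ k) \<longlonglongrightarrow> 0" using D0 by (intro LIMSEQ_power_zero) auto
    then have ev1: "eventually (\<lambda>k. exp (- D) ^ k < \<delta>) sequentially" using del by (rule order_tendstoD)
    have "(\<lambda>k. C / (1 - \<tau>) * \<tau> ^ k) \<longlonglongrightarrow> 0" using tau by (intro tendsto_mult_right_zero LIMSEQ_power_zero) auto
    then have ev2: "eventually (\<lambda>k. C / (1 - \<tau>) * \<tau> ^ k < e) sequentially" using e by (rule order_tendstoD)
    obtain K where K: "\<And>k. k \<ge> K \<Longrightarrow> exp (- D) ^ k < \<delta>" "C / (1 - \<tau>) * \<tau> ^ K < e"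
      using eventually_conj[OF ev1 ev2] unfolding eventually_sequentially by blast
    define N where "N k = card {p \<in> I (K + k). P (K + k) p}" for k
    have "\<forall>k. \<exists>h. bij_betw h {0..<N k} {p \<in> I (K + k). P (K + k) p}"
      unfolding N_def using fin by (intro allI ex_bij_betw_nat_finite) auto
    then obtain h where h: "\<And>k. bij_betw (h k) {0..<N k} {p \<in> I (K + k). P (K + k) p}" by metis
    \<comment> \<open>Padding with empty sets, which cost nothing, lets all levels be enumerated by
      pairs of natural numbers.\<close>
    define U where "U = (\<lambda>(k, j). if j < N k then atom (K + k) (h k j) else {})"
    have hP: "h k j \<in> I (K + k)" "P (K + k) (h k j)" if "j < N k" for k j
      using bij_betwE[OF h[of k]] that by auto
    have bU: "bounded (U p)" for p by (cases p) (simp add: U_def)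
    have dU: "diameter (U (k, j)) \<le> exp (- D) ^ (K + k)" for k j
    proof (cases "j < N k")
      case True
      have "diameter (U (k, j)) \<le> L (K + k) (h k j)"
        using True L_pos[OF hP(1)[OF True]] by (intro diameter_le) (auto simp: U_def)
      also have "\<dots> \<le> exp (- real (K + k) * D)" using hP(2)[OF True] by (simp add: P_def)
      also have "\<dots> = exp (- D) ^ (K + k)" by (simp add: exp_of_nat_mult[symmetric] algebra_simps)
      finally show ?thesis .
    next
      case False
      then show ?thesis by (simp add: U_def)
    qed
    have cost: "hausdorff_cost s (U (k, j)) \<le> (if j < N k then ennreal (exp (- s * D) ^ (K + k)) else 0)" for k j
    proof (cases "j < N k")
      case True
      have "diameter (U (k, j)) powr s \<le> (exp (- D) ^ (K + k)) powr s"
        using dU[of k j] diameter_ge_0[OF bU] s0 by (intro powr_mono2) auto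
      also have "\<dots> = exp (- s * D) ^ (K + k)"
        by (simp add: powr_def ln_realpow exp_of_nat_mult[symmetric] mult_ac)
      finally show ?thesis using True s0 by (simp add: hausdorff_cost_def ennreal_leI)
    qed (simp add: U_def hausdorff_cost_def)
    have EU: "E \<subseteq> (\<Union>i. U (prod_decode i))"
    proof
      fix x assume "x \<in> E"
      then obtain k where "x \<in> good P (K + k)" unfolding E_def by blast
      then obtain p where p: "p \<in> {p \<in> I (K + k). P (K + k) p}" "x \<in> atom (K + k) p" by (auto simp: good_def)
      then obtain j where "j < N k" "h k j = p" using bij_betw_imp_surj_on[OF h[of k]] by force
      then have "x \<in> U (prod_decode (prod_encode (k, j)))" using p(2) by (simp add: U_def)
      then show "x \<in> (\<Union>i. U (prod_decode i))" by blast
    qed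
    have row: "(\<Sum>j. hausdorff_cost s (U (k, j))) \<le> ennreal (C * \<tau> ^ (K + k))" for k
    proof -
      have "(\<Sum>j. hausdorff_cost s (U (k, j))) \<le> (\<Sum>j. if j < N k then ennreal (exp (- s * D) ^ (K + k)) else 0)"
        by (intro suminf_le cost) auto
      also have "\<dots> = (\<Sum>j<N k. ennreal (exp (- s * D) ^ (K + k)))"
        by (subst suminf_finite[of "{..<N k}"]) auto
      also have "\<dots> = ennreal (real (N k) * exp (- s * D) ^ (K + k))"
        by (simp add: ennreal_mult ennreal_of_nat_eq_real_of_nat)
      also have "\<dots> \<le> ennreal (C * \<tau> ^ (K + k))"
      proof (intro ennreal_leI)
        have "real (N k) \<le> real (card (I (K + k)))"
          unfolding N_def using fin by (intro of_nat_mono card_mono) auto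
        then have "real (N k) \<le> C * r ^ (K + k)" using card_le[of "K + k"] by linarith
        then have "real (N k) * exp (- s * D) ^ (K + k) \<le> (C * r ^ (K + k)) * exp (- s * D) ^ (K + k)"
          by (intro mult_right_mono) auto
        then show "real (N k) * exp (- s * D) ^ (K + k) \<le> C * \<tau> ^ (K + k)"
          by (simp add: \<tau>_def power_mult_distrib mult_ac)
      qed
      finally show ?thesis .
    qed
    have "(\<Sum>i. hausdorff_cost s (U (prod_decode i))) = (\<Sum>k. \<Sum>j. hausdorff_cost s (U (k, j)))"
      using suminf_ennreal_2dimen[of "\<lambda>k. \<Sum>j. hausdorff_cost s (U (k, j))" "\<lambda>p. hausdorff_cost s (U p)"] by simp
    also have "\<dots> \<le> (\<Sum>k. ennreal (C * \<tau> ^ (K + k)))" by (intro suminf_le row) auto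
    also have "\<dots> = ennreal (C / (1 - \<tau>) * \<tau> ^ K)"
    proof (rule suminf_ennreal_eq)
      have "(\<lambda>k. (C * \<tau> ^ K) * \<tau> ^ k) sums ((C * \<tau> ^ K) * (1 / (1 - \<tau>)))"
        using tau by (intro sums_mult geometric_sums) auto
      then show "(\<lambda>k. C * \<tau> ^ (K + k)) sums (C / (1 - \<tau>) * \<tau> ^ K)" by (simp add: power_add mult_ac)
    qed (use C_pos tau in auto)
    also have "\<dots> \<le> ennreal e" using K(2) by (intro ennreal_leI) simp
    finally have total: "(\<Sum>i. hausdorff_cost s (U (prod_decode i))) \<le> ennreal e" .
    have "diameter (U p) \<le> \<delta>" for p
      using dU[of "fst p" "snd p"] K(1)[of "K + fst p"] by simp
    then have "hausdorff_premeasure s \<delta> E \<le> (\<Sum>i. hausdorff_cost s (U (prod_decode i)))"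
      unfolding hausdorff_premeasure_def using EU bU
      by (intro Inf_lower CollectI exI[of _ "\<lambda>i. U (prod_decode i)"] conjI allI refl)
    then show ?thesis using total by (rule order.trans)
  qed
  have "hausdorff_premeasure s \<delta> E = 0" if "\<delta> > 0" for \<delta>
  proof -
    have "hausdorff_premeasure s \<delta> E \<le> 0"
      by (rule ennreal_le_epsilon) (use pre[OF that] in simp)
    then show ?thesis by simp
  qed
  then have "hausdorff_measure s E = 0" unfolding hausdorff_measure_def by simp
  then have "hausdorff_dim E \<le> ennreal s"
    unfolding hausdorff_dim_def using s0 by (intro Inf_lower) auto
  moreover have "measure_hausdorff_dim \<mu> \<le> hausdorff_dim E"
    unfolding measure_hausdorff_dim_def using Eb E1 by (intro Inf_lower) auto
  ultimately show ?thesis by (rule order.trans[rotated])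
qed

text \<open>A set of diameter \<open>d\<close> cannot meet three disjoint intervals longer than \<open>d\<close>, since it would have to
  jump over the middle one.\<close>

lemma meets_at_most_two:
  assumes U: "bounded U" "diameter U \<le> d"
  shows "card {p \<in> I k. L k p \<ge> d \<and> atom k p \<inter> U \<noteq> {}} \<le> 2"
proof (cases "{p \<in> I k. L k p \<ge> d \<and> atom k p \<inter> U \<noteq> {}} = {}")
  case False
  let ?S = "{p \<in> I k. L k p \<ge> d \<and> atom k p \<inter> U \<noteq> {}}"
  have finS: "finite ?S" using fin by simp
  obtain p where p: "p \<in> ?S" "\<And>x. x \<in> ?S \<Longrightarrow> a k p \<le> a k x"
    using arg_min_if_finite[OF finS False, of "a k"] by (metis (no_types, lifting) not_le)
  have "Max (a k ` ?S) \<in> a k ` ?S" using finS False by (intro Max_in) auto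
  then obtain q where q: "Max (a k ` ?S) = a k q" "q \<in> ?S" by (rule imageE)
  have qmax: "a k x \<le> a k q" if "x \<in> ?S" for x unfolding q(1)[symmetric] using finS that by (intro Max_ge) auto
  have ord: "a k x + L k x \<le> a k y" if "x \<in> I k" "y \<in> I k" "x \<noteq> y" "a k x \<le> a k y" for x y
    using disj[OF that(1,2), of "a k y"] that L_pos[OF that(2)] by force
  have "?S \<subseteq> {p, q}"
  proof
    fix x assume x: "x \<in> ?S"
    show "x \<in> {p, q}"
    proof (rule ccontr)
      assume "x \<notin> {p, q}"
      then have 1: "a k p + L k p \<le> a k x" and 2: "a k x + L k x \<le> a k q"
        using ord[of p x] ord[of x q] p q qmax x by auto
      obtain y z where y: "y \<in> atom k p" "y \<in> U" and z: "z \<in> atom k q" "z \<in> U" using p(1) q(2) by blast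
      have "dist y z \<le> d" using diameter_bounded_bound[OF U(1) y(2) z(2)] U(2) by simp
      then have "z - y \<le> d" by (simp add: dist_real_def)
      then show False using 1 2 y(1) z(1) x by auto
    qed
  qed
  then have "card ?S \<le> card {p, q}" by (intro card_mono) auto
  also have "\<dots> \<le> 2" by (simp add: card_insert_if)
  finally show ?thesis .
next
  case True
  then show ?thesis by (simp only: card.empty zero_le)
qed

text \<open>Mass distribution principle on a set \<open>F K\<close> of positive mass whose points
  are good at all levels from K on. A set of diameter d is compared with the level k where exp (- k
  D), the lower bound for good atoms, is about d; it meets few of them, so its part in
  \<open>F K\<close> has mass at most of order d^s.\<close>

lemma dim_lower:
  assumes s: "0 \<le> s" "s < ln r / G" and E: "E \<in> sets borel" "emeasure \<mu> E = 1"
  shows "hausdorff_measure s E \<noteq> 0"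
proof (cases "s = 0")
  \<comment> \<open>For exponent 0 a nonempty set costs 1, and a set of full mass is
    nonempty.\<close>
  case True
  have "1 \<le> hausdorff_premeasure s 1 E"
    unfolding hausdorff_premeasure_def
  proof (safe intro!: Inf_greatest)
    fix U :: "nat \<Rightarrow> real set" assume U: "E \<subseteq> (\<Union>i. U i)"
    have "E \<noteq> {}" using E(2) by auto
    then obtain i where "U i \<noteq> {}" using U by blast
    then have "1 = hausdorff_cost s (U i)" by (simp add: hausdorff_cost_def True)
    also have "\<dots> \<le> (\<Sum>i. hausdorff_cost s (U i))" using sum_le_suminf[of "\<lambda>i. hausdorff_cost s (U i)" "{i}"] by simp
    finally show "1 \<le> (\<Sum>i. hausdorff_cost s (U i))" .
  qed
  also have "\<dots> \<le> hausdorff_measure s E" unfolding hausdorff_measure_def by (intro SUP_upper) auto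
  finally show ?thesis by auto
next
  case False
  then have s0: "s > 0" using s by simp
  have lnr: "ln r > 0" using r_gt by simp
  \<comment> \<open>Again \<open>D\<close> is the midpoint of G and ln r / s, now with s D < ln
    r.\<close>
  define \<epsilon> where "\<epsilon> = (ln r / s - G) / 2"
  have sG: "s * G < ln r" using s(2) G_pos by (simp add: pos_less_divide_eq)
  then have "G < ln r / s" using s0 by (simp add: pos_less_divide_eq mult.commute)
  then have eps: "\<epsilon> > 0" by (simp add: \<epsilon>_def)
  define D where "D = G + \<epsilon>"
  have D: "D = (G + ln r / s) / 2" by (simp add: D_def \<epsilon>_def field_simps)
  have D0: "D > 0" using G_pos eps by (simp add: D_def)
  have "s * D = (s * G + ln r) / 2" unfolding D using s0 by (simp add: field_simps)
  then have sD: "s < ln r / D" using sG D0 by (simp add: pos_less_divide_eq)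
  define P where "P k p \<longleftrightarrow> L k p \<ge> exp (- real k * D)" for k p
  obtain \<delta> B k0 where dB: "\<delta> > 0" "\<And>k. k \<ge> k0 \<Longrightarrow> real (card {p \<in> I k. L k p < exp (- real k * (G + \<epsilon>))}) \<le> B * (r * exp (- \<delta>)) ^ k"
    using few_short[OF eps] by blast
  have ae: "AE x in \<mu>. eventually (\<lambda>k. x \<in> good P k) sequentially"
    using dB by (intro AE_good[of \<delta> k0 _ B]) (auto simp: P_def D_def not_le)
  define F where "F K = (\<Inter>k. good P (K + k))" for K
  have Fs: "F K \<in> sets \<mu>" for K unfolding F_def using good_sets by auto
  have "\<exists>K. measure \<mu> (F K) > 0"
  proof (rule ccontr)
    assume "\<not> ?thesis"
    then have "measure \<mu> (F K) = 0" for K by (metis measure_nonneg less_eq_real_def)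
    then have "AE x in \<mu>. x \<notin> F K" for K
      using Fs[of K] by (intro AE_not_in) (simp add: null_sets_def emeasure_eq_measure)
    then have "AE x in \<mu>. \<forall>K. x \<notin> F K" by (subst AE_all_countable) auto
    with ae have "AE x in \<mu>. False"
    proof eventually_elim
      fix x assume ev: "eventually (\<lambda>k. x \<in> good P k) sequentially" and n: "\<forall>K. x \<notin> F K"
      from ev obtain K where "\<And>k. k \<ge> K \<Longrightarrow> x \<in> good P k" by (auto simp: eventually_sequentially)
      then have "x \<in> F K" by (simp add: F_def)
      then show False using n by blast
    qed
    then show False by simp
  qed
  then obtain K where K: "measure \<mu> (F K) > 0" by blast
  \<comment> \<open>Two atoms, the constant \<open>C\<close> of the mass bound, and one factor
    \<open>r\<close> for rounding the level down.\<close>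
  define B' where "B' = 2 * C * r"
  have B'0: "B' > 0" using C_pos r_gt by (simp add: B'_def)
  have FD: "x \<in> good P k" if "x \<in> F K" "k \<ge> K" for x k
    using that unfolding F_def by (metis INT_iff UNIV_I le_add_diff_inverse)
  \<comment> \<open>\<open>V\<close> stands in for \<open>U \<inter> F K\<close>, since
    \<open>U\<close> need not be measurable.\<close>
  have local: "\<exists>V. V \<in> sets \<mu> \<and> U \<inter> F K \<subseteq> V \<and> emeasure \<mu> V \<le> ennreal B' * hausdorff_cost s U"
    if U: "bounded U" "diameter U \<le> exp (- real (Suc K) * D)" for U :: "real set"
  proof -
    consider "U = {}" | "U \<noteq> {}" "diameter U = 0" | "U \<noteq> {}" "diameter U > 0"
      using diameter_ge_0[OF U(1)] by linarith
    then show ?thesis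
    proof cases
      case 1
      then show ?thesis by (intro exI[of _ "{}"]) auto
    next
      \<comment> \<open>A single point costs 0 here, as \<open>0 powr s = 0\<close>; so a point of
        \<open>F K\<close> must be shown to be null, by shrinking atoms around it.\<close>
      case 2
      then obtain x where x: "x \<in> U" by blast
      have Ux: "U \<subseteq> {x}" using diameter_bounded_bound[OF U(1) _ x] 2(2) by fastforce
      show ?thesis
      proof (cases "x \<in> F K")
        case False
        then show ?thesis using Ux by (intro exI[of _ "{}"]) auto
      next
        case True
        have xs: "{x} \<in> sets \<mu>" by (simp add: sets)
        have "measure \<mu> {x} \<le> 0"
        proof (rule LIMSEQ_le_const)
          have "(\<lambda>k. C * (1 / r) ^ k) \<longlonglongrightarrow> C * 0"
            using r_gt by (intro tendsto_mult tendsto_const LIMSEQ_power_zero) auto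
          then show "(\<lambda>k. C * (1 / r) ^ k) \<longlonglongrightarrow> 0" by simp
          have "measure \<mu> {x} \<le> C * (1 / r) ^ k" if "k \<ge> K" for k
          proof -
            have "x \<in> good P k" using FD True that by blast
            then obtain p where p: "p \<in> I k" "x \<in> atom k p" by (auto simp: good_def)
            have "measure \<mu> {x} \<le> measure \<mu> (atom k p)"
              using p(2) by (intro finite_measure_mono) (auto simp: sets)
            also have "\<dots> \<le> C / r ^ k" using mass_le[OF p(1)] .
            finally show ?thesis by (simp add: power_divide)
          qed
          then show "\<exists>N. \<forall>k\<ge>N. measure \<mu> {x} \<le> C * (1 / r) ^ k" by blast
        qed
        then have "measure \<mu> {x} = 0" by (simp add: order_antisym)
        then show ?thesis using Ux xs by (intro exI[of _ "{x}"]) (auto simp: emeasure_eq_measure)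
      qed
    next
      case 3
      define d where "d = diameter U"
      have d: "d > 0" "d \<le> exp (- real (Suc K) * D)" using 3 U by (auto simp: d_def)
      \<comment> \<open>The real level at which exp (- y D) equals \<open>d\<close>; its integer
        part is at least K.\<close>
      define y where "y = - ln d / D"
      have "ln d \<le> - real (Suc K) * D" using d by (metis ln_exp ln_le_cancel_iff exp_gt_zero)
      then have y: "y \<ge> real (Suc K)" using D0 by (simp add: y_def field_simps)
      have dy: "d = exp (- y * D)" using D0 d(1) by (simp add: y_def)
      define k where "k = nat \<lfloor>y\<rfloor>"
      have y0: "y \<ge> 0" using y by linarith
      have k: "real k \<le> y" "y < real k + 1" unfolding k_def using y0 by auto
      have kK: "k \<ge> K" using y k by linarith
      have dk: "d \<le> exp (- real k * D)" unfolding dy using k(1) D0 by simp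
      define S where "S = {p \<in> I k. L k p \<ge> exp (- real k * D) \<and> atom k p \<inter> U \<noteq> {}}"
      have cS: "card S \<le> 2" unfolding S_def using dk by (intro meets_at_most_two U(1)) (simp add: d_def)
      have finS: "finite S" using fin by (simp add: S_def)
      define V where "V = (\<Union>p\<in>S. atom k p)"
      have Vs: "V \<in> sets \<mu>" unfolding V_def sets using finS by (intro sets.finite_UN) auto
      have sub: "U \<inter> F K \<subseteq> V"
      proof
        fix x assume x: "x \<in> U \<inter> F K"
        then obtain p where "p \<in> I k" "P k p" "x \<in> atom k p" using FD[of x k] kK by (auto simp: good_def)
        then show "x \<in> V" using x unfolding V_def S_def P_def by blast
      qed
      have "measure \<mu> V \<le> (\<Sum>p\<in>S. measure \<mu> (atom k p))"
        unfolding V_def using finS by (intro finite_measure_subadditive_finite) (auto simp: sets)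
      also have "\<dots> \<le> (\<Sum>p\<in>S. C / r ^ k)" by (intro sum_mono mass_le) (auto simp: S_def)
      also have "\<dots> = real (card S) * (C / r ^ k)" by simp
      also have "\<dots> \<le> 2 * (C / r ^ k)" using cS C_pos r_gt by (intro mult_right_mono) auto
      also have "\<dots> = B' * exp (- (real k + 1) * ln r)"
      proof -
        have "exp ((real k + 1) * ln r) = r * r ^ k"
          using r_gt by (simp add: exp_add distrib_right exp_of_nat_mult)
        then have "exp (- ((real k + 1) * ln r)) = 1 / (r * r ^ k)" by (simp only: exp_minus inverse_eq_divide)
        then show ?thesis using r_gt by (simp only: mult_minus_left B'_def) (simp add: field_simps)
      qed
      also have "\<dots> \<le> B' * exp (- (y * D) * s)"
      proof -
        have "(y * D) * s \<le> (real k + 1) * ln r"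
        proof -
          have "D * s \<le> ln r" using sD D0 by (simp add: field_simps)
          then have "y * (D * s) \<le> y * ln r" using y0 by (intro mult_left_mono)
          also have "\<dots> \<le> (real k + 1) * ln r" using k(2) lnr by (intro mult_right_mono) auto
          finally show ?thesis by (simp add: mult_ac)
        qed
        then have "- (real k + 1) * ln r \<le> - (y * D) * s" by (simp only: mult_minus_left neg_le_iff_le)
        then have "exp (- (real k + 1) * ln r) \<le> exp (- (y * D) * s)" by (simp only: exp_le_cancel_iff)
        then show ?thesis using B'0 by (intro mult_left_mono) auto
      qed
      also have "exp (- (y * D) * s) = d powr s" using d(1) by (simp add: powr_def dy mult_ac)
      finally have "measure \<mu> V \<le> B' * d powr s" .
      then have "emeasure \<mu> V \<le> ennreal (B' * d powr s)" by (simp add: emeasure_eq_measure ennreal_leI)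
      also have "\<dots> = ennreal B' * hausdorff_cost s U"
        using 3 s0 B'0 by (simp add: hausdorff_cost_def d_def ennreal_mult)
      finally show ?thesis using Vs sub by blast
    qed
  qed
  have E1: "emeasure \<mu> (E \<inter> F K) = emeasure \<mu> (F K)"
  proof -
    have "AE x in \<mu>. x \<in> E" using E sets emeasure_eq_1_AE
      by (metis AE_in_set_eq_1 emeasure_eq_measure ennreal_eq_1)
    then show ?thesis using Fs E(1) sets by (intro emeasure_eq_AE) auto
  qed
  have bound: "ennreal (measure \<mu> (F K)) \<le> ennreal B' * (\<Sum>i. hausdorff_cost s (U i))"
    if U: "E \<subseteq> (\<Union>i. U i)" "\<And>i. bounded (U i) \<and> diameter (U i) \<le> exp (- real (Suc K) * D)" for U :: "nat \<Rightarrow> real set"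
  proof -
    have "\<forall>i. \<exists>V. V \<in> sets \<mu> \<and> U i \<inter> F K \<subseteq> V \<and> emeasure \<mu> V \<le> ennreal B' * hausdorff_cost s (U i)"
      using local U(2) by blast
    then obtain V where V: "\<And>i. V i \<in> sets \<mu>" "\<And>i. U i \<inter> F K \<subseteq> V i"
      "\<And>i. emeasure \<mu> (V i) \<le> ennreal B' * hausdorff_cost s (U i)" by metis
    have "ennreal (measure \<mu> (F K)) = emeasure \<mu> (E \<inter> F K)" unfolding E1 by (simp add: emeasure_eq_measure)
    also have "\<dots> \<le> emeasure \<mu> (\<Union>i. V i)"
    proof (rule emeasure_mono)
      show "E \<inter> F K \<subseteq> (\<Union>i. V i)"
      proof
        fix x assume x: "x \<in> E \<inter> F K"
        then obtain i where "x \<in> U i" using U(1) by auto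
        then have "x \<in> V i" using V(2)[of i] x by auto
        then show "x \<in> (\<Union>i. V i)" by (rule UN_I[OF UNIV_I])
      qed
    qed (use V(1) in auto)
    also have "\<dots> \<le> (\<Sum>i. emeasure \<mu> (V i))" using V by (intro emeasure_subadditive_countably) auto
    also have "\<dots> \<le> (\<Sum>i. ennreal B' * hausdorff_cost s (U i))" by (intro suminf_le V) auto
    also have "\<dots> = ennreal B' * (\<Sum>i. hausdorff_cost s (U i))" by simp
    finally show ?thesis .
  qed
  let ?d = "exp (- real (Suc K) * D)"
  have "ennreal (measure \<mu> (F K) / B') \<le> hausdorff_premeasure s ?d E"
    unfolding hausdorff_premeasure_def
  proof (rule Inf_greatest)
    fix z assume "z \<in> {\<Sum>i. hausdorff_cost s (U i) | U :: nat \<Rightarrow> real set.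
      E \<subseteq> (\<Union>i. U i) \<and> (\<forall>i. bounded (U i) \<and> diameter (U i) \<le> ?d)}"
    then obtain U :: "nat \<Rightarrow> real set" where z: "z = (\<Sum>i. hausdorff_cost s (U i))"
      and U: "E \<subseteq> (\<Union>i. U i)" "\<And>i. bounded (U i) \<and> diameter (U i) \<le> ?d" by blast
    have "ennreal (measure \<mu> (F K) / B') = ennreal (1 / B') * ennreal (measure \<mu> (F K))"
      using B'0 by (simp add: ennreal_mult[symmetric])
    also have "\<dots> \<le> ennreal (1 / B') * (ennreal B' * z)" unfolding z by (intro mult_left_mono bound U) auto
    also have "\<dots> = z" using B'0 by (simp add: mult.assoc[symmetric] ennreal_mult[symmetric])
    finally show "ennreal (measure \<mu> (F K) / B') \<le> z" .
  qed
  also have "\<dots> \<le> hausdorff_measure s E" unfolding hausdorff_measure_def by (intro SUP_upper) auto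
  finally show ?thesis using divide_pos_pos[OF K B'0] by (auto simp: ennreal_eq_0_iff not_le)
qed

lemma measure_hausdorff_dim_atoms: "measure_hausdorff_dim \<mu> = ennreal (ln r / G)"
proof (rule antisym)
  have q0: "ln r / G > 0" using r_gt G_pos by simp
  show "measure_hausdorff_dim \<mu> \<le> ennreal (ln r / G)"
  proof (rule ennreal_le_epsilon)
    fix e :: real assume "e > 0"
    then have "measure_hausdorff_dim \<mu> \<le> ennreal (ln r / G + e)" by (intro dim_upper) simp
    also have "\<dots> = ennreal (ln r / G) + ennreal e" using q0 \<open>e > 0\<close> by (intro ennreal_plus) auto
    finally show "measure_hausdorff_dim \<mu> \<le> ennreal (ln r / G) + ennreal e" .
  qed
  show "ennreal (ln r / G) \<le> measure_hausdorff_dim \<mu>"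
    unfolding measure_hausdorff_dim_def hausdorff_dim_def
    using dim_lower by (auto intro!: Inf_greatest ennreal_leI) (meson not_le)
qed

end


section \<open>The dimension formula\<close>

context tower
begin

lemma visits_word: "x \<in> interval g \<alpha> \<Longrightarrow> visits (aiet_map f) (interval f) x (w \<alpha>)"
  using tower by (simp add: tower_over_def)

lemma left_in_interval: "left_t g \<alpha> \<in> interval g \<alpha>"
  using g.pos by (simp add: interval_def)

lemma floor_in_interval_iff:
  assumes k: "k < length (w \<alpha>)"
  shows "(aiet_map f ^^ k) ` interval g \<alpha> \<subseteq> interval f \<beta> \<longleftrightarrow> w \<alpha> ! k = \<beta>"
proof
  assume "(aiet_map f ^^ k) ` interval g \<alpha> \<subseteq> interval f \<beta>"
  then have "(aiet_map f ^^ k) (left_t g \<alpha>) \<in> interval f \<beta>" using left_in_interval by blast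
  then show "w \<alpha> ! k = \<beta>"
    using visits_nth[OF visits_word[OF left_in_interval] k] f.interval_unique by blast
next
  assume "w \<alpha> ! k = \<beta>"
  then show "(aiet_map f ^^ k) ` interval g \<alpha> \<subseteq> interval f \<beta>"
    using visits_nth[OF visits_word k] by blast
qed

lemma return_time_word:
  assumes x: "x \<in> interval g \<alpha>"
  shows "return_time (aiet_map f) (domain g) x = length (w \<alpha>)"
  unfolding return_time_def
proof (rule Least_equality)
  have "(aiet_map f ^^ length (w \<alpha>)) x = aiet_map g x" "w \<alpha> \<noteq> []" using tower x by (auto simp: tower_over_def)
  then show "0 < length (w \<alpha>) \<and> (aiet_map f ^^ length (w \<alpha>)) x \<in> domain g"
    using g.map_domain[OF g.interval_domain[OF x]] by simp
  fix j assume "0 < j \<and> (aiet_map f ^^ j) x \<in> domain g"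
  then show "length (w \<alpha>) \<le> j" using tower x unfolding tower_over_def by (meson not_le)
qed

lemma birkhoff_psum:
  assumes x: "x \<in> interval g \<alpha>" and i: "i \<le> length (w \<alpha>)"
  shows "birkhoff_sum (aiet_map f) i (phi f v) x = psum (($) v) (w \<alpha>) i"
  using i
proof (induction i)
  case (Suc i)
  then have "letter f ((aiet_map f ^^ i) x) = w \<alpha> ! i"
    using visits_nth[OF visits_word[OF x], of i] f.letter_eq by simp
  then show ?case using Suc by (simp add: birkhoff_sum_def phi_def psum_Suc)
qed (simp add: birkhoff_sum_def)

end

text \<open>By the common itinerary, the quantities defined by description on an interval of level
  \<open>N\<close> are constant there and can be read off from the word.\<close>

lemma tower_rv_iter:
  assumes "tower T (rv_iter N T) w"
  shows rv_height_word: "rv_height T N \<alpha> = length (w \<alpha>)"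
    and self_similarity_matrix_word: "self_similarity_matrix T N = subst_matrix w 0"
    and tower_letter_word: "i < length (w \<alpha>) \<Longrightarrow> tower_letter T N \<alpha> i = w \<alpha> ! i"
    and tower_sum_word: "i \<le> length (w \<alpha>) \<Longrightarrow> tower_sum T N v i \<alpha> = psum (($) v) (w \<alpha>) i"
    and weighted_matrix_word: "weighted_matrix T N v = subst_matrix w v"
proof -
  interpret tower T "rv_iter N T" w by fact
  show height: "rv_height T N \<alpha> = length (w \<alpha>)" for \<alpha>
    unfolding rv_height_def
  proof (rule the_equality)
    fix q assume "\<forall>x\<in>interval (rv_iter N T) \<alpha>. return_time (aiet_map T) (domain (rv_iter N T)) x = q"
    then have "return_time (aiet_map T) (domain (rv_iter N T)) (left_t (rv_iter N T) \<alpha>) = q"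
      using left_in_interval by blast
    then show "q = length (w \<alpha>)" using return_time_word[OF left_in_interval] by simp
  qed (simp add: return_time_word)
  show letter: "tower_letter T N \<alpha> i = w \<alpha> ! i" if "i < length (w \<alpha>)" for i \<alpha>
    unfolding tower_letter_def floor_in_interval_iff[OF that] by simp
  show tsum: "tower_sum T N v i \<alpha> = psum (($) v) (w \<alpha>) i" if "i \<le> length (w \<alpha>)" for i \<alpha> v
    unfolding tower_sum_def
  proof (rule the_equality)
    fix q assume "\<forall>x\<in>interval (rv_iter N T) \<alpha>. birkhoff_sum (aiet_map T) i (phi T v) x = q"
    then have "birkhoff_sum (aiet_map T) i (phi T v) (left_t (rv_iter N T) \<alpha>) = q"
      using left_in_interval by blast
    then show "q = psum (($) v) (w \<alpha>) i" using birkhoff_psum[OF left_in_interval that] by simp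
  qed (simp add: birkhoff_psum that)
  show "weighted_matrix T N v = subst_matrix w v" for v
    unfolding weighted_matrix_def subst_matrix_def height
    by (intro vec_eq_iff[THEN iffD2] allI) (auto simp: letter tsum intro!: sum.cong)
  show "self_similarity_matrix T N = subst_matrix w 0"
    unfolding self_similarity_matrix_def subst_matrix_def height
    by (intro vec_eq_iff[THEN iffD2] allI)
      (simp add: psum_zero floor_in_interval_iff cong: conj_cong)
qed

locale periodic_tower =
  fixes H :: "nat \<Rightarrow> ('a::finite) aiet" and \<sigma> :: "'a \<Rightarrow> 'a list"
  assumes step: "\<And>k. tower (H k) (H (Suc k)) \<sigma>" and base: "\<And>k. tower (H 0) (H k) (subst_iter \<sigma> k)"

lemma rv_word_period:
  assumes "\<And>n. r (n + N) = r n"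
  shows "rv_word r (k * N) = subst_iter (rv_word r N) k"
proof (induction k)
  case (Suc k)
  have "r (i + k * N) = r i" for i
    by (induction k) (simp_all add: assms add.assoc[symmetric] add.commute[of N])
  then have "rv_word r (Suc k * N) \<alpha> = subst_iter (rv_word r N) (Suc k) \<alpha>" for \<alpha>
    using rv_word_add[of r "k * N" N \<alpha>] by (simp add: Suc add.commute)
  then show ?case by blast
qed (simp add: fun_eq_iff)

text \<open>A period of the rotation number makes all blocks of \<open>N\<close> steps act by the
  same substitution, even when lengths and slopes change from block to block; so it covers f as well
  as T.\<close>

lemma periodic_tower_rv_iter:
  fixes f :: "('a::finite) aiet"
  assumes f: "is_aiet f" and card: "CARD('a) \<ge> 2" and ren: "infinitely_renormalizable f"
    and per: "\<And>n. rotation_number f (n + N) = rotation_number f n"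
  shows "periodic_tower (\<lambda>k. rv_iter (k * N) f) (rv_word (rotation_number f) N)"
proof (rule periodic_tower.intro)
  have data: "aiet_data (rv_iter n f)" and tow: "tower_over f (rv_word (rotation_number f) n) (rv_iter n f)" for n
    using rv_iter_tower[OF _ card ren] f by (simp_all add: aiet_data_iff)
  have f0: "rv_iter 0 f = f" by (simp add: rv_iter_def)
  fix k
  have "rotation_number f (n + k * N) = rotation_number f n" for n
    by (induction k) (simp_all add: per add.assoc[symmetric] add.commute[of N])
  then have rot: "rotation_number (rv_iter (k * N) f) = rotation_number f"
    by (simp add: rotation_number_rv_iter)
  have "tower_over (rv_iter (k * N) f) (rv_word (rotation_number f) N) (rv_iter (N + k * N) f)"
    using rv_iter_tower[OF data card infinitely_renormalizable_rv_iter[OF ren], of N "k * N"] rot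
    by (simp add: rv_iter_rv_iter)
  then show "tower (rv_iter (k * N) f) (rv_iter (Suc k * N) f) (rv_word (rotation_number f) N)"
    using data by (intro tower.intro) simp_all
  show "tower (rv_iter (0 * N) f) (rv_iter (k * N) f) (subst_iter (rv_word (rotation_number f) N) k)"
    using data tow[of "k * N"] rv_word_period[of "rotation_number f" N k, OF per] data[of 0]
    by (intro tower.intro) (simp_all add: f0)
qed

text \<open>Since \<open>s\<close> only contributes bounded factors, \<open>c\<close> determines the lengths of the floors.\<close>

locale central_stable_tower = periodic_tower H \<sigma> + pf_subst \<sigma> r l \<theta> c
  for H :: "nat \<Rightarrow> ('a::finite) aiet" and \<sigma> :: "'a \<Rightarrow> 'a list" and r l \<theta> c +
  fixes \<mu> :: "real measure" and s :: "real^'a" and rc :: real and \<eta> :: "real^'a"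
  assumes total1: "total_length (H 0) = 1"
    and slopes0: "slopes (H 0) = c + s"
    and stable: "summable (\<lambda>k. norm (((*v) (subst_matrix \<sigma> 0) ^^ k) s))"
    and inv: "invariant_prob (H 0) \<mu>"
    and r_gt_1: "r > 1"
    and rc_pos: "rc > 0" and eta: "pf_vector (subst_matrix \<sigma> c) rc \<eta>"
    and gap: "ln r < ln rc - mean"
begin

abbreviation W :: "nat \<Rightarrow> 'a \<Rightarrow> 'a list" where "W \<equiv> subst_iter \<sigma>"

lemma H_data: "aiet_data (H k)"
  using base[of k] by (simp add: tower.g_data)

lemma len_pos: "lengths (H k) $ \<alpha> > 0"
  using H_data aiet_data.pos by blast

definition atoms :: "nat \<Rightarrow> ('a \<times> nat) set" where
  "atoms k = (SIGMA \<alpha>:UNIV. {..<length (W k \<alpha>)})"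

definition atom_left :: "nat \<Rightarrow> 'a \<times> nat \<Rightarrow> real" where
  "atom_left k p = (aiet_map (H 0) ^^ snd p) (left_t (H k) (fst p))"

definition atom_length :: "nat \<Rightarrow> 'a \<times> nat \<Rightarrow> real" where
  "atom_length k p = exp (psum (($) (c + s)) (W k (fst p)) (snd p)) * lengths (H k) $ fst p"

lemma atoms_idx: "atoms k = tower.idx (W k)"
  using base[of k] by (simp add: atoms_def tower.idx_def)

lemma atom_length_floor: "atom_length k p = tower.floor_length (H 0) (H k) (W k) p"
  using base[of k] by (simp add: atom_length_def tower.floor_length_def slopes0)

lemma atom_floor:
  "p \<in> atoms k \<Longrightarrow> tower.floor (H 0) (H k) p = {atom_left k p ..< atom_left k p + atom_length k p}"
  using tower.floor_eq[OF base[of k], of "snd p" "fst p"]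
  by (cases p) (simp add: atom_left_def atom_length_floor atoms_def)

section \<open>Lengths of floors under bounded distortion\<close>

lemma psum_perturb:
  "\<exists>B\<ge>0. \<forall>k \<alpha> i. \<bar>psum (($) (c + s)) (W k \<alpha>) i - psum (($) c) (W k \<alpha>) i\<bar> \<le> B"
proof -
  obtain B where "B \<ge> 0" "\<And>k \<alpha> i. \<bar>psum (($) s) (W k \<alpha>) i\<bar> \<le> B"
    using psum_subst_iter_bounded[OF stable] by blast
  moreover have "psum (($) (c + s)) ws i = psum (($) c) ws i + psum (($) s) ws i" for ws i
    using psum_add[of "($) c" "($) s" ws i] by (simp add: vector_add_component[abs_def])
  ultimately show ?thesis by auto
qed

text \<open>Upper bound: the floors fill length 1 and each partition sum grows like rc^k. Lower
  bound: the same identity bounds the sum of all base lengths from below; positivity of M transfers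
  this from level k + 1 to each single letter of level k, at bounded cost because the log-slopes of
  all levels are bounded.\<close>

lemma lengths_bounds: "\<exists>C\<ge>1. \<forall>k \<alpha>. lengths (H k) $ \<alpha> \<le> C / rc ^ k \<and> 1 / (C * rc ^ k) \<le> lengths (H k) $ \<alpha>"
proof -
  obtain B where B: "B \<ge> 0" "\<And>k \<alpha> i. \<bar>psum (($) (c + s)) (W k \<alpha>) i - psum (($) c) (W k \<alpha>) i\<bar> \<le> B"
    using psum_perturb by blast
  have eta_eq: "(subst_matrix \<sigma> c *v \<eta>) $ \<alpha> = rc * \<eta> $ \<alpha>" and eta_pos: "\<eta> $ \<alpha> > 0" for \<alpha>
    using eta by (auto simp: pf_vector_def)
  obtain C1 where C1: "C1 > 0" "\<And>k \<alpha>. C1 * rc ^ k \<le> partition_sum (($) c) (W k \<alpha>)"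
    using partition_sum_lower[OF fixed eta_pos, of rc] eta_eq rc_pos by auto
  obtain C2 where C2: "C2 > 0" "\<And>k \<alpha>. partition_sum (($) c) (W k \<alpha>) \<le> C2 * rc ^ k"
    using partition_sum_upper[OF fixed eta_pos, of rc] eta_eq rc_pos by auto
  have total: "(\<Sum>\<alpha>\<in>UNIV. partition_sum (($) (c + s)) (W k \<alpha>) * lengths (H k) $ \<alpha>) = 1" for k
  proof -
    have "1 = (\<Sum>p\<in>atoms k. atom_length k p)"
      using tower.total_length_floors[OF base[of k]] by (simp add: total1 atoms_idx atom_length_floor)
    also have "\<dots> = (\<Sum>\<alpha>\<in>UNIV. \<Sum>i<length (W k \<alpha>). atom_length k (\<alpha>, i))"
      unfolding atoms_def by (subst sum.Sigma) auto
    finally show ?thesis by (simp add: atom_length_def partition_sum_def sum_distrib_right)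
  qed
  have ps_le: "partition_sum (($) (c + s)) (W k \<alpha>) \<le> exp B * partition_sum (($) c) (W k \<alpha>)" for k \<alpha>
    unfolding partition_sum_def sum_distrib_left
  proof (intro sum_mono)
    fix i show "exp (psum (($) (c + s)) (W k \<alpha>) i) \<le> exp B * exp (psum (($) c) (W k \<alpha>) i)"
      using B(2)[of k \<alpha> i] by (simp add: mult_exp_exp abs_le_iff)
  qed
  have ps_ge: "exp (- B) * partition_sum (($) c) (W k \<alpha>) \<le> partition_sum (($) (c + s)) (W k \<alpha>)" for k \<alpha>
    unfolding partition_sum_def sum_distrib_left
  proof (intro sum_mono)
    fix i show "exp (- B) * exp (psum (($) c) (W k \<alpha>) i) \<le> exp (psum (($) (c + s)) (W k \<alpha>) i)"
      using B(2)[of k \<alpha> i] by (simp add: mult_exp_exp abs_le_iff)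
  qed
  have upper: "lengths (H k) $ \<alpha> \<le> (exp B / C1) / rc ^ k" for k \<alpha>
  proof -
    have "exp (- B) * (C1 * rc ^ k) * lengths (H k) $ \<alpha> \<le> exp (- B) * partition_sum (($) c) (W k \<alpha>) * lengths (H k) $ \<alpha>"
      using C1(2)[of k \<alpha>] len_pos[of k \<alpha>] by (intro mult_right_mono mult_left_mono) auto
    also have "\<dots> \<le> partition_sum (($) (c + s)) (W k \<alpha>) * lengths (H k) $ \<alpha>"
      using ps_ge len_pos[of k \<alpha>] by (intro mult_right_mono) auto
    also have "\<dots> \<le> (\<Sum>\<alpha>\<in>UNIV. partition_sum (($) (c + s)) (W k \<alpha>) * lengths (H k) $ \<alpha>)"
      using len_pos[of k] by (intro member_le_sum) (auto simp: partition_sum_def less_imp_le intro!: mult_nonneg_nonneg sum_nonneg)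
    finally have "exp (- B) * (C1 * rc ^ k) * lengths (H k) $ \<alpha> \<le> 1" by (simp add: total)
    then show ?thesis using C1(1) rc_pos by (simp add: exp_minus field_simps)
  qed
  have sum_lower: "1 / (exp B * C2 * rc ^ k) \<le> (\<Sum>\<alpha>\<in>UNIV. lengths (H k) $ \<alpha>)" for k
  proof -
    have "1 \<le> (\<Sum>\<alpha>\<in>UNIV. (exp B * (C2 * rc ^ k)) * lengths (H k) $ \<alpha>)"
      unfolding total[of k, symmetric]
    proof (intro sum_mono mult_right_mono)
      fix \<alpha>
      have "exp B * partition_sum (($) c) (W k \<alpha>) \<le> exp B * (C2 * rc ^ k)"
        by (intro mult_left_mono C2) auto
      then show "partition_sum (($) (c + s)) (W k \<alpha>) \<le> exp B * (C2 * rc ^ k)"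
        using ps_le[of k \<alpha>] by linarith
    qed (use len_pos in \<open>auto simp: less_imp_le\<close>)
    then have "1 \<le> (exp B * C2 * rc ^ k) * (\<Sum>\<alpha>\<in>UNIV. lengths (H k) $ \<alpha>)"
      by (simp add: sum_distrib_left mult.assoc)
    moreover have "exp B * C2 * rc ^ k > 0" using C2(1) rc_pos by simp
    ultimately show ?thesis by (simp add: pos_divide_le_eq mult.commute)
  qed
  \<comment> \<open>The log-slope at level k is a total over a full word: \<open>c\<close>
    contributes \<open>c $ \<alpha>\<close>, being fixed, and \<open>s\<close> at most
    \<open>B\<close>.\<close>
  define b where "b = norm c + B"
  have slopes_le: "\<bar>slopes (H k) $ \<alpha>\<bar> \<le> b" for k \<alpha>
  proof -
    have "slopes (H k) $ \<alpha> = (\<Sum>\<beta>\<leftarrow>W k \<alpha>. slopes (H 0) $ \<beta>)"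
      using tower.tower[OF base[of k]] by (simp add: tower_over_def)
    then have 1: "slopes (H k) $ \<alpha> = psum (($) (c + s)) (W k \<alpha>) (length (W k \<alpha>))"
      by (simp add: psum_def slopes0)
    have 2: "psum (($) c) (W k \<alpha>) (length (W k \<alpha>)) = c $ \<alpha>"
      by (simp add: psum_def sum_list_subst_iter fixed_power[OF fixed])
    have "\<bar>c $ \<alpha>\<bar> \<le> norm c" by (rule component_le_norm_cart)
    then show ?thesis using B(2)[of k \<alpha> "length (W k \<alpha>)"] unfolding 1 2 b_def by linarith
  qed
  have psum_le: "\<bar>psum v ws i\<bar> \<le> real (length ws) * b" if "\<And>\<beta>. \<bar>v \<beta>\<bar> \<le> b" for v ws i
  proof -
    have b0: "b \<ge> 0" using that[of undefined] by linarith
    have "\<bar>sum_list (map v ys)\<bar> \<le> real (length ys) * b" for ys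
    proof (induction ys)
      case (Cons y ys)
      then show ?case using that[of y] by (simp add: algebra_simps)
    qed simp
    then have "\<bar>psum v ws i\<bar> \<le> real (length (take i ws)) * b" unfolding psum_def .
    also have "\<dots> \<le> real (length ws) * b" using b0 by (intro mult_right_mono) auto
    finally show ?thesis .
  qed
  define Q where "Q = real (Max (range (\<lambda>\<alpha>. length (\<sigma> \<alpha>))))"
  have Q: "real (length (\<sigma> \<alpha>)) \<le> Q" for \<alpha> unfolding Q_def by (intro of_nat_mono Max_ge) auto
  have b0: "b \<ge> 0" using B by (simp add: b_def)
  \<comment> \<open>Over \<alpha>, the tower of one more level has a floor inside the interval of
    \<beta>.\<close>
  have lower1: "exp (- (Q * b)) * lengths (H (Suc k)) $ \<alpha> \<le> lengths (H k) $ \<beta>" for k \<alpha> \<beta>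
  proof -
    interpret st: tower "H k" "H (Suc k)" \<sigma> by (rule step)
    obtain j where j: "j < length (\<sigma> \<alpha>)" "\<sigma> \<alpha> ! j = \<beta>"
      using M_pos[of \<alpha> \<beta>] subst_matrix_pos_iff by blast
    have "\<bar>psum (($) (slopes (H k))) (\<sigma> \<alpha>) j\<bar> \<le> real (length (\<sigma> \<alpha>)) * b" by (intro psum_le slopes_le)
    also have "\<dots> \<le> Q * b" by (intro mult_right_mono Q b0)
    finally have "exp (- (Q * b)) * lengths (H (Suc k)) $ \<alpha> \<le> st.floor_length (\<alpha>, j)"
      unfolding st.floor_length_def fst_conv snd_conv using len_pos[of "Suc k" \<alpha>] by (intro mult_right_mono) auto
    also have "\<dots> \<le> (\<Sum>p\<in>{p \<in> st.idx. \<sigma> (fst p) ! snd p = \<beta>}. st.floor_length p)"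
      using j st.floor_length_pos by (intro member_le_sum) (auto simp: st.idx_iff st.finite_idx less_imp_le)
    finally show ?thesis by (simp add: st.lengths_floors)
  qed
  \<comment> \<open>The factor \<open>rc\<close> pays for the shift by one level,
    \<open>real CARD('a)\<close> for the sum over all letters.\<close>
  define C3 where "C3 = exp B * C2 * rc * real CARD('a) * exp (Q * b)"
  have C3: "C3 > 0" using C2 rc_pos by (simp add: C3_def)
  have lower: "1 / (C3 * rc ^ k) \<le> lengths (H k) $ \<beta>" for k \<beta>
  proof -
    have "exp (- (Q * b)) * (1 / (exp B * C2 * rc ^ Suc k)) \<le> exp (- (Q * b)) * (\<Sum>\<alpha>\<in>UNIV. lengths (H (Suc k)) $ \<alpha>)"
      by (intro mult_left_mono sum_lower) auto
    also have "\<dots> \<le> (\<Sum>\<alpha>\<in>(UNIV::'a set). lengths (H k) $ \<beta>)"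
      unfolding sum_distrib_left by (intro sum_mono lower1)
    also have "\<dots> = real CARD('a) * lengths (H k) $ \<beta>" by simp
    finally show ?thesis using C2(1) rc_pos C3 by (simp add: C3_def exp_minus field_simps)
  qed
  define C where "C = max 1 (max (exp B / C1) C3)"
  have C: "C \<ge> 1" "exp B / C1 \<le> C" "C3 \<le> C" by (auto simp: C_def)
  show ?thesis
  proof (intro exI[of _ C] conjI allI)
    fix k \<alpha>
    have "(exp B / C1) / rc ^ k \<le> C / rc ^ k" using C rc_pos by (intro divide_right_mono) auto
    then show "lengths (H k) $ \<alpha> \<le> C / rc ^ k" using upper[of k \<alpha>] by linarith
    have "1 / (C * rc ^ k) \<le> 1 / (C3 * rc ^ k)" using C C3 rc_pos by (intro divide_left_mono mult_right_mono) auto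
    then show "1 / (C * rc ^ k) \<le> lengths (H k) $ \<alpha>" using lower[of k \<alpha>] by linarith
  qed (use C in auto)
qed

lemma atom_length_bounds:
  "\<exists>A\<ge>0. \<forall>k \<alpha> i. \<bar>ln (atom_length k (\<alpha>, i)) - (psum (($) c) (W k \<alpha>) i - real k * ln rc)\<bar> \<le> A"
proof -
  obtain B where B: "B \<ge> 0" "\<And>k \<alpha> i. \<bar>psum (($) (c + s)) (W k \<alpha>) i - psum (($) c) (W k \<alpha>) i\<bar> \<le> B"
    using psum_perturb by blast
  obtain C where C: "C \<ge> 1" "\<And>k \<alpha>. lengths (H k) $ \<alpha> \<le> C / rc ^ k"
      "\<And>k \<alpha>. 1 / (C * rc ^ k) \<le> lengths (H k) $ \<alpha>"
    using lengths_bounds by blast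
  have "\<bar>ln (atom_length k (\<alpha>, i)) - (psum (($) c) (W k \<alpha>) i - real k * ln rc)\<bar> \<le> B + ln C" for k \<alpha> i
  proof -
    have "ln (lengths (H k) $ \<alpha>) \<le> ln (C / rc ^ k)" using C(2)[of k \<alpha>] len_pos[of k \<alpha>] C(1) rc_pos by simp
    moreover have "ln (1 / (C * rc ^ k)) \<le> ln (lengths (H k) $ \<alpha>)" using C(3)[of k \<alpha>] len_pos[of k \<alpha>] C(1) rc_pos
      by (subst ln_le_cancel_iff) auto
    moreover have "ln (C / rc ^ k) = ln C - real k * ln rc" "ln (1 / (C * rc ^ k)) = - ln C - real k * ln rc"
      using C(1) rc_pos by (simp_all add: ln_div ln_mult ln_realpow)
    moreover have "ln (atom_length k (\<alpha>, i)) = psum (($) (c + s)) (W k \<alpha>) i + ln (lengths (H k) $ \<alpha>)"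
      using len_pos[of k \<alpha>] by (simp add: atom_length_def ln_mult)
    ultimately show ?thesis using B(2)[of k \<alpha> i] by linarith
  qed
  moreover have "B + ln C \<ge> 0" using B C by simp
  ultimately show ?thesis by blast
qed

lemma atom_length_pos: "atom_length k p > 0"
  using len_pos by (simp add: atom_length_def)

lemma atoms_finite: "finite (atoms k)" by (simp add: atoms_def)

text \<open>The additive error \<open>A\<close> of the log-lengths is absorbed by k \<epsilon> / 2
  once k is at least 2 A / \<epsilon>.\<close>

lemma atom_deviation:
  assumes eps: "\<epsilon> > 0"
  shows "\<exists>k0. \<forall>k\<ge>k0. \<forall>\<alpha> i.
    (atom_length k (\<alpha>, i) > exp (- real k * (ln rc - mean - \<epsilon>)) \<longrightarrow>
      real k * (mean + \<epsilon> / 2) \<le> psum (($) c) (W k \<alpha>) i) \<and>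
    (atom_length k (\<alpha>, i) < exp (- real k * (ln rc - mean + \<epsilon>)) \<longrightarrow>
      psum (($) c) (W k \<alpha>) i \<le> real k * (mean - \<epsilon> / 2))"
proof -
  obtain A where A: "A \<ge> 0" "\<And>k \<alpha> i. \<bar>ln (atom_length k (\<alpha>, i)) - (psum (($) c) (W k \<alpha>) i - real k * ln rc)\<bar> \<le> A"
    using atom_length_bounds by blast
  obtain k0 :: nat where k0: "2 * A / \<epsilon> \<le> real k0" using real_arch_simple by blast
  show ?thesis
  proof (intro exI[of _ k0] allI impI conjI)
    fix k \<alpha> i assume "k \<ge> k0"
    then have "2 * A / \<epsilon> \<le> real k" using k0 by linarith
    then have Ak: "A \<le> real k * (\<epsilon> / 2)" using eps by (simp add: pos_divide_le_eq)
    {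
      assume "atom_length k (\<alpha>, i) > exp (- real k * (ln rc - mean - \<epsilon>))"
      then have "ln (atom_length k (\<alpha>, i)) > - real k * (ln rc - mean - \<epsilon>)"
        using atom_length_pos by (metis ln_exp ln_less_cancel_iff exp_gt_zero)
      then show "real k * (mean + \<epsilon> / 2) \<le> psum (($) c) (W k \<alpha>) i"
        using A(2)[of k \<alpha> i] Ak by (simp add: algebra_simps abs_le_iff)
    }
    assume "atom_length k (\<alpha>, i) < exp (- real k * (ln rc - mean + \<epsilon>))"
    then have "ln (atom_length k (\<alpha>, i)) < - real k * (ln rc - mean + \<epsilon>)"
      using atom_length_pos by (metis ln_exp ln_less_cancel_iff exp_gt_zero)
    then show "psum (($) c) (W k \<alpha>) i \<le> real k * (mean - \<epsilon> / 2)"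
      using A(2)[of k \<alpha> i] Ak by (simp add: algebra_simps abs_le_iff)
  qed
qed

lemma few_atoms:
  assumes P: "\<And>k \<alpha> i. k \<ge> k0 \<Longrightarrow> P k (\<alpha>, i) \<Longrightarrow> Q k \<alpha> i"
    and Q: "\<exists>\<delta>>0. \<exists>C>0. \<forall>k. real (card (SIGMA \<alpha>:UNIV. {i. i < length (W k \<alpha>) \<and> Q k \<alpha> i})) \<le>
      C * (r * exp (- \<delta>)) ^ k"
  shows "\<exists>\<delta>>0. \<exists>B k0. \<forall>k\<ge>k0. real (card {p \<in> atoms k. P k p}) \<le> B * (r * exp (- \<delta>)) ^ k"
proof -
  let ?S = "\<lambda>k. SIGMA \<alpha>:UNIV. {i. i < length (W k \<alpha>) \<and> Q k \<alpha> i}"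
  obtain \<delta> B where dB: "\<delta> > 0" "\<And>k. real (card (?S k)) \<le> B * (r * exp (- \<delta>)) ^ k" using Q by blast
  have "real (card {p \<in> atoms k. P k p}) \<le> B * (r * exp (- \<delta>)) ^ k" if "k \<ge> k0" for k
  proof -
    have "{p \<in> atoms k. P k p} \<subseteq> ?S k" using P[OF that] by (auto simp: atoms_def)
    then have "card {p \<in> atoms k. P k p} \<le> card (?S k)" by (intro card_mono finite_SigmaI) auto
    then show ?thesis using dB(2)[of k] by linarith
  qed
  then show ?thesis using dB(1) by blast
qed

lemma few_long_atoms:
  assumes "\<epsilon> > 0"
  shows "\<exists>\<delta>>0. \<exists>B k0. \<forall>k\<ge>k0. real (card {p \<in> atoms k. atom_length k p >
    exp (- real k * (ln rc - mean - \<epsilon>))}) \<le> B * (r * exp (- \<delta>)) ^ k"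
proof -
  obtain k0 where "\<forall>k\<ge>k0. \<forall>\<alpha> i. atom_length k (\<alpha>, i) > exp (- real k * (ln rc - mean - \<epsilon>)) \<longrightarrow>
      real k * (mean + \<epsilon> / 2) \<le> psum (($) c) (W k \<alpha>) i"
    using atom_deviation[OF assms] by blast
  then show ?thesis using large_deviation_upper[of "\<epsilon> / 2"] assms
    by (intro few_atoms[of k0 _ "\<lambda>k \<alpha> i. real k * (mean + \<epsilon> / 2) \<le> psum (($) c) (W k \<alpha>) i"]) auto
qed

lemma few_short_atoms:
  assumes "\<epsilon> > 0"
  shows "\<exists>\<delta>>0. \<exists>B k0. \<forall>k\<ge>k0. real (card {p \<in> atoms k. atom_length k p <
    exp (- real k * (ln rc - mean + \<epsilon>))}) \<le> B * (r * exp (- \<delta>)) ^ k"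
proof -
  obtain k0 where "\<forall>k\<ge>k0. \<forall>\<alpha> i. atom_length k (\<alpha>, i) < exp (- real k * (ln rc - mean + \<epsilon>)) \<longrightarrow>
      psum (($) c) (W k \<alpha>) i \<le> real k * (mean - \<epsilon> / 2)"
    using atom_deviation[OF assms] by blast
  then show ?thesis using large_deviation_lower[OF pf_subst_axioms, of "\<epsilon> / 2"] assms
    by (intro few_atoms[of k0 _ "\<lambda>k \<alpha> i. psum (($) c) (W k \<alpha>) i \<le> real k * (mean - \<epsilon> / 2)"]) auto
qed

lemma dimension: "measure_hausdorff_dim \<mu> = ennreal (ln r / (ln rc - mean))"
proof -
  have prob: "prob_space \<mu>" and sets: "sets \<mu> = sets borel" and dom1: "emeasure \<mu> (domain (H 0)) = 1"
    and invm: "distr \<mu> borel (aiet_map (H 0)) = \<mu>"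
    using inv by (auto simp: invariant_prob_def)
  interpret prob_space \<mu> by fact
  have dom1': "measure \<mu> (domain (H 0)) = 1" using dom1 by (simp add: emeasure_eq_measure)
  obtain C1 where C1: "C1 > 0" "\<And>k \<alpha>. real (length (W k \<alpha>)) \<le> C1 * r ^ k"
    using subst_iter_length_bounds(1)[OF right r_pos] by blast
  obtain C2 where C2: "C2 > 0" "\<And>k \<alpha>. C2 * r ^ k \<le> real (length (W k \<alpha>))"
    using subst_iter_length_bounds(2)[OF right r_pos] by blast
  define C where "C = max (real CARD('a) * C1) (1 / C2)"
  have C: "C > 0" "real CARD('a) * C1 \<le> C" "1 / C2 \<le> C" using C2(1) by (auto simp: C_def less_max_iff_disj)
  have floors: "(\<Union>p\<in>atoms k. {atom_left k p ..< atom_left k p + atom_length k p}) = domain (H 0)" for k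
    using tower.domain_floors[OF base[of k]] atom_floor[of _ k] by (simp add: atoms_idx)
  have mass_eq: "measure \<mu> {atom_left k p ..< atom_left k p + atom_length k p} = measure \<mu> (interval (H k) (fst p))"
    if "p \<in> atoms k" for k p
    using tower.measure_floor_invariant[OF base[of k] invm sets, of "snd p" "fst p"] atom_floor[OF that] that
    by (cases p) (simp add: atoms_def)
  have mass_sum: "(\<Sum>\<alpha>\<in>UNIV. real (length (W k \<alpha>)) * measure \<mu> (interval (H k) \<alpha>)) = 1" for k
  proof -
    have "1 = (\<Sum>p\<in>atoms k. measure \<mu> (tower.floor (H 0) (H k) p))"
      using tower.measure_domain_floors[OF base[of k] finite_measure_axioms sets] dom1' by (simp add: atoms_idx)
    also have "\<dots> = (\<Sum>p\<in>atoms k. measure \<mu> (interval (H k) (fst p)))"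
      by (intro sum.cong) (auto simp: atom_floor mass_eq)
    also have "\<dots> = (\<Sum>\<alpha>\<in>UNIV. \<Sum>i<length (W k \<alpha>). measure \<mu> (interval (H k) \<alpha>))"
      unfolding atoms_def by (subst sum.Sigma) (auto simp: case_prod_unfold)
    finally show ?thesis by simp
  qed
  \<comment> \<open>The floors over \<alpha> have equal mass and total mass at most 1, so each has
    at most the inverse of the length of the word.\<close>
  have mass: "measure \<mu> (interval (H k) \<alpha>) \<le> C / r ^ k" for k \<alpha>
  proof -
    have "(C2 * r ^ k) * measure \<mu> (interval (H k) \<alpha>) \<le> real (length (W k \<alpha>)) * measure \<mu> (interval (H k) \<alpha>)"
      by (intro mult_right_mono C2) auto
    also have "\<dots> \<le> (\<Sum>\<alpha>\<in>UNIV. real (length (W k \<alpha>)) * measure \<mu> (interval (H k) \<alpha>))"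
      by (intro member_le_sum) auto
    finally have "(C2 * r ^ k) * measure \<mu> (interval (H k) \<alpha>) \<le> 1" by (simp add: mass_sum)
    then have "measure \<mu> (interval (H k) \<alpha>) \<le> (1 / C2) / r ^ k" using C2(1) r_pos by (simp add: field_simps)
    also have "\<dots> \<le> C / r ^ k" using C r_pos by (intro divide_right_mono) auto
    finally show ?thesis .
  qed
  interpret atom_system \<mu> atoms atom_left atom_length r C "ln rc - mean"
  proof
    show "finite (atoms k)" for k by (rule atoms_finite)
    show "p = q" if "p \<in> atoms k" "q \<in> atoms k" "x \<in> {atom_left k p ..< atom_left k p + atom_length k p}"
      "x \<in> {atom_left k q ..< atom_left k q + atom_length k q}" for p q k x
      using tower.floor_disjoint[OF base[of k], of p q x] that by (simp add: atoms_idx[symmetric] atom_floor)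
    show "measure \<mu> (\<Union>p\<in>atoms k. {atom_left k p ..< atom_left k p + atom_length k p}) = 1" for k
      by (simp add: floors dom1')
    show "real (card (atoms k)) \<le> C * r ^ k" for k
    proof -
      have "real (card (atoms k)) = (\<Sum>\<alpha>\<in>UNIV. real (length (W k \<alpha>)))"
        unfolding atoms_def by (subst card_SigmaI) auto
      also have "\<dots> \<le> (\<Sum>\<alpha>\<in>(UNIV::'a set). C1 * r ^ k)" by (intro sum_mono C1)
      also have "\<dots> = (real CARD('a) * C1) * r ^ k" by simp
      also have "\<dots> \<le> C * r ^ k" using C r_pos by (intro mult_right_mono) auto
      finally show ?thesis .
    qed
    show "measure \<mu> {atom_left k p ..< atom_left k p + atom_length k p} \<le> C / r ^ k" if "p \<in> atoms k" for k p
      using mass_eq[OF that] mass by simp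
    have "0 < ln r" using r_gt_1 by simp
    then show "0 < ln rc - mean" using gap by linarith
  qed (use prob sets r_gt_1 C few_long_atoms few_short_atoms atom_length_pos in \<open>auto simp: prob_space_def\<close>)
  show ?thesis by (rule measure_hausdorff_dim_atoms)
qed

end

theorem theorem1p2:
  fixes T f :: "('a::finite) aiet" and \<omega> :: "real^'a" and N :: nat and \<mu> :: "real measure"
  assumes "CARD('a) \<ge> 2"
    and "hyperbolic_periodic_type T"
    and "positive_period T N"
    and "central_stable_type T N \<omega>"
    and "f \<in> Aff T \<omega>"
    and "invariant_prob f \<mu>"
  shows "measure_hausdorff_dim \<mu> = ennreal (rho T N / G_const T N \<omega>) \<and>
         0 < rho T N / G_const T N \<omega> \<and> rho T N / G_const T N \<omega> < 1"
proof -
  define \<sigma> where "\<sigma> = rv_word (rotation_number T) N"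
  have T: "is_aiet T" "slopes T = 0" "total_length T = 1" "infinitely_renormalizable T"
    using assms(2) by (auto simp: hyperbolic_periodic_type_def self_similar_def is_iet_def infinity_complete_def)
  have per: "rotation_number T (n + N) = rotation_number T n" for n
    using assms(3) by (simp add: positive_period_def is_period_def)
  have f: "is_aiet f" "slopes f = \<omega>" "total_length f = 1" "infinitely_renormalizable f"
    and rot: "rotation_number f = rotation_number T"
    using assms(5) by (auto simp: Aff_def)
  define HT where "HT k = rv_iter (k * N) T" for k
  define H where "H k = rv_iter (k * N) f" for k
  have HT0: "HT 0 = T" and H0: "H 0 = f" by (simp_all add: HT_def H_def rv_iter_def)
  interpret TT: periodic_tower HT \<sigma>
    unfolding HT_def \<sigma>_def by (rule periodic_tower_rv_iter[OF T(1) assms(1) T(4) per])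
  \<comment> \<open>Equality of the rotation numbers makes \<sigma> the substitution of
    \<open>f\<close> as well.\<close>
  interpret FF: periodic_tower H \<sigma>
    unfolding H_def \<sigma>_def rot[symmetric]
    by (rule periodic_tower_rv_iter[OF f(1) assms(1) f(4)]) (simp add: rot per)
  have towN: "tower T (rv_iter N T) \<sigma>"
    using TT.step[of 0] by (simp add: HT0) (simp add: HT_def)
  note words = tower_rv_iter[OF towN]
  let ?M = "subst_matrix \<sigma> 0"
  have M_pos: "?M $ \<alpha> $ \<beta> > 0" for \<alpha> \<beta>
    using assms(3) words(2) by (simp add: positive_period_def)
  \<comment> \<open>The entries count floors, so positive ones are at least 1.\<close>
  have M_ge1: "?M $ \<alpha> $ \<beta> \<ge> 1" for \<alpha> \<beta>
    using M_pos[of \<alpha> \<beta>] by (simp add: subst_matrix_def psum_zero)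
  obtain c s where split: "eigen_splitting ?M \<omega> 0 c s" and c0: "c \<noteq> 0"
    using assms(4) words(2) by (auto simp: central_stable_type_def)
  have cs: "\<omega> = c + s" and fixed: "?M *v c = c" and stab: "s \<in> contracting_space ?M"
    using split by (auto simp: eigen_splitting_def fixed_space_def)
  have central: "central_part (self_similarity_matrix T N) \<omega> = c"
    using central_part_eq[OF split] words(2) by simp
  obtain r \<theta>0 where r: "r > 0" and \<theta>0: "pf_vector ?M r \<theta>0" using pf_vector_exists[OF M_pos] by blast
  have Mt_pos: "transpose ?M $ \<alpha> $ \<beta> > 0" for \<alpha> \<beta> using M_pos by (simp add: transpose_def)
  obtain r' l0 where l0: "pf_vector (transpose ?M) r' l0" using pf_vector_exists[OF Mt_pos] by blast
  have rr: "r' = r" using pf_value_unique_transpose[OF \<theta>0 l0] by simp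
  have rho: "rho T N = ln r" using pf_eigenvalue_eq[OF M_pos \<theta>0] words(2) by (simp add: rho_def)
  have T_data: "aiet_data (HT k)" for k using TT.base[of k] by (simp add: tower.g_data)
  have T_slopes: "slopes (HT k) = 0" for k
    using tower.tower[OF TT.base[of k]] T(2) by (simp add: HT0 tower_over_def vec_eq_iff sum_list_0)
  \<comment> \<open>For T all floors of a tower are as long as the base, so counting floors in an
    interval expresses the lengths of level k through those of level k + 1.\<close>
  have T_step: "lengths (HT k) = transpose ?M *v lengths (HT (Suc k))" for k
  proof -
    interpret st: tower "HT k" "HT (Suc k)" \<sigma> by (rule TT.step)
    have "lengths (HT k) $ \<beta> = (transpose ?M *v lengths (HT (Suc k))) $ \<beta>" for \<beta>
    proof -
      have "{p \<in> st.idx. \<sigma> (fst p) ! snd p = \<beta>} = (SIGMA \<alpha>:UNIV. {i. i < length (\<sigma> \<alpha>) \<and> \<sigma> \<alpha> ! i = \<beta>})"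
        by (auto simp: st.idx_def)
      then have "lengths (HT k) $ \<beta> =
          (\<Sum>p\<in>(SIGMA \<alpha>:UNIV. {i. i < length (\<sigma> \<alpha>) \<and> \<sigma> \<alpha> ! i = \<beta>}). lengths (HT (Suc k)) $ fst p)"
        by (simp add: st.lengths_floors st.floor_length_def T_slopes psum_zero)
      also have "\<dots> = (\<Sum>\<alpha>\<in>UNIV. \<Sum>i\<in>{i. i < length (\<sigma> \<alpha>) \<and> \<sigma> \<alpha> ! i = \<beta>}. lengths (HT (Suc k)) $ \<alpha>)"
        by (subst sum.Sigma) (auto simp: case_prod_unfold)
      finally show ?thesis
        by (simp add: matrix_vector_mult_def transpose_def subst_matrix_def psum_zero del: transpose_matrix_vector)
    qed
    then show ?thesis by (simp add: vec_eq_iff)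
  qed
  define l where "l = lengths T"
  have l_pos: "l $ \<alpha> > 0" for \<alpha> using aiet_data.pos[OF T_data[of 0]] by (simp add: l_def HT0)
  \<comment> \<open>The lengths of all levels form an infinite positive backward orbit of the
    transpose, which forces an eigenvector.\<close>
  have left: "pf_vector (transpose ?M) r l"
  proof -
    have "transpose ?M *v lengths (HT 0) = r *s lengths (HT 0)"
      using pf_backward_orbit[OF Mt_pos l0[unfolded rr], of "\<lambda>k. lengths (HT k)"] T_step
        aiet_data.pos[OF T_data] by blast
    then show ?thesis using l_pos by (simp add: pf_vector_def l_def HT0 del: transpose_matrix_vector)
  qed
  have l\<theta>0: "l \<bullet> \<theta>0 > 0"
    unfolding inner_vec_def using l_pos \<theta>0 by (intro sum_pos) (auto simp: pf_vector_def)
  define \<theta> where "\<theta> = (1 / (l \<bullet> \<theta>0)) *\<^sub>R \<theta>0"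
  have right: "pf_vector ?M r \<theta>"
    using \<theta>0 l\<theta>0 by (simp add: pf_vector_def \<theta>_def matrix_vector_mult_scaleR vec_eq_iff)
  have normal: "l \<bullet> \<theta> = 1" using l\<theta>0 by (simp add: \<theta>_def)
  have theta: "theta T N = \<theta>"
    unfolding theta_def rho exp_ln[OF r] words(2) l_def[symmetric]
  proof (rule the_equality)
    show "(\<forall>\<alpha>. 0 < \<theta> $ \<alpha>) \<and> ?M *v \<theta> = r *s \<theta> \<and> l \<bullet> \<theta> = 1"
      using right normal by (simp add: pf_vector_def)
    fix v assume v: "(\<forall>\<alpha>. 0 < v $ \<alpha>) \<and> ?M *v v = r *s v \<and> l \<bullet> v = 1"
    then obtain x where "v = x *s \<theta>" using pf_vector_unique[OF M_pos right] by blast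
    then show "v = \<theta>" using v normal by (simp add: scalar_mult_eq_scaleR)
  qed
  \<comment> \<open>Summing the eigenvector equation, with entries at least 1, gives r \<ge> d \<ge>
    2.\<close>
  have r1: "r > 1"
  proof -
    have \<theta>_pos: "\<theta> $ \<alpha> > 0" for \<alpha> using right by (simp add: pf_vector_def)
    have "(\<Sum>\<beta>\<in>UNIV. \<theta> $ \<beta>) \<le> r * \<theta> $ \<alpha>" for \<alpha>
    proof -
      have "r * \<theta> $ \<alpha> = (?M *v \<theta>) $ \<alpha>" using right by (simp add: pf_vector_def)
      also have "\<dots> \<ge> (\<Sum>\<beta>\<in>UNIV. 1 * \<theta> $ \<beta>)"
        unfolding matrix_vector_mult_def vec_lambda_beta using M_ge1 \<theta>_pos
        by (intro sum_mono mult_right_mono) (auto simp: less_imp_le)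
      finally show ?thesis by simp
    qed
    then have "(\<Sum>\<alpha>\<in>(UNIV::'a set). \<Sum>\<beta>\<in>UNIV. \<theta> $ \<beta>) \<le> (\<Sum>\<alpha>\<in>UNIV. r * \<theta> $ \<alpha>)" by (intro sum_mono)
    then have "real CARD('a) * (\<Sum>\<beta>\<in>UNIV. \<theta> $ \<beta>) \<le> r * (\<Sum>\<beta>\<in>UNIV. \<theta> $ \<beta>)"
      by (simp add: sum_distrib_left)
    moreover have "(\<Sum>\<beta>\<in>UNIV. \<theta> $ \<beta>) > 0" using \<theta>_pos by (intro sum_pos) auto
    ultimately have "real CARD('a) \<le> r" by simp
    then show ?thesis using assms(1) by linarith
  qed
  interpret P: pf_subst \<sigma> r l \<theta> c
    using M_pos r left right normal fixed by unfold_locales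
  have Mc_pos: "subst_matrix \<sigma> c $ \<alpha> $ \<beta> > 0" for \<alpha> \<beta>
    using M_pos[of \<alpha> \<beta>] by (simp only: subst_matrix_pos_iff)
  obtain rc \<eta> where rc: "rc > 0" and eta: "pf_vector (subst_matrix \<sigma> c) rc \<eta>" using pf_vector_exists[OF Mc_pos] by blast
  have G: "G_const T N \<omega> = ln rc - P.mean"
  proof -
    have "(\<Sum>\<alpha>\<in>UNIV. \<Sum>i<rv_height T N \<alpha>. theta T N $ tower_letter T N \<alpha> i * exp (- rho T N) *
        lengths T $ \<alpha> * tower_sum T N c i \<alpha>) = P.mean"
      unfolding P.mean_def
      by (intro sum.cong) (auto simp: words(1,3,4) theta rho P.\<psi>_def l_def exp_minus r inverse_eq_divide)
    then show ?thesis
      using pf_eigenvalue_eq[OF Mc_pos eta] by (simp add: G_const_def Let_def central words(5))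
  qed
  \<comment> \<open>The domain of level k shrinks to the point 0, while the leftmost interval of T
    has positive length; once it fits inside, every tower starts there.\<close>
  have first: "\<exists>k \<alpha>0. \<forall>\<alpha>. subst_iter \<sigma> k \<alpha> ! 0 = \<alpha>0"
  proof -
    obtain \<alpha>0 where a0: "\<And>\<beta>. pos_t T \<alpha>0 \<le> pos_t T \<beta>"
      using ex_has_least_nat[of "\<lambda>_. True" _ "pos_t T"] by blast
    have left0: "left_t T \<alpha>0 = 0" using a0 by (simp add: left_t_def not_less[symmetric])
    obtain C where C: "C > 0" "\<And>k \<alpha>. C * r ^ k \<le> real (length (subst_iter \<sigma> k \<alpha>))"
      using subst_iter_length_bounds(2)[OF right r] by blast
    \<comment> \<open>The at least C r^k floors over each letter are disjoint translates of its base
      and lie in [0, 1).\<close>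
    have tot: "total_length (HT k) \<le> (1 / C) * (1 / r) ^ k" for k
    proof -
      interpret ba: tower T "HT k" "subst_iter \<sigma> k" using TT.base[of k] by (simp add: HT0)
      have "1 = (\<Sum>(\<alpha>, i)\<in>ba.idx. lengths (HT k) $ \<alpha>)"
        using ba.total_length_floors by (simp add: T(2,3) ba.floor_length_def psum_zero case_prod_unfold)
      also have "\<dots> = (\<Sum>\<alpha>\<in>UNIV. real (length (subst_iter \<sigma> k \<alpha>)) * lengths (HT k) $ \<alpha>)"
        by (simp add: ba.sum_idx)
      also have "\<dots> \<ge> (\<Sum>\<alpha>\<in>UNIV. (C * r ^ k) * lengths (HT k) $ \<alpha>)"
        using C(2) ba.g.pos by (intro sum_mono mult_right_mono) (auto simp: less_imp_le)
      finally have "(C * r ^ k) * total_length (HT k) \<le> 1" by (simp add: total_length_def sum_distrib_left)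
      then show ?thesis using C(1) r by (simp add: power_divide field_simps)
    qed
    have "(\<lambda>k. (1 / C) * (1 / r) ^ k) \<longlonglongrightarrow> (1 / C) * 0"
      using r1 by (intro tendsto_mult tendsto_const LIMSEQ_power_zero) auto
    then have "eventually (\<lambda>k. (1 / C) * (1 / r) ^ k < l $ \<alpha>0) sequentially"
      using l_pos[of \<alpha>0] by (intro order_tendstoD) auto
    then obtain k where k: "(1 / C) * (1 / r) ^ k < l $ \<alpha>0" by (auto simp: eventually_sequentially)
    interpret ba: tower T "HT k" "subst_iter \<sigma> k" using TT.base[of k] by (simp add: HT0)
    have "subst_iter \<sigma> k \<alpha> ! 0 = \<alpha>0" for \<alpha>
    proof -
      let ?x = "left_t (HT k) \<alpha>"
      have x: "?x \<in> interval (HT k) \<alpha>" by (rule ba.left_in_interval)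
      have ne: "0 < length (subst_iter \<sigma> k \<alpha>)" using ba.tower by (simp add: tower_over_def)
      have 1: "?x \<in> interval T (subst_iter \<sigma> k \<alpha> ! 0)"
        using visits_nth[OF ba.visits_word[OF x] ne] by simp
      have "0 \<le> ?x" "?x < l $ \<alpha>0"
        using ba.g.interval_domain[OF x] tot[of k] k by (auto simp: domain_def)
      then have "?x \<in> interval T \<alpha>0" by (simp add: interval_def left0 l_def)
      then show ?thesis using 1 ba.f.interval_unique by blast
    qed
    then show ?thesis by blast
  qed
  have gap: "ln r < ln rc - P.mean" using first P.mean_strict[OF c0 assms(1) eta rc] by blast
  interpret central_stable_tower H \<sigma> r l \<theta> c \<mu> s rc \<eta>
    using f cs assms(6) contracting_summable[OF stab] r1 rc eta gap by unfold_locales (simp_all add: H0)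
  have "ln r > 0" using r1 by simp
  then have "0 < ln r / (ln rc - P.mean)" "ln r / (ln rc - P.mean) < 1" using gap by simp_all
  then show ?thesis using dimension by (simp add: rho G)
qed

end
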